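(* Let $g\ge 1$ and let $\Sigma_g$ be the closed oriented surface of genus $g$. The set of Witt classes of all representations of $\pi_1(\Sigma_g)$ in $SL(2,\mathbf Q)$ is equal to the set of elements of $I^2(\mathbf Q)$ with norm $\le 4(g-1)$.
   Context: Let $K=\mathbf Q$, $K^*=K\setminus\{0\}$; $W(K)$ is the Witt ring of nondegenerate symmetric bilinear forms over $K$; for $a\in K^*$, $[a]\in W(K)$ is the class of the 1-dimensional form $\langle a\rangle$, and $[0]:=0$. $I(K)\subset W(K)$ is the fundamental ideal (classes of forms on even-dimensional spaces) and $I^2(K)$ is its square. The norm $\|x\|$ of $x\in W(K)$ is the dimension of the (unique up to isomorphism) anisotropic form representing $x$. The Witt class $w\in H^2(SL(2,K),W(K))$ (cohomology of the discrete group, constant coefficients) is represented by the non-homogeneous cocycle $w(a,b)=[-a_{21}\cdot(ab)_{21}\cdot b_{21}]$, where $m_{21}$ is the $(2,1)$ entry of $m$. The Witt class of a representation $\rho\colon\pi_1(\Sigma_g)\to SL(2,K)$ is $\langle\rho^*w,[\Sigma_g]\rangle\in W(K)$, where $\rho^*w\in H^2(\pi_1(\Sigma_g),W(K))\cong H^2(\Sigma_g,W(K))$; it lies in $I^2(K)$. Concretely, let $a_1,b_1,\dots,a_g,b_g$ be loops with a common base point, cutting $\Sigma_g$ into a $4g$-gon whose boundary read counterclockwise is $\prod_i[a_i,b_i]$, where $[x,y]=xyx^{-1}y^{-1}$, and put $A_i=\rho(a_i)$, $B_i=\rho(b_i)$. Then the value is $\prod_{i=1}^g[\overline A_i,\overline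 B_i]$ computed in the central extension $SL(2,K)\times W(K)$ with multiplication $(g,u)(h,v)=(gh,u+v+w(g,h))$, where $\overline m=(m,0)$; this product lies in the central subgroup $\{1\}\times W(K)\cong W(K)$. *)

theory Defs
  imports
    "HOL-Algebra.Ideal_Product"
    "Jordan_Normal_Form.Determinant"
begin

(* frees the field name of the record monoid *)
hide_const (open) Multiset.mult

section \<open>Symmetric bilinear forms and the Witt ring\<close>

text \<open>
  A symmetric bilinear form on \<open>\<rat>\<^sup>n\<close> is given by its Gram matrix, a symmetric \<open>n \<times> n\<close> matrix
  over \<^typ>\<open>rat\<close>.  The dimension \<open>n\<close> is arbitrary; \<open>n = 0\<close> is allowed.
\<close>

definition bil :: "rat mat \<Rightarrow> rat vec \<Rightarrow> rat vec \<Rightarrow> rat" where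
  "bil A v w = v \<bullet> (A *\<^sub>v w)"

definition forms :: "rat mat set" where
  "forms = {A. square_mat A \<and> transpose_mat A = A \<and>
     (\<forall>v \<in> carrier_vec (dim_row A).
        (\<forall>w \<in> carrier_vec (dim_row A). bil A v w = 0) \<longrightarrow> v = 0\<^sub>v (dim_row A))}"

definition anisotropic :: "rat mat \<Rightarrow> bool" where
  "anisotropic A \<longleftrightarrow> (\<forall>v \<in> carrier_vec (dim_row A). bil A v v = 0 \<longrightarrow> v = 0\<^sub>v (dim_row A))"

text \<open>With \<open>B = P\<^sup>T A P\<close>, the map \<open>v \<mapsto> P v\<close> is an isometry from the form \<open>B\<close> to the form \<open>A\<close>.\<close>

definition isometric :: "rat mat \<Rightarrow> rat mat \<Rightarrow> bool" where
  "isometric A B \<longleftrightarrow>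
     (\<exists>P \<in> carrier_mat (dim_row A) (dim_row A). invertible_mat P \<and> B = transpose_mat P * A * P)"

definition orth_sum :: "rat mat \<Rightarrow> rat mat \<Rightarrow> rat mat" where
  "orth_sum A B = diag_block_mat [A, B]"

text \<open>Gram matrix of the tensor product in the basis \<open>e\<^sub>k \<otimes> f\<^sub>l\<close>, which gets the index \<open>k m + l\<close>
  if \<open>B\<close> has dimension \<open>m\<close>.\<close>

definition tensor_form :: "rat mat \<Rightarrow> rat mat \<Rightarrow> rat mat" where
  "tensor_form A B = (let m = dim_row B in
     mat (dim_row A * m) (dim_row A * m)
       (\<lambda>(i, j). A $$ (i div m, j div m) * B $$ (i mod m, j mod m)))"

definition hyp_plane :: "rat mat" where
  "hyp_plane = mat_of_rows_list 2 [[0, 1], [1, 0]]"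

definition hyp_space :: "nat \<Rightarrow> rat mat" where
  "hyp_space m = diag_block_mat (replicate m hyp_plane)"

text \<open>Over a field of characteristic other than 2 every metabolic form is hyperbolic, so two forms
  have the same Witt class iff they become isometric after adding hyperbolic planes.\<close>

definition witt_rel :: "(rat mat \<times> rat mat) set" where
  "witt_rel = {(A, B). A \<in> forms \<and> B \<in> forms \<and>
     (\<exists>m n. isometric (orth_sum A (hyp_space m)) (orth_sum B (hyp_space n)))}"

definition witt_ring :: "rat mat set ring" where
  "witt_ring =
     \<lparr>carrier = forms // witt_rel,
      mult = (\<lambda>U V. \<Union>A\<in>U. \<Union>B\<in>V. witt_rel `` {tensor_form A B}),
      one = witt_rel `` {1\<^sub>m 1},
      zero = witt_rel `` {1\<^sub>m 0},
      add = (\<lambda>U V. \<Union>A\<in>U. \<Union>B\<in>V. witt_rel `` {orth_sum A B})\<rparr>"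

definition witt1 :: "rat \<Rightarrow> rat mat set" where
  "witt1 a = (if a = 0 then \<zero>\<^bsub>witt_ring\<^esub> else witt_rel `` {mat 1 1 (\<lambda>_. a)})"

definition fundamental_ideal :: "rat mat set set" where
  "fundamental_ideal = {U \<in> carrier witt_ring. \<exists>A\<in>U. even (dim_row A)}"

definition fundamental_ideal_sq :: "rat mat set set" where
  "fundamental_ideal_sq = ideal_prod witt_ring fundamental_ideal fundamental_ideal"

definition witt_norm :: "rat mat set \<Rightarrow> nat" where
  "witt_norm U = (THE n. \<exists>A\<in>U. anisotropic A \<and> dim_row A = n)"


section \<open>The Witt cocycle and its central extension\<close>

definition SL2Q :: "rat mat monoid" where
  "SL2Q = \<lparr>carrier = {m \<in> carrier_mat 2 2. det m = 1}, mult = (*), one = 1\<^sub>m 2\<rparr>"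

text \<open>Matrix indices start at 0, so \<open>m $$ (1, 0)\<close> is the \<open>(2,1)\<close> entry of \<open>m\<close>.\<close>

definition witt_cocycle :: "rat mat \<Rightarrow> rat mat \<Rightarrow> rat mat set" where
  "witt_cocycle a b = witt1 (- (a $$ (1, 0) * (a * b) $$ (1, 0) * b $$ (1, 0)))"

text \<open>The pair \<open>(1, 0)\<close> is neutral because the cocycle vanishes whenever one argument is \<open>1\<close>.\<close>

definition witt_ext :: "(rat mat \<times> rat mat set) monoid" where
  "witt_ext =
     \<lparr>carrier = carrier SL2Q \<times> carrier witt_ring,
      mult = (\<lambda>(g, u) (h, v).
        (g \<otimes>\<^bsub>SL2Q\<^esub> h, (u \<oplus>\<^bsub>witt_ring\<^esub> v) \<oplus>\<^bsub>witt_ring\<^esub> witt_cocycle g h)),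
      one = (\<one>\<^bsub>SL2Q\<^esub>, \<zero>\<^bsub>witt_ring\<^esub>)\<rparr>"

definition lift_ext :: "rat mat \<Rightarrow> rat mat \<times> rat mat set" where
  "lift_ext m = (m, \<zero>\<^bsub>witt_ring\<^esub>)"

definition commutator :: "('a, 'b) monoid_scheme \<Rightarrow> 'a \<Rightarrow> 'a \<Rightarrow> 'a" where
  "commutator G x y = x \<otimes>\<^bsub>G\<^esub> y \<otimes>\<^bsub>G\<^esub> inv\<^bsub>G\<^esub> x \<otimes>\<^bsub>G\<^esub> inv\<^bsub>G\<^esub> y"

definition prod_commutators ::
  "('a, 'b) monoid_scheme \<Rightarrow> nat \<Rightarrow> (nat \<Rightarrow> 'a) \<Rightarrow> (nat \<Rightarrow> 'a) \<Rightarrow> 'a" where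
  "prod_commutators G g x y = foldr (\<lambda>i z. commutator G (x i) (y i) \<otimes>\<^bsub>G\<^esub> z) [0..<g] \<one>\<^bsub>G\<^esub>"


section \<open>The fundamental group of the closed oriented surface of genus \<open>g\<close>\<close>

text \<open>
  Cutting the surface into a \<open>4g\<close>-gon with boundary \<open>[a\<^sub>0, b\<^sub>0] \<cdots> [a\<^sub>g\<^sub>-\<^sub>1, b\<^sub>g\<^sub>-\<^sub>1]\<close> presents its
  fundamental group by the generators \<open>a\<^sub>i, b\<^sub>i\<close> (\<open>i < g\<close>) and this single relator.  A letter
  \<open>(e, x)\<close> stands for \<open>x\<close> if \<open>e\<close> is true and for the inverse of \<open>x\<close> otherwise.
\<close>

datatype surface_gen = GenA nat | GenB nat

type_synonym surface_word = "(bool \<times> surface_gen) list"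

definition surface_words :: "nat \<Rightarrow> surface_word set" where
  "surface_words g = lists (UNIV \<times> (GenA ` {..<g} \<union> GenB ` {..<g}))"

definition surface_relator :: "nat \<Rightarrow> surface_word" where
  "surface_relator g = concat (map (\<lambda>i.
     [(True, GenA i), (True, GenB i), (False, GenA i), (False, GenB i)]) [0..<g])"

inductive_set surface_rel :: "nat \<Rightarrow> (surface_word \<times> surface_word) set" for g :: nat where
  refl: "u \<in> surface_words g \<Longrightarrow> (u, u) \<in> surface_rel g"
| sym: "(u, v) \<in> surface_rel g \<Longrightarrow> (v, u) \<in> surface_rel g"
| trans: "(u, v) \<in> surface_rel g \<Longrightarrow> (v, w) \<in> surface_rel g \<Longrightarrow> (u, w) \<in> surface_rel g"
| cancel: "u @ [(e, x), (\<not> e, x)] @ v \<in> surface_words g \<Longrightarrow>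
    (u @ [(e, x), (\<not> e, x)] @ v, u @ v) \<in> surface_rel g"
| relator: "u @ v \<in> surface_words g \<Longrightarrow> (u @ surface_relator g @ v, u @ v) \<in> surface_rel g"

definition surface_group :: "nat \<Rightarrow> surface_word set monoid" where
  "surface_group g =
     \<lparr>carrier = surface_words g // surface_rel g,
      mult = (\<lambda>U V. \<Union>u\<in>U. \<Union>v\<in>V. surface_rel g `` {u @ v}),
      one = surface_rel g `` {[]}\<rparr>"

definition loop_a :: "nat \<Rightarrow> nat \<Rightarrow> surface_word set" where
  "loop_a g i = surface_rel g `` {[(True, GenA i)]}"

definition loop_b :: "nat \<Rightarrow> nat \<Rightarrow> surface_word set" where
  "loop_b g i = surface_rel g `` {[(True, GenB i)]}"


section \<open>The Witt class of a representation\<close>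

text \<open>The product of commutators lies over \<open>1\<close>, and its second component is the pairing of the
  pulled back Witt class with the fundamental class of the surface.\<close>

definition witt_class :: "nat \<Rightarrow> (surface_word set \<Rightarrow> rat mat) \<Rightarrow> rat mat set" where
  "witt_class g \<rho> = snd (prod_commutators witt_ext g
     (\<lambda>i. lift_ext (\<rho> (loop_a g i))) (\<lambda>i. lift_ext (\<rho> (loop_b g i))))"

end

theory Submission
  imports Defs
begin

text \<open>
Cutting the surface open along the loops and adding diagonals from the base point gives a
one-vertex triangulation with \<open>4g - 2\<close> triangles.  Carry the vector \<open>e\<^sub>1 \<in> \<rat>\<^sup>2\<close> along with the
representation: a triangle with edges \<open>a\<close>, \<open>b\<close>, \<open>ab\<close> then has the vertex vectors \<open>e\<^sub>1\<close>,
\<open>a e\<^sub>1\<close>, \<open>ab e\<^sub>1\<close>, and \<open>t(a, b) = - a\<^sub>2\<^sub>1 (ab)\<^sub>2\<^sub>1 b\<^sub>2\<^sub>1\<close> is the product of the three determinants along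
its sides.  The product of commutators in the central extension unfolds to the sum of the
classes \<open>[t(a, b)]\<close> over all triangles, so the Witt class is represented by a diagonal form of
dimension at most \<open>4g - 2\<close>.

\<^emph>\<open>Upper bound.\<close>  The triangles form a cycle: \<open>f(ab) - f(a) - f(b)\<close> sums to zero over them for
every \<open>f\<close> with \<open>f(m\<inverse>) = - f(m)\<close> (\<open>closed_chain_telescope\<close>).  This is used three times.
Modulo the forms of even dimension and trivial signed discriminant, \<open>[t(a, b)]\<close> is such a
coboundary, of \<open>f(m) = [m\<^sub>2\<^sub>1]\<close> up to degenerate cases; hence the Witt class lies in \<open>I\<^sup>2\<close>.  Next,
\<open>f(m) = (tr m - 2) / m\<^sub>2\<^sub>1\<close> satisfies \<open>f(ab) - f(a) - f(b) = t(a, b) \<xi>(a, b)\<^sup>2\<close> with an explicit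
\<open>\<xi>\<close> (\<open>triangle_defect\<close>), so the vector of the numbers \<open>\<xi>\<close> is isotropic for the diagonal form,
and splitting off a hyperbolic plane brings the dimension down to \<open>4g - 4\<close>.  If that vector is
zero, then \<open>(ab)\<^sub>2\<^sub>1 = a\<^sub>2\<^sub>1 + b\<^sub>2\<^sub>1\<close> on every triangle, which makes \<open>[t(a, b)]\<close> itself the coboundary
of \<open>[m\<^sub>2\<^sub>1]\<close>, and the Witt class vanishes.  If some \<open>t(a, b)\<close> is zero, at most \<open>4g - 3\<close> summands
remain, and the dimension is even.

\<^emph>\<open>Realization.\<close>  A one-holed torus can be given any three classes on its triangles
(\<open>commutator_realization\<close>).  Conjugation by upper unipotent matrices changes none of these
numbers but moves the \<open>(2,1)\<close> entry of a product freely, so that such tori can be attached to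
one another with any prescribed class on the connecting triangle (\<open>one_holed_realization\<close>).  The
last torus caps the surface off and contributes a single class (\<open>triangular_commutator\<close>), which
is the right one because the signed discriminant is trivial.

Both parts take place in the additive group of the Witt ring, presented by diagonal forms; this
needs diagonalization, Witt cancellation (for the norm to be well defined) and the description
of \<open>I\<^sup>2\<close> by dimension and signed discriminant.
\<close>

section \<open>Isometry of Gram matrices\<close>

lemma invertible_mat_iff_det:
  fixes P :: "rat mat"
  assumes "P \<in> carrier_mat n n"
  shows "invertible_mat P \<longleftrightarrow> det P \<noteq> 0"
proof
  assume "invertible_mat P"
  then obtain Q where Q: "inverts_mat P Q" "inverts_mat Q P"
    unfolding invertible_mat_def by blast
  have PQ: "P * Q = 1\<^sub>m n" using Q(1) assms by (auto simp: inverts_mat_def)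
  have "dim_col Q = n" using arg_cong[OF PQ, of dim_col] by simp
  moreover have "dim_row Q = n"
    using arg_cong[OF Q(2)[unfolded inverts_mat_def], of dim_col] carrier_matD(2)[OF assms]
    by (simp only: index_mult_mat index_one_mat)
  ultimately have "det P * det Q = 1"
    using PQ assms det_mult[of P n Q] by (metis carrier_matI det_one)
  then show "det P \<noteq> 0" by auto
next
  assume "det P \<noteq> 0"
  from det_non_zero_imp_unit[OF assms this, of "()"]
  obtain Q where "Q \<in> carrier_mat n n" "Q * P = 1\<^sub>m n" "P * Q = 1\<^sub>m n"
    unfolding Units_def by (auto simp: ring_mat_def)
  then show "invertible_mat P"
    using assms unfolding invertible_mat_def inverts_mat_def by auto
qed

lemma forms_iff_det:
  "A \<in> forms \<longleftrightarrow> square_mat A \<and> transpose_mat A = A \<and> det A \<noteq> 0"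
proof -
  { assume sq: "square_mat A" and tr: "transpose_mat A = A"
    let ?n = "dim_row A"
    have A: "A \<in> carrier_mat ?n ?n" using sq by auto
    have swap: "bil A v w = (A *\<^sub>v v) \<bullet> w" if "v \<in> carrier_vec ?n" "w \<in> carrier_vec ?n" for v w
      using that A tr unfolding bil_def
      by (metis carrier_vec_dim_vec dim_mult_mat_vec mult_mat_vec_carrier transpose_vec_mult_scalar comm_scalar_prod)
    have nd: "(\<forall>w \<in> carrier_vec ?n. bil A v w = 0) \<longleftrightarrow> A *\<^sub>v v = 0\<^sub>v ?n" if v: "v \<in> carrier_vec ?n" for v
    proof
      assume z: "\<forall>w \<in> carrier_vec ?n. bil A v w = 0"
      show "A *\<^sub>v v = 0\<^sub>v ?n"
      proof (intro eq_vecI)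
        fix i assume i: "i < dim_vec (0\<^sub>v ?n :: rat vec)"
        have "(A *\<^sub>v v) \<bullet> unit_vec ?n i = 0" using z swap[OF v, of "unit_vec ?n i"] by auto
        moreover have "(A *\<^sub>v v) \<bullet> unit_vec ?n i = (A *\<^sub>v v) $ i"
          using i mult_mat_vec_carrier[OF A v] by (intro scalar_prod_right_unit) simp_all
        ultimately show "(A *\<^sub>v v) $ i = 0\<^sub>v ?n $ i" using i by simp
      qed auto
    qed (use swap v in auto)
    then have "(\<forall>v \<in> carrier_vec ?n. (\<forall>w \<in> carrier_vec ?n. bil A v w = 0) \<longrightarrow> v = 0\<^sub>v ?n)
      \<longleftrightarrow> (\<forall>v \<in> carrier_vec ?n. A *\<^sub>v v = 0\<^sub>v ?n \<longrightarrow> v = 0\<^sub>v ?n)"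
      using nd by (intro ball_cong) (simp_all only:)
    also have "\<dots> \<longleftrightarrow> det A \<noteq> 0"
      using det_0_iff_vec_prod_zero_field[OF A] by auto
    finally have "A \<in> forms \<longleftrightarrow> det A \<noteq> 0"
      unfolding forms_def mem_Collect_eq using sq tr by (simp only: simp_thms) }
  moreover have "square_mat A \<and> transpose_mat A = A" if "A \<in> forms"
    using that unfolding forms_def by simp
  ultimately show ?thesis by metis
qed

lemma isometric_iff:
  assumes "A \<in> carrier_mat n n"
  shows "isometric A B \<longleftrightarrow> (\<exists>P \<in> carrier_mat n n. det P \<noteq> 0 \<and> B = transpose_mat P * A * P)"
  using assms invertible_mat_iff_det unfolding isometric_def by auto

lemma isometric_carrier:
  assumes "A \<in> carrier_mat n n" "isometric A B" shows "B \<in> carrier_mat n n"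
  using assms unfolding isometric_def by auto

lemma isometric_refl:
  assumes "A \<in> carrier_mat n n" shows "isometric A A"
  unfolding isometric_iff[OF assms]
  by (intro bexI[of _ "1\<^sub>m n"]) (use assms in auto)

lemma isometric_trans:
  assumes A: "A \<in> carrier_mat n n" and "isometric A B" "isometric B C"
  shows "isometric A C"
proof -
  have B: "B \<in> carrier_mat n n" using isometric_carrier assms by blast
  obtain P where P: "P \<in> carrier_mat n n" "det P \<noteq> 0" "B = transpose_mat P * A * P"
    using assms isometric_iff by blast
  obtain Q where Q: "Q \<in> carrier_mat n n" "det Q \<noteq> 0" "C = transpose_mat Q * B * Q"
    using assms isometric_iff[OF B] by blast
  have "C = transpose_mat Q * (transpose_mat P * A * P) * Q" using P Q by simp
  also have "\<dots> = (transpose_mat Q * transpose_mat P) * A * (P * Q)"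
    using A P(1) Q(1) by (simp add: assoc_mult_mat[of _ n n _ n _ n])
  also have "transpose_mat Q * transpose_mat P = transpose_mat (P * Q)"
    using P(1) Q(1) by (metis transpose_mult)
  finally show ?thesis unfolding isometric_iff[OF A]
    using P Q by (intro bexI[of _ "P * Q"]) (auto simp: det_mult[of P n Q])
qed

lemma isometric_sym:
  assumes A: "A \<in> carrier_mat n n" and "isometric A B" shows "isometric B A"
proof -
  have B: "B \<in> carrier_mat n n" using isometric_carrier assms by blast
  obtain P where P: "P \<in> carrier_mat n n" "det P \<noteq> 0" "B = transpose_mat P * A * P"
    using assms isometric_iff by blast
  from det_non_zero_imp_unit[OF P(1,2), of "()"]
  obtain Q where Q: "Q \<in> carrier_mat n n" "Q * P = 1\<^sub>m n" "P * Q = 1\<^sub>m n"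
    unfolding Units_def by (auto simp: ring_mat_def)
  have "det P * det Q = 1" using Q det_mult[OF P(1) Q(1)] by simp
  then have dQ: "det Q \<noteq> 0" by auto
  have PQt: "transpose_mat Q * transpose_mat P = 1\<^sub>m n"
    using P(1) Q by (metis transpose_mult transpose_one)
  have "transpose_mat Q * B * Q = (transpose_mat Q * transpose_mat P) * A * (P * Q)"
    unfolding P(3) using A P(1) Q(1) by (simp add: assoc_mult_mat[of _ n n _ n _ n])
  also have "\<dots> = A" unfolding PQt Q(3) using A by simp
  finally show ?thesis unfolding isometric_iff[OF B] using Q(1) dQ by metis
qed

lemma orth_sum_block:
  assumes "A \<in> carrier_mat n n" "B \<in> carrier_mat m m"
  shows "orth_sum A B = four_block_mat A (0\<^sub>m n m) (0\<^sub>m m n) B"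
proof -
  have "four_block_mat B (0\<^sub>m m 0) (0\<^sub>m 0 m) (0\<^sub>m 0 0) = B"
    using assms by (intro eq_matI) auto
  then show ?thesis using assms by (simp add: orth_sum_def Let_def)
qed

lemma orth_sum_carrier:
  assumes "A \<in> carrier_mat n n" "B \<in> carrier_mat m m"
  shows "orth_sum A B \<in> carrier_mat (n + m) (n + m)"
  using assms by (simp add: orth_sum_block[OF assms])

text \<open>
The base change is block diagonal.
\<close>

lemma isometric_orth_sum:
  assumes A: "A \<in> carrier_mat n n" and C: "C \<in> carrier_mat m m"
    and "isometric A B" "isometric C D"
  shows "isometric (orth_sum A C) (orth_sum B D)"
proof -
  have B: "B \<in> carrier_mat n n" and D: "D \<in> carrier_mat m m"
    using isometric_carrier assms by blast+
  obtain P where P: "P \<in> carrier_mat n n" "det P \<noteq> 0" "B = transpose_mat P * A * P"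
    using assms isometric_iff by blast
  obtain Q where Q: "Q \<in> carrier_mat m m" "det Q \<noteq> 0" "D = transpose_mat Q * C * Q"
    using assms isometric_iff by blast
  let ?R = "four_block_mat P (0\<^sub>m n m) (0\<^sub>m m n) Q"
  have R: "?R \<in> carrier_mat (n + m) (n + m)" using P Q by simp
  have dR: "det ?R \<noteq> 0"
    using P Q det_four_block_mat_upper_right_zero[OF P(1) HOL.refl _ Q(1)] by simp
  have tR: "transpose_mat ?R = four_block_mat (transpose_mat P) (0\<^sub>m n m) (0\<^sub>m m n) (transpose_mat Q)"
    using transpose_four_block_mat[OF P(1) _ _ Q(1), of "0\<^sub>m n m" "0\<^sub>m m n"] by simp
  have Pt: "transpose_mat P \<in> carrier_mat n n" and Qt: "transpose_mat Q \<in> carrier_mat m m"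
    using P Q by auto
  have "transpose_mat ?R * orth_sum A C * ?R = orth_sum B D"
    unfolding orth_sum_block[OF A C] orth_sum_block[OF B D] tR
    using A C P Q Pt Qt
    by (simp add: mult_four_block_mat[OF Pt _ _ Qt A _ _ C]
       mult_four_block_mat[of _ n n _ m _ m _ P n _ m])
  then show ?thesis
    unfolding isometric_iff[OF orth_sum_carrier[OF A C]] using R dR by metis
qed

lemma forms_isometric:
  assumes "A \<in> forms" "isometric A B" shows "B \<in> forms"
proof -
  obtain n where A: "A \<in> carrier_mat n n" "transpose_mat A = A" "det A \<noteq> 0"
    using assms(1) unfolding forms_iff_det by auto
  obtain P where P: "P \<in> carrier_mat n n" "det P \<noteq> 0" "B = transpose_mat P * A * P"
    using assms A isometric_iff by blast
  have "det B = det P * det A * det P"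
    using A P by (simp add: det_mult[of _ n] det_transpose[of P n])
  moreover have "transpose_mat B = B"
    using A P by (simp add: transpose_mult[of _ n n _ n] assoc_mult_mat[of _ n n _ n _ n])
  moreover have "square_mat B" using A P by auto
  ultimately show ?thesis unfolding forms_iff_det using A P by auto
qed

lemma forms_orth_sum:
  assumes "A \<in> forms" "B \<in> forms" shows "orth_sum A B \<in> forms"
proof -
  obtain n where A: "A \<in> carrier_mat n n" "transpose_mat A = A" "det A \<noteq> 0"
    using assms(1) unfolding forms_iff_det by auto
  obtain m where B: "B \<in> carrier_mat m m" "transpose_mat B = B" "det B \<noteq> 0"
    using assms(2) unfolding forms_iff_det by auto
  show ?thesis unfolding forms_iff_det orth_sum_block[OF A(1) B(1)]
    using A B det_four_block_mat_upper_right_zero[OF A(1) HOL.refl _ B(1)]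
      transpose_four_block_mat[OF A(1) _ _ B(1), of "0\<^sub>m n m" "0\<^sub>m m n"] by simp
qed

section \<open>Diagonal forms\<close>

definition diag_form :: "rat list \<Rightarrow> rat mat" where
  "diag_form as = mat (length as) (length as) (\<lambda>(i, j). if i = j then as ! i else 0)"

definition diag_isometric :: "rat list \<Rightarrow> rat list \<Rightarrow> bool"  (infix "\<simeq>" 50) where
  "as \<simeq> bs \<longleftrightarrow> isometric (diag_form as) (diag_form bs)"

lemma diag_form_carrier [simp]: "diag_form as \<in> carrier_mat (length as) (length as)"
  by (simp add: diag_form_def)

lemma dim_diag_form [simp]:
  "dim_row (diag_form as) = length as" "dim_col (diag_form as) = length as"
  by (simp_all add: diag_form_def)

lemma index_diag_form [simp]:
  "i < length as \<Longrightarrow> j < length as \<Longrightarrow> diag_form as $$ (i, j) = (if i = j then as ! i else 0)"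
  by (simp add: diag_form_def)

lemma diag_form_Nil: "diag_form [] = 1\<^sub>m 0"
  by (intro eq_matI) auto

lemma det_diag_form: "det (diag_form as) = prod_list as"
proof -
  have "upper_triangular (diag_form as)" by (auto simp: upper_triangular_def)
  moreover have "diag_mat (diag_form as) = as"
    by (auto simp: diag_mat_def intro!: nth_equalityI)
  ultimately show ?thesis using det_upper_triangular[OF _ diag_form_carrier] by metis
qed

lemma diag_form_forms: "diag_form as \<in> forms \<longleftrightarrow> 0 \<notin> set as"
proof -
  have "transpose_mat (diag_form as) = diag_form as" by (intro eq_matI) auto
  then show ?thesis unfolding forms_iff_det by (auto simp: det_diag_form prod_list_zero_iff)
qed

lemma orth_sum_diag_form: "orth_sum (diag_form as) (diag_form bs) = diag_form (as @ bs)"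
  unfolding orth_sum_block[OF diag_form_carrier diag_form_carrier]
  by (intro eq_matI) (auto simp: nth_append)

lemma diso_refl [simp]: "as \<simeq> as"
  unfolding diag_isometric_def by (rule isometric_refl[OF diag_form_carrier])

lemma diso_sym: "as \<simeq> bs \<Longrightarrow> bs \<simeq> as"
  unfolding diag_isometric_def by (rule isometric_sym[OF diag_form_carrier])

lemma diso_trans [trans]: "as \<simeq> bs \<Longrightarrow> bs \<simeq> cs \<Longrightarrow> as \<simeq> cs"
  unfolding diag_isometric_def by (rule isometric_trans[OF diag_form_carrier])

lemma diso_length: "as \<simeq> bs \<Longrightarrow> length as = length bs"
  unfolding diag_isometric_def
  by (metis isometric_carrier diag_form_carrier carrier_matD(1) dim_diag_form(1))

lemma diso_append: "as \<simeq> bs \<Longrightarrow> cs \<simeq> ds \<Longrightarrow> as @ cs \<simeq> bs @ ds"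
  unfolding diag_isometric_def orth_sum_diag_form[symmetric]
  by (rule isometric_orth_sum[OF diag_form_carrier diag_form_carrier])

lemma diso_Cons: "as \<simeq> bs \<Longrightarrow> a # as \<simeq> a # bs"
  using diso_append[of "[a]" "[a]" as bs] by simp

lemma diso_nonzero: "as \<simeq> bs \<Longrightarrow> 0 \<notin> set as \<Longrightarrow> 0 \<notin> set bs"
  using forms_isometric diag_form_forms unfolding diag_isometric_def by blast

lemma diso_prod:
  assumes "as \<simeq> bs" shows "\<exists>t. t \<noteq> 0 \<and> prod_list bs = prod_list as * t\<^sup>2"
proof -
  let ?n = "length as"
  obtain P where P: "P \<in> carrier_mat ?n ?n" "det P \<noteq> 0"
      "diag_form bs = transpose_mat P * diag_form as * P"
    using assms unfolding diag_isometric_def isometric_iff[OF diag_form_carrier] by blast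
  have "det (diag_form bs) = det P * det (diag_form as) * det P"
    unfolding P(3) using P(1) by (simp add: det_mult[of _ ?n] det_transpose[of P ?n])
  then show ?thesis using P(2) unfolding det_diag_form
    by (intro exI[of _ "det P"]) (simp add: power2_eq_square)
qed

text \<open>
With a nondegenerate target, invertibility of the base change follows from the matrix equation,
so an isometry amounts to a system of equations between its coefficients.
\<close>

lemma diso_iff:
  assumes nz: "0 \<notin> set bs"
  shows "as \<simeq> bs \<longleftrightarrow> length as = length bs \<and>
    (\<exists>P. \<forall>i<length as. \<forall>j<length as.
       (\<Sum>k<length as. as ! k * P k i * P k j) = (if i = j then bs ! i else 0))"
proof -
  let ?n = "length as"
  have entry: "(transpose_mat P * diag_form as * P) $$ (i, j)
      = (\<Sum>k<?n. as ! k * P $$ (k, i) * P $$ (k, j))"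
    if P: "P \<in> carrier_mat ?n ?n" and i: "i < ?n" and j: "j < ?n" for P i j
  proof -
    have "(transpose_mat P * diag_form as) $$ (i, k) = as ! k * P $$ (k, i)" if k: "k < ?n" for k
    proof -
      have "(transpose_mat P * diag_form as) $$ (i, k)
        = (\<Sum>l<?n. P $$ (l, i) * (if l = k then as ! l else 0))"
        using P i k by (simp add: scalar_prod_def lessThan_atLeast0)
      also have "\<dots> = (\<Sum>l<?n. if l = k then as ! k * P $$ (k, i) else 0)"
        by (intro sum.cong) auto
      finally show ?thesis using k by simp
    qed
    then show ?thesis using P i j
      by (subst index_mult_mat) (simp_all add: scalar_prod_def lessThan_atLeast0)
  qed
  show ?thesis
  proof
    assume iso: "as \<simeq> bs"
    then obtain P where P: "P \<in> carrier_mat ?n ?n"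
        "diag_form bs = transpose_mat P * diag_form as * P"
      unfolding diag_isometric_def isometric_iff[OF diag_form_carrier] by blast
    have l: "?n = length bs" using diso_length[OF iso] .
    have "\<forall>i<?n. \<forall>j<?n. (\<Sum>k<?n. as ! k * P $$ (k, i) * P $$ (k, j)) = (if i = j then bs ! i else 0)"
      using entry[OF P(1)] l unfolding P(2)[symmetric] by simp
    then show "?n = length bs \<and> (\<exists>P. \<forall>i<?n. \<forall>j<?n.
       (\<Sum>k<?n. as ! k * P k i * P k j) = (if i = j then bs ! i else 0))"
      using l by (intro conjI exI[of _ "\<lambda>k i. P $$ (k, i)"])
  next
    assume R: "?n = length bs \<and> (\<exists>P. \<forall>i<?n. \<forall>j<?n.
       (\<Sum>k<?n. as ! k * P k i * P k j) = (if i = j then bs ! i else 0))"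
    then obtain Pf where l: "length bs = ?n" and Pf: "\<And>i j. i < ?n \<Longrightarrow> j < ?n \<Longrightarrow>
       (\<Sum>k<?n. as ! k * Pf k i * Pf k j) = (if i = j then bs ! i else 0)" by metis
    define P where "P = mat ?n ?n (\<lambda>(i, j). Pf i j)"
    have P: "P \<in> carrier_mat ?n ?n" by (simp add: P_def)
    have eq: "diag_form bs = transpose_mat P * diag_form as * P"
    proof (intro eq_matI)
      fix i j assume "i < dim_row (transpose_mat P * diag_form as * P)"
        "j < dim_col (transpose_mat P * diag_form as * P)"
      then have ij: "i < ?n" "j < ?n" using P by auto
      show "diag_form bs $$ (i, j) = (transpose_mat P * diag_form as * P) $$ (i, j)"
        unfolding entry[OF P ij] using ij l Pf[OF ij] by (simp add: P_def)
    qed (use P l in auto)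
    have "det (diag_form bs) = det P * det (diag_form as) * det P"
      unfolding eq using P by (simp add: det_mult[of _ ?n] det_transpose[of P ?n])
    then have "det P \<noteq> 0" using nz unfolding det_diag_form by (auto simp: prod_list_zero_iff)
    then show "as \<simeq> bs" unfolding diag_isometric_def isometric_iff[OF diag_form_carrier]
      using P eq by blast
  qed
qed

lemma disoI:
  assumes "0 \<notin> set bs" "length bs = length as"
    and "\<And>i j. i < length as \<Longrightarrow> j < length as \<Longrightarrow>
      (\<Sum>k<length as. as ! k * P k i * P k j) = (if i = j then bs ! i else 0)"
  shows "as \<simeq> bs"
  unfolding diso_iff[OF assms(1)] using assms(2,3) by (intro conjI exI[of _ P] allI impI) simp_all

lemma diso_square: "a \<noteq> 0 \<Longrightarrow> t \<noteq> 0 \<Longrightarrow> [a] \<simeq> [a * t\<^sup>2]"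
  by (subst diso_iff) (auto simp: power2_eq_square intro!: exI[of _ "\<lambda>_ _. t"])

lemma diso_binary:
  assumes "c \<noteq> 0" "d \<noteq> 0" "a * p * p + b * r * r = c" "a * p * q + b * r * s = 0"
    "a * q * q + b * s * s = d"
  shows "[a, b] \<simeq> [c, d]"
proof -
  let ?P = "\<lambda>i j. if i = (0::nat) then (if j = (0::nat) then p else q) else (if j = 0 then r else s)"
  have "i < 2 \<longleftrightarrow> i = 0 \<or> i = Suc 0" for i :: nat by auto
  then have "\<forall>i<length [a, b]. \<forall>j<length [a, b]. (\<Sum>k<length [a, b]. [a, b] ! k * ?P k i * ?P k j)
      = (if i = j then [c, d] ! i else 0)"
    using assms(3-5) by (auto simp: numeral_2_eq_2 algebra_simps)
  then have "\<exists>P. \<forall>i<length [a, b]. \<forall>j<length [a, b]. (\<Sum>k<length [a, b]. [a, b] ! k * P k i * P k j)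
      = (if i = j then [c, d] ! i else 0)"
    by (rule exI[of _ ?P])
  then show ?thesis using assms(1,2) by (subst diso_iff) simp_all
qed

lemma diso_swap: "a \<noteq> 0 \<Longrightarrow> b \<noteq> 0 \<Longrightarrow> [a, b] \<simeq> [b, a]"
  by (rule diso_binary[of _ _ _ 0 _ 1 1 0]) auto

text \<open>
The vector \<open>(1, 1)\<close> has the value \<open>a + b\<close>; \<open>(- b, a)\<close> is orthogonal to it.
\<close>

lemma diso_add: "a \<noteq> 0 \<Longrightarrow> b \<noteq> 0 \<Longrightarrow> a + b \<noteq> 0 \<Longrightarrow> [a, b] \<simeq> [a + b, a * b * (a + b)]"
  by (rule diso_binary[of _ _ _ 1 _ 1 "- b" a]) (simp_all, simp_all add: algebra_simps)

text \<open>
The base change solves \<open>p\<^sup>2 - r\<^sup>2 = 1 / a\<close> by \<open>p + r = 1\<close> and \<open>p - r = 1 / a\<close>.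
\<close>

lemma diso_hyperbolic: "a \<noteq> 0 \<Longrightarrow> [a, - a] \<simeq> [1, - 1]"
  by (rule diso_binary[of _ _ _ "(1 + 1/a)/2" _ "(1 - 1/a)/2" "(1 - 1/a)/2" "(1 + 1/a)/2"])
     (auto simp: field_simps)

lemma diso_move: "0 \<notin> set us \<Longrightarrow> a \<noteq> 0 \<Longrightarrow> us @ a # vs \<simeq> a # us @ vs"
proof (induction us)
  case (Cons u us)
  then have "u # us @ a # vs \<simeq> u # a # us @ vs" by (auto intro: diso_Cons)
  also have "\<dots> \<simeq> a # u # us @ vs"
    using diso_append[OF diso_swap[of u a] diso_refl, of "us @ vs"] Cons by auto
  finally show ?case by simp
qed simp

lemma diso_mset: "mset as = mset bs \<Longrightarrow> 0 \<notin> set as \<Longrightarrow> as \<simeq> bs"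
proof (induction as arbitrary: bs)
  case (Cons a as)
  have "a \<in> set bs" using Cons.prems(1) by (metis list.set_intros(1) set_mset_mset)
  then obtain us vs where bs: "bs = us @ a # vs" by (meson split_list)
  have "mset as = mset (us @ vs)" using Cons.prems(1) bs by simp
  moreover have nz: "0 \<notin> set bs" using Cons.prems by (metis set_mset_mset)
  ultimately have "a # as \<simeq> a # us @ vs" using Cons by (auto intro: diso_Cons)
  also have "\<dots> \<simeq> us @ a # vs" using nz bs by (intro diso_sym[OF diso_move]) auto
  finally show ?case using bs by simp
qed simp

text \<open>
A diagonal form splits off every nonzero value that it represents.  By induction, the value
\<open>d\<close> that the tail contributes is split off first, and then the binary form \<open>\<langle>a r\<^sup>2, d\<rangle>\<close> is
rewritten; the special cases are those in which one of the two contributions vanishes.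
\<close>

lemma diso_represent:
  assumes "0 \<notin> set as" "length rs = length as" "(\<Sum>i<length as. as ! i * (rs ! i)\<^sup>2) = c" "c \<noteq> 0"
  shows "\<exists>bs. as \<simeq> c # bs"
  using assms
proof (induction as arbitrary: rs c)
  case (Cons a as)
  from Cons.prems(2) obtain r rs' where rs: "rs = r # rs'" "length rs' = length as"
    by (cases rs) auto
  define d where "d = (\<Sum>i<length as. as ! i * (rs' ! i)\<^sup>2)"
  have c: "c = a * r\<^sup>2 + d"
    using Cons.prems(3) unfolding rs d_def by (simp add: sum.lessThan_Suc_shift del: sum.lessThan_Suc)
  have a: "a \<noteq> 0" and nz: "0 \<notin> set as" using Cons.prems(1) by auto
  show ?case
  proof (cases "d = 0")
    case True
    then have "[a] \<simeq> [c]" using c Cons.prems(4) a diso_square[of a r] by auto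
    from diso_append[OF this diso_refl, of as] show ?thesis by auto
  next
    case False
    from Cons.IH[OF nz rs(2) d_def[symmetric] False] obtain bs where bs: "as \<simeq> d # bs" ..
    have "a # as \<simeq> a # d # bs" using bs by (rule diso_Cons)
    also have "\<exists>e. [a, d] \<simeq> [c, e]"
    proof (cases "r = 0")
      case True
      then show ?thesis using diso_swap a False c by auto
    next
      case r: False
      have "[a, d] \<simeq> [a * r\<^sup>2, d]"
        using diso_append[OF diso_square[OF a r] diso_refl, of "[d]"] by simp
      also have "\<dots> \<simeq> [a * r\<^sup>2 + d, a * r\<^sup>2 * d * (a * r\<^sup>2 + d)]"
        using diso_add a r False c Cons.prems(4) by auto
      finally show ?thesis using c by auto
    qed
    then obtain e where "[a, d] \<simeq> [c, e]" ..
    from diso_append[OF this diso_refl, of bs] have "a # d # bs \<simeq> c # e # bs" by simp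
    finally show ?thesis by blast
  qed
qed simp

text \<open>
If the first coordinate \<open>r\<close> of the isotropic vector is nonzero, division by \<open>r\<close> shows that the
tail represents \<open>- a\<close>, which pairs with \<open>a\<close> to a hyperbolic plane.
\<close>

lemma diso_isotropic:
  assumes "0 \<notin> set as" "length rs = length as" "(\<Sum>i<length as. as ! i * (rs ! i)\<^sup>2) = 0"
    "\<exists>i<length as. rs ! i \<noteq> 0"
  shows "\<exists>bs. as \<simeq> 1 # - 1 # bs"
  using assms
proof (induction as arbitrary: rs)
  case (Cons a as)
  from Cons.prems(2) obtain r rs' where rs: "rs = r # rs'" "length rs' = length as"
    by (cases rs) auto
  define d where "d = (\<Sum>i<length as. as ! i * (rs' ! i)\<^sup>2)"
  have c: "a * r\<^sup>2 + d = 0"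
    using Cons.prems(3) unfolding rs d_def by (simp add: sum.lessThan_Suc_shift del: sum.lessThan_Suc)
  have a: "a \<noteq> 0" and nz: "0 \<notin> set as" using Cons.prems(1) by auto
  show ?case
  proof (cases "r = 0")
    case True
    obtain i where "i < length (a # as)" "rs ! i \<noteq> 0" using Cons.prems(4) by blast
    then have "\<exists>i<length as. rs' ! i \<noteq> 0" using rs True by (cases i) auto
    moreover have "d = 0" using c True by simp
    ultimately obtain bs where "as \<simeq> 1 # - 1 # bs" using Cons.IH[OF nz rs(2)] d_def by auto
    then have "a # as \<simeq> a # 1 # - 1 # bs" by (rule diso_Cons)
    also have "\<dots> \<simeq> 1 # - 1 # a # bs"
    proof -
      have "[a, 1, - 1] \<simeq> [1, - 1, a]" using a by (intro diso_mset) auto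
      from diso_append[OF this diso_refl, of bs] show ?thesis by simp
    qed
    finally show ?thesis by blast
  next
    case False
    define rs'' where "rs'' = map (\<lambda>x. x / r) rs'"
    have "(\<Sum>i<length as. as ! i * (rs'' ! i)\<^sup>2) = d / r\<^sup>2"
      unfolding rs''_def d_def sum_divide_distrib using rs(2)
      by (intro sum.cong) (auto simp: power_divide)
    also have "\<dots> = - a" using c False by (simp add: field_simps)
    finally obtain bs where "as \<simeq> - a # bs"
      using diso_represent[OF nz, of rs'' "- a"] rs(2) a rs''_def by auto
    then have "a # as \<simeq> a # - a # bs" by (rule diso_Cons)
    also have "\<dots> \<simeq> 1 # - 1 # bs"
      using diso_append[OF diso_hyperbolic[OF a] diso_refl, of bs] by simp
    finally show ?thesis by blast
  qed
qed simp

text \<open>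
Witt cancellation by an explicit formula.  Write the isometry as a block matrix with rows
\<open>(p, u)\<close> and \<open>(v, M)\<close>.  Then \<open>N = M - v u / (p + e)\<close> is an isometry of the remaining forms for
each sign \<open>e = \<plusminus>1\<close> with \<open>p + e \<noteq> 0\<close>: it is the composition of the given isometry with a
reflection that repairs the image of the first basis vector.
\<close>

lemma diso_cancel:
  assumes "0 \<notin> set (a # as)" "a # as \<simeq> a # bs"
  shows "as \<simeq> bs"
proof -
  have nz: "0 \<notin> set (a # bs)" using assms diso_nonzero by blast
  let ?n = "length as"
  have l: "length bs = ?n" using diso_length[OF assms(2)] by simp
  obtain P where "\<forall>i<Suc ?n. \<forall>j<Suc ?n.
      (\<Sum>k<Suc ?n. (a # as) ! k * P k i * P k j) = (if i = j then (a # bs) ! i else 0)"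
    using assms(2)[unfolded diso_iff[OF nz], THEN conjunct2] unfolding list.size(4) add_0_right
      add_Suc_right by (elim exE)
  note P = this[rule_format]
  define p where "p = P 0 0"
  define u where "u = (\<lambda>j. P 0 (Suc j))"
  define v where "v = (\<lambda>i. P (Suc i) 0)"
  define M where "M = (\<lambda>i j. P (Suc i) (Suc j))"
  have 1: "(\<Sum>k<?n. as ! k * v k * v k) = a - a * p * p"
    using P[of 0 0] unfolding sum.lessThan_Suc_shift by (simp add: p_def v_def)
  have 2: "(\<Sum>k<?n. as ! k * v k * M k j) = - (a * p * u j)" if "j < ?n" for j
    using P[of 0 "Suc j"] that unfolding sum.lessThan_Suc_shift by (simp add: p_def v_def u_def M_def)
  have 3: "(\<Sum>k<?n. as ! k * M k i * M k j) = (if i = j then bs ! i else 0) - a * u i * u j"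
    if "i < ?n" "j < ?n" for i j
    using P[of "Suc i" "Suc j"] that unfolding sum.lessThan_Suc_shift
    by (simp add: u_def M_def eq_diff_eq add.commute)
  obtain e :: rat where e: "e * e = 1" "p + e \<noteq> 0"
  proof (cases "p + 1 = 0")
    case True then show ?thesis using that[of "- 1"] by auto
  next
    case False then show ?thesis using that[of 1] by auto
  qed
  define s where "s = 1 / (p + e)"
  have s: "s * (p + e) = 1" using e by (simp add: s_def)
  define N where "N = (\<lambda>k i. M k i - s * v k * u i)"
  have "(\<Sum>k<?n. as ! k * N k i * N k j) = (if i = j then bs ! i else 0)"
    if ij: "i < ?n" "j < ?n" for i j
  proof -
    have "(\<Sum>k<?n. as ! k * N k i * N k j) = (\<Sum>k<?n. as ! k * M k i * M k j)
        - s * u j * (\<Sum>k<?n. as ! k * v k * M k i) - s * u i * (\<Sum>k<?n. as ! k * v k * M k j)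
        + s * s * u i * u j * (\<Sum>k<?n. as ! k * v k * v k)"
      unfolding sum_distrib_left sum_subtractf[symmetric] sum.distrib[symmetric]
      by (intro sum.cong) (auto simp: N_def algebra_simps)
    also have "\<dots> = (if i = j then bs ! i else 0)
       + a * u i * u j * (2 * (s * p) + s * s - s * p * (s * p) - 1)"
      unfolding 1 2[OF ij(1)] 2[OF ij(2)] 3[OF ij] by (simp add: algebra_simps)
    also have "2 * (s * p) + s * s - s * p * (s * p) - 1 = 0"
    proof -
      have sp: "s * p = 1 - s * e" using s by (simp add: algebra_simps)
      show ?thesis unfolding sp using e(1) by (simp add: algebra_simps)
    qed
    finally show ?thesis by simp
  qed
  then show ?thesis using nz l by (intro disoI[of bs as N]) auto
qed

lemma diso_cancel_append:
  assumes "0 \<notin> set cs" "0 \<notin> set as" "cs @ as \<simeq> cs @ bs" shows "as \<simeq> bs"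
  using assms by (induction cs) (auto dest: diso_cancel[rotated])

section \<open>Diagonalization and Witt equivalence\<close>

lemma det_2x2:
  fixes A :: "'a :: comm_ring_1 mat"
  assumes "A \<in> carrier_mat 2 2"
  shows "det A = A $$ (0, 0) * A $$ (1, 1) - A $$ (0, 1) * A $$ (1, 0)"
proof -
  have minor: "det (mat_delete A i 0) = A $$ (1 - i, 1)" if "i < 2" for i
  proof -
    have "mat_delete A i 0 \<in> carrier_mat 1 1"
      using mat_delete_carrier[OF assms, of i 0] by simp
    then have "det (mat_delete A i 0) = mat_delete A i 0 $$ (0, 0)" by (rule det_single)
    also have "\<dots> = A $$ (1 - i, 1)" using assms that by (auto simp: mat_delete_def)
    finally show ?thesis .
  qed
  have "det A = (\<Sum>i<2. A $$ (i, 0) * cofactor A i 0)"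
    by (rule laplace_expansion_column[OF assms]) simp
  then show ?thesis using minor by (simp add: cofactor_def numeral_2_eq_2)
qed

text \<open>
If \<open>e\<^sub>0\<close> is isotropic, nondegeneracy provides \<open>k\<close> with \<open>A\<^sub>0\<^sub>k \<noteq> 0\<close>, and the value at \<open>e\<^sub>0 + t e\<^sub>k\<close> is
\<open>t (2 A\<^sub>0\<^sub>k + t A\<^sub>k\<^sub>k)\<close>, which cannot vanish for both \<open>t = 1\<close> and \<open>t = -1\<close>.  Such a vector is
the first column of an elementary matrix.
\<close>

lemma form_ex_anisotropic_first:
  assumes A: "A \<in> forms" "A \<in> carrier_mat (Suc m) (Suc m)"
  shows "\<exists>B. isometric A B \<and> B $$ (0, 0) \<noteq> 0"
proof (cases "A $$ (0, 0) = 0")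
  case False
  then show ?thesis using isometric_refl[OF A(2)] by blast
next
  case True
  let ?n = "Suc m"
  have sym: "A $$ (i, j) = A $$ (j, i)" if "i < ?n" "j < ?n" for i j
    using that A unfolding forms_iff_det by (metis carrier_matD index_transpose_mat(1))
  have "\<exists>k<?n. A $$ (0, k) \<noteq> 0"
  proof (rule ccontr)
    assume z: "\<not> (\<exists>k<?n. A $$ (0, k) \<noteq> 0)"
    have "A *\<^sub>v unit_vec ?n 0 = 0\<^sub>v ?n"
    proof (intro eq_vecI)
      fix i assume i: "i < dim_vec (0\<^sub>v ?n :: rat vec)"
      have "(A *\<^sub>v unit_vec ?n 0) $ i = A $$ (i, 0)" using A(2) i by simp
      then show "(A *\<^sub>v unit_vec ?n 0) $ i = 0\<^sub>v ?n $ i" using z i sym[of i 0] by simp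
    qed (use A in auto)
    then have "det A = 0"
      unfolding det_0_iff_vec_prod_zero_field[OF A(2)]
      by (intro exI[of _ "unit_vec ?n 0"]) (auto simp: unit_vec_def vec_eq_iff intro!: exI[of _ 0])
    then show False using A(1) unfolding forms_iff_det by simp
  qed
  then obtain k where k: "k < ?n" "A $$ (0, k) \<noteq> 0" by blast
  then have k0: "k \<noteq> 0" using True by metis
  obtain t :: rat where t: "t * (2 * A $$ (0, k) + t * A $$ (k, k)) \<noteq> 0"
  proof (cases "2 * A $$ (0, k) + A $$ (k, k) = 0")
    case True
    then show ?thesis using that[of "- 1"] k(2) by (simp add: add_eq_0_iff)
  next
    case False then show ?thesis using that[of 1] by simp
  qed
  let ?P = "addrow_mat ?n t k 0"
  have P: "?P \<in> carrier_mat ?n ?n" by simp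
  have Pt: "transpose_mat ?P = addrow_mat ?n t 0 k"
    by (intro eq_matI) auto
  have AP: "A * ?P = addcol t 0 k A" using addcol_mat[OF A(2), of k t 0] k by simp
  have "transpose_mat ?P * A * ?P = transpose_mat ?P * (A * ?P)"
    using A P by (intro assoc_mult_mat) auto
  also have "\<dots> = addrow t 0 k (addcol t 0 k A)"
    unfolding Pt AP using addrow_mat[OF _ k(1), of "addcol t 0 k A" ?n t 0] A(2)
    by (metis carrier_matD carrier_matI index_mat_addcol(4,5))
  finally have "(transpose_mat ?P * A * ?P) $$ (0, 0) = t * (2 * A $$ (0, k) + t * A $$ (k, k))"
    using A k k0 True sym[of 0 k] by (simp add: algebra_simps)
  moreover have "det ?P \<noteq> 0" using det_addrow_mat[of k 0 ?n t] k0 by simp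
  ultimately show ?thesis using isometric_iff[OF A(2)] P t by metis
qed

text \<open>
Clearing the first row with the nonzero pivot \<open>a\<close>; by symmetry this clears the first column
as well.
\<close>

lemma form_split_first:
  assumes B: "B \<in> forms" "B \<in> carrier_mat (Suc m) (Suc m)" and a: "B $$ (0, 0) = a" "a \<noteq> 0"
  shows "\<exists>C \<in> carrier_mat m m. isometric B (orth_sum (diag_form [a]) C)"
proof -
  let ?n = "Suc m"
  define P where "P = mat ?n ?n (\<lambda>(i, j). if i = j then 1 else if i = 0 then - B $$ (0, j) / a else 0)"
  have P: "P \<in> carrier_mat ?n ?n" by (simp add: P_def)
  have "upper_triangular P" by (auto simp: upper_triangular_def P_def)
  moreover have "diag_mat P = replicate ?n 1"
    unfolding diag_mat_def by (intro nth_equalityI) (auto simp: P_def simp del: upt_Suc replicate_Suc)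
  ultimately have "det P \<noteq> 0" using det_upper_triangular[OF _ P] by (simp add: prod_list_zero_iff)
  define C where "C = transpose_mat P * B * P"
  have iso: "isometric B C" using isometric_iff[OF B(2)] P \<open>det P \<noteq> 0\<close> C_def by blast
  have C: "C \<in> carrier_mat ?n ?n" using P B by (simp add: C_def)
  have "transpose_mat C = C" using forms_isometric[OF B(1) iso] unfolding forms_iff_det by simp
  then have sym: "C $$ (i, j) = C $$ (j, i)" if "i < ?n" "j < ?n" for i j
    using that C by (metis carrier_matD index_transpose_mat(1))
  have row: "(transpose_mat P * B) $$ (0, k) = B $$ (0, k)" if k: "k < ?n" for k
  proof -
    have "(transpose_mat P * B) $$ (0, k) = (\<Sum>l<?n. P $$ (l, 0) * B $$ (l, k))"
      using P B k by (simp add: scalar_prod_def lessThan_atLeast0 del: sum.lessThan_Suc sum.op_ivl_Suc)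
    also have "\<dots> = B $$ (0, k)"
      unfolding sum.lessThan_Suc_shift by (simp add: P_def)
    finally show ?thesis .
  qed
  have row0: "C $$ (0, j) = (if j = 0 then a else 0)" if j: "j < ?n" for j
  proof -
    have "C $$ (0, j) = (\<Sum>k<?n. B $$ (0, k) * P $$ (k, j))"
      unfolding C_def using P B j row
      by (subst index_mult_mat) (simp_all add: scalar_prod_def lessThan_atLeast0 del: sum.lessThan_Suc sum.op_ivl_Suc)
    also have "\<dots> = a * P $$ (0, j) + (\<Sum>k<m. B $$ (0, Suc k) * P $$ (Suc k, j))"
      unfolding sum.lessThan_Suc_shift using a by simp
    also have "(\<Sum>k<m. B $$ (0, Suc k) * P $$ (Suc k, j))
       = (\<Sum>k<m. if Suc k = j then B $$ (0, j) else 0)"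
      by (intro sum.cong) (use j in \<open>auto simp: P_def\<close>)
    also have "\<dots> = (if j = 0 then 0 else B $$ (0, j))"
      using j by (cases j) auto
    finally show ?thesis using j a by (simp add: P_def)
  qed
  define D where "D = mat m m (\<lambda>(i, j). C $$ (Suc i, Suc j))"
  have D: "D \<in> carrier_mat m m" by (simp add: D_def)
  have one: "diag_form [a] \<in> carrier_mat 1 1" using diag_form_carrier[of "[a]"] by simp
  have "C = orth_sum (diag_form [a]) D"
    unfolding orth_sum_block[OF one D]
  proof (intro eq_matI)
    fix i j
    assume ij: "i < dim_row (four_block_mat (diag_form [a]) (0\<^sub>m 1 m) (0\<^sub>m m 1) D)"
      "j < dim_col (four_block_mat (diag_form [a]) (0\<^sub>m 1 m) (0\<^sub>m m 1) D)"
    then have "i < ?n" "j < ?n" using D by auto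
    then show "C $$ (i, j) = four_block_mat (diag_form [a]) (0\<^sub>m 1 m) (0\<^sub>m m 1) D $$ (i, j)"
      using row0[of j] row0[of i] sym[of i 0] D
      by (cases i; cases j) (auto simp: D_def)
  qed (use C D in auto)
  then show ?thesis using iso D by blast
qed

text \<open>
Induction on the dimension.  The complement of the first vector inherits symmetry and
nondegeneracy from the orthogonal sum in which it occurs.
\<close>

lemma form_diagonalizable:
  assumes "A \<in> forms"
  shows "\<exists>as. 0 \<notin> set as \<and> isometric A (diag_form as)"
proof -
  have "\<exists>as. isometric A (diag_form as)" if "A \<in> forms" "A \<in> carrier_mat n n" for n
    using that
  proof (induction n arbitrary: A)
    case 0
    then have "A = diag_form []" by (intro eq_matI) auto
    then show ?case using isometric_refl[OF 0(2)] by blast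
  next
    case (Suc m)
    obtain B where B: "isometric A B" "B $$ (0, 0) \<noteq> 0"
      using form_ex_anisotropic_first[OF Suc.prems] by blast
    have BF: "B \<in> forms" "B \<in> carrier_mat (Suc m) (Suc m)"
      using forms_isometric isometric_carrier Suc.prems B by blast+
    define a where "a = B $$ (0, 0)"
    obtain C where C: "C \<in> carrier_mat m m" "isometric B (orth_sum (diag_form [a]) C)"
      using form_split_first[OF BF HOL.refl B(2)] unfolding a_def by (elim bexE)
    have one: "diag_form [a] \<in> carrier_mat 1 1" using diag_form_carrier[of "[a]"] by simp
    have S: "orth_sum (diag_form [a]) C \<in> forms" using forms_isometric BF C by blast
    then have "transpose_mat (orth_sum (diag_form [a]) C) = orth_sum (diag_form [a]) C"
       "det (orth_sum (diag_form [a]) C) \<noteq> 0" unfolding forms_iff_det by auto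
    moreover have "det (orth_sum (diag_form [a]) C) = a * det C"
      unfolding orth_sum_block[OF one C(1)]
      using det_four_block_mat_upper_right_zero[OF one HOL.refl _ C(1)] det_diag_form[of "[a]"] by simp
    moreover have "transpose_mat (orth_sum (diag_form [a]) C) = orth_sum (transpose_mat (diag_form [a])) (transpose_mat C)"
      using C(1) one transpose_four_block_mat[OF one _ _ C(1), of "0\<^sub>m 1 m" "0\<^sub>m m 1"]
      by (simp add: orth_sum_block[of _ 1 _ m])
    ultimately have eq: "orth_sum (transpose_mat (diag_form [a])) (transpose_mat C) = orth_sum (diag_form [a]) C"
      and dC: "det C \<noteq> 0" by auto
    have one': "transpose_mat (diag_form [a]) \<in> carrier_mat 1 1" using one by simp
    have "transpose_mat C = C"
    proof (intro eq_matI)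
      fix i j assume "i < dim_row C" "j < dim_col C"
      then show "transpose_mat C $$ (i, j) = C $$ (i, j)"
        using C(1) one one' arg_cong[OF eq, of "\<lambda>M. M $$ (Suc i, Suc j)"]
          orth_sum_block[OF one C(1)] orth_sum_block[OF one', of "transpose_mat C" m] by simp
    qed (use C in auto)
    then have "C \<in> forms" using C dC unfolding forms_iff_det by auto
    then obtain as where as: "isometric C (diag_form as)" using Suc.IH C by blast
    have "isometric (orth_sum (diag_form [a]) C) (orth_sum (diag_form [a]) (diag_form as))"
      using isometric_orth_sum[OF one C(1) isometric_refl[OF one] as] .
    then have "isometric A (diag_form ([a] @ as))"
      unfolding orth_sum_diag_form using isometric_trans B C BF Suc.prems by blast
    then show ?case by blast
  qed
  then obtain as where "isometric A (diag_form as)"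
    using assms unfolding forms_iff_det by auto
  then show ?thesis using assms forms_isometric diag_form_forms by blast
qed

definition hyps :: "nat \<Rightarrow> rat list" where "hyps m = concat (replicate m [1, - 1])"

lemma hyps_Suc: "hyps (Suc m) = 1 # - 1 # hyps m" by (simp add: hyps_def)
lemma hyps_0 [simp]: "hyps 0 = []" by (simp add: hyps_def)
lemma hyps_add: "hyps (m + n) = hyps m @ hyps n" by (simp add: hyps_def replicate_add)
lemma length_hyps [simp]: "length (hyps m) = 2 * m"
  by (induction m) (auto simp: hyps_Suc)
lemma hyps_nonzero [simp]: "0 \<notin> set (hyps m)"
  by (induction m) (auto simp: hyps_Suc)
lemma prod_hyps: "prod_list (hyps m) = (- 1) ^ m"
  by (induction m) (auto simp: hyps_Suc)

lemma hyp_plane_carrier: "hyp_plane \<in> carrier_mat 2 2"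
  by (simp add: hyp_plane_def mat_of_rows_list_def numeral_2_eq_2)

text \<open>
The vectors \<open>(1, 1)\<close> and \<open>(1/2, - 1/2)\<close> form a hyperbolic pair for \<open>\<langle>1, - 1\<rangle>\<close>.
\<close>

lemma isometric_hyp_plane: "isometric (diag_form [1, - 1]) hyp_plane"
proof -
  let ?P = "mat_of_rows_list 2 [[1, 1/2], [1, - 1/2]] :: rat mat"
  have P: "?P \<in> carrier_mat 2 2" by (simp add: mat_of_rows_list_def numeral_2_eq_2)
  have D: "diag_form [1, - 1] \<in> carrier_mat 2 2" using diag_form_carrier[of "[1, - 1]"] by (simp add: numeral_2_eq_2)
  have "det ?P \<noteq> 0"
    unfolding det_2x2[OF P] by (simp add: mat_of_rows_list_def)
  moreover have "hyp_plane = transpose_mat ?P * diag_form [1, - 1] * ?P"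
    by (rule eq_matI)
       (auto simp: hyp_plane_def mat_of_rows_list_def scalar_prod_def numeral_2_eq_2 less_Suc_eq)
  ultimately show ?thesis unfolding isometric_iff[OF D] using P by blast
qed

lemma isometric_hyp_space: "isometric (diag_form (hyps m)) (hyp_space m)"
proof (induction m)
  case 0
  have "diag_form (hyps 0) = hyp_space 0" by (intro eq_matI) (auto simp: hyp_space_def)
  then show ?case using isometric_refl[OF diag_form_carrier] by metis
next
  case (Suc m)
  have c: "hyp_space m \<in> carrier_mat (2 * m) (2 * m)"
    using isometric_carrier[OF diag_form_carrier Suc] by simp
  have "hyp_space (Suc m) = orth_sum hyp_plane (hyp_space m)"
    unfolding orth_sum_block[OF hyp_plane_carrier c]
    using c hyp_plane_carrier by (simp add: hyp_space_def Let_def)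
  then show ?case
    using isometric_orth_sum[OF diag_form_carrier diag_form_carrier isometric_hyp_plane Suc]
    by (simp add: orth_sum_diag_form hyps_Suc)
qed

definition witt_eq :: "rat list \<Rightarrow> rat list \<Rightarrow> bool" where
  "witt_eq as bs \<longleftrightarrow> (\<exists>m n. as @ hyps m \<simeq> bs @ hyps n)"

lemma witt_rel_iff:
  assumes A: "A \<in> forms" "isometric A (diag_form as)" and B: "B \<in> forms" "isometric B (diag_form bs)"
  shows "(A, B) \<in> witt_rel \<longleftrightarrow> witt_eq as bs"
proof -
  obtain n where An: "A \<in> carrier_mat n n" using A unfolding forms_iff_det by auto
  obtain m where Bm: "B \<in> carrier_mat m m" using B unfolding forms_iff_det by auto
  have H: "hyp_space k \<in> carrier_mat (2 * k) (2 * k)" for k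
    using isometric_carrier[OF diag_form_carrier isometric_hyp_space] by simp
  have 1: "isometric (orth_sum A (hyp_space k)) (diag_form (as @ hyps k))" for k
    unfolding orth_sum_diag_form[symmetric]
    using isometric_orth_sum[OF An H A(2) isometric_sym[OF diag_form_carrier isometric_hyp_space]] .
  have 2: "isometric (orth_sum B (hyp_space k)) (diag_form (bs @ hyps k))" for k
    unfolding orth_sum_diag_form[symmetric]
    using isometric_orth_sum[OF Bm H B(2) isometric_sym[OF diag_form_carrier isometric_hyp_space]] .
  have "isometric (orth_sum A (hyp_space k)) (orth_sum B (hyp_space l)) \<longleftrightarrow> as @ hyps k \<simeq> bs @ hyps l" for k l
    unfolding diag_isometric_def
    using isometric_trans isometric_sym 1[of k] 2[of l] orth_sum_carrier[OF An H] orth_sum_carrier[OF Bm H]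
      diag_form_carrier by meson
  then show ?thesis unfolding witt_rel_def witt_eq_def using A B by simp
qed

lemma witt_eq_refl: "witt_eq as as" unfolding witt_eq_def using diso_refl by blast

lemma witt_eq_sym: "witt_eq as bs \<Longrightarrow> witt_eq bs as"
  unfolding witt_eq_def using diso_sym by blast

lemma witt_eq_trans:
  assumes "witt_eq as bs" "witt_eq bs cs" "0 \<notin> set bs" shows "witt_eq as cs"
proof -
  obtain m n where 1: "as @ hyps m \<simeq> bs @ hyps n" using assms(1) witt_eq_def by blast
  obtain k l where 2: "bs @ hyps k \<simeq> cs @ hyps l" using assms(2) witt_eq_def by blast
  have "as @ hyps (m + k) \<simeq> bs @ hyps (n + k)"
    using diso_append[OF 1 diso_refl, of "hyps k"] by (simp add: hyps_add)
  also have "bs @ hyps (n + k) = bs @ hyps (k + n)" by (simp add: add.commute)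
  also have "\<dots> \<simeq> cs @ hyps (l + n)"
    using diso_append[OF 2 diso_refl, of "hyps n"] by (simp add: hyps_add)
  finally show ?thesis unfolding witt_eq_def by blast
qed

lemma diso_imp_witt_eq: "as \<simeq> bs \<Longrightarrow> witt_eq as bs"
  unfolding witt_eq_def by (intro exI[of _ 0]) simp

lemma witt_eq_append:
  assumes "witt_eq as bs" "witt_eq cs ds" "0 \<notin> set (as @ bs @ cs @ ds)"
  shows "witt_eq (as @ cs) (bs @ ds)"
proof -
  obtain m n where 1: "as @ hyps m \<simeq> bs @ hyps n" using assms(1) witt_eq_def by blast
  obtain k l where 2: "cs @ hyps k \<simeq> ds @ hyps l" using assms(2) witt_eq_def by blast
  have "(as @ cs) @ hyps (m + k) \<simeq> (as @ hyps m) @ (cs @ hyps k)"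
    using assms(3) by (intro diso_mset) (auto simp: hyps_add)
  also have "\<dots> \<simeq> (bs @ hyps n) @ (ds @ hyps l)" using 1 2 by (rule diso_append)
  also have "\<dots> \<simeq> (bs @ ds) @ hyps (n + l)"
    using assms(3) by (intro diso_mset) (auto simp: hyps_add)
  finally show ?thesis unfolding witt_eq_def by blast
qed

section \<open>The Witt group\<close>

lemma witt_rel_forms: "(A, B) \<in> witt_rel \<Longrightarrow> A \<in> forms \<and> B \<in> forms"
  by (simp add: witt_rel_def)

lemma equiv_witt_rel: "equiv forms witt_rel"
proof (rule equivI)
  show "witt_rel \<subseteq> forms \<times> forms" by (auto dest: witt_rel_forms)
  show "refl_on forms witt_rel"
  proof (rule refl_onI)
    fix A assume A: "A \<in> forms"
    then obtain as where "isometric A (diag_form as)" using form_diagonalizable by blast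
    then show "(A, A) \<in> witt_rel" using witt_rel_iff A witt_eq_refl by blast
  qed
  show "sym witt_rel"
  proof (rule symI)
    fix A B assume AB: "(A, B) \<in> witt_rel"
    then obtain as bs where "isometric A (diag_form as)" "isometric B (diag_form bs)"
      using form_diagonalizable witt_rel_forms by meson
    then show "(B, A) \<in> witt_rel" using AB witt_rel_iff witt_eq_sym witt_rel_forms by meson
  qed
  show "trans witt_rel"
  proof (rule transI)
    fix A B C assume AB: "(A, B) \<in> witt_rel" and BC: "(B, C) \<in> witt_rel"
    then obtain as bs cs where "isometric A (diag_form as)" "isometric B (diag_form bs)"
       "isometric C (diag_form cs)" "0 \<notin> set bs"
      using form_diagonalizable witt_rel_forms by meson
    then show "(A, C) \<in> witt_rel"
      using AB BC witt_rel_iff witt_eq_trans witt_rel_forms by meson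
  qed
qed

typedef witt = "forms // witt_rel"
proof -
  have "diag_form [] \<in> forms" by (simp add: diag_form_forms)
  then show ?thesis by (intro exI[of _ "witt_rel `` {diag_form []}"] quotientI)
qed

text \<open>
Every class is the class of a diagonal form, so computations in the Witt group are carried out
with lists of nonzero rational numbers.
\<close>

definition diag_class :: "rat list \<Rightarrow> witt" where
  "diag_class as = Abs_witt (witt_rel `` {diag_form as})"

lemma Rep_diag_class: "0 \<notin> set as \<Longrightarrow> Rep_witt (diag_class as) = witt_rel `` {diag_form as}"
  unfolding diag_class_def by (intro Abs_witt_inverse quotientI) (simp add: diag_form_forms)

lemma isometric_imp_witt_class:
  assumes "A \<in> forms" "isometric A (diag_form as)"
  shows "witt_rel `` {A} = witt_rel `` {diag_form as}"
proof -
  have F: "diag_form as \<in> forms" using forms_isometric assms by blast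
  then have "(A, diag_form as) \<in> witt_rel"
    using witt_rel_iff[OF assms F isometric_refl[OF diag_form_carrier]] witt_eq_refl by blast
  then show ?thesis using equiv_class_eq[OF equiv_witt_rel] by blast
qed

lemma witt_diag_cases:
  obtains as where "0 \<notin> set as" "x = diag_class as"
proof -
  obtain A where A: "A \<in> forms" "Rep_witt x = witt_rel `` {A}"
    using Rep_witt[of x] by (auto elim: quotientE)
  obtain as where as: "0 \<notin> set as" "isometric A (diag_form as)" using form_diagonalizable A by blast
  then have "Rep_witt x = Rep_witt (diag_class as)"
    using isometric_imp_witt_class A Rep_diag_class by metis
  then show ?thesis using that as by (metis Rep_witt_inject)
qed

lemma diag_class_eq_iff:
  assumes "0 \<notin> set as" "0 \<notin> set bs"
  shows "diag_class as = diag_class bs \<longleftrightarrow> witt_eq as bs"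
proof -
  have F: "diag_form as \<in> forms" "diag_form bs \<in> forms" using assms diag_form_forms by auto
  have "diag_class as = diag_class bs \<longleftrightarrow> Rep_witt (diag_class as) = Rep_witt (diag_class bs)"
    by (simp add: Rep_witt_inject)
  also have "\<dots> \<longleftrightarrow> (diag_form as, diag_form bs) \<in> witt_rel"
    unfolding Rep_diag_class[OF assms(1)] Rep_diag_class[OF assms(2)]
    using eq_equiv_class_iff[OF equiv_witt_rel F] by blast
  finally show ?thesis
    using witt_rel_iff[OF F(1) isometric_refl F(2) isometric_refl] diag_form_carrier by blast
qed

lemma in_Rep_diag_class:
  assumes "0 \<notin> set as" "A \<in> Rep_witt (diag_class as)"
  obtains bs where "A \<in> forms" "0 \<notin> set bs" "isometric A (diag_form bs)" "diag_class as = diag_class bs"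
proof -
  have AS: "(diag_form as, A) \<in> witt_rel" using assms Rep_diag_class by simp
  then have A: "A \<in> forms" "diag_form as \<in> forms" using witt_rel_forms by auto
  obtain bs where bs: "0 \<notin> set bs" "isometric A (diag_form bs)" using form_diagonalizable A by blast
  have "witt_eq as bs"
    using witt_rel_iff[OF A(2) isometric_refl A(1) bs(2)] diag_form_carrier AS by blast
  then show ?thesis using that A bs diag_class_eq_iff assms by blast
qed

lemma Rep_diag_class_self:
  "0 \<notin> set as \<Longrightarrow> diag_form as \<in> Rep_witt (diag_class as)"
  using Rep_diag_class equiv_class_self[OF equiv_witt_rel] diag_form_forms by simp

instantiation witt :: ab_group_add
begin

definition zero_witt_def: "0 = diag_class []"

definition plus_witt_def: "x + y = Abs_witt (Rep_witt x \<oplus>\<^bsub>witt_ring\<^esub> Rep_witt y)"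

text \<open>
An arbitrary diagonal representative is negated entrywise.  Independence of this choice comes for
free from the uniqueness of inverses.
\<close>

definition uminus_witt_def:
  "- x = diag_class (map uminus (SOME as. 0 \<notin> set as \<and> x = diag_class as))"

definition minus_witt_def: "(x :: witt) - y = x + (- y)"

lemma diag_class_append_aux:
  assumes "0 \<notin> set as" "0 \<notin> set bs"
  shows "Rep_witt (diag_class as) \<oplus>\<^bsub>witt_ring\<^esub> Rep_witt (diag_class bs) = Rep_witt (diag_class (as @ bs))"
proof -
  have nz: "0 \<notin> set (as @ bs)" using assms by simp
  have *: "witt_rel `` {orth_sum A B} = Rep_witt (diag_class (as @ bs))"
    if A: "A \<in> Rep_witt (diag_class as)" and B: "B \<in> Rep_witt (diag_class bs)" for A B
  proof -
    obtain as' where as: "A \<in> forms" "0 \<notin> set as'" "isometric A (diag_form as')" "diag_class as = diag_class as'"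
      using in_Rep_diag_class assms A by blast
    obtain bs' where bs: "B \<in> forms" "0 \<notin> set bs'" "isometric B (diag_form bs')" "diag_class bs = diag_class bs'"
      using in_Rep_diag_class assms B by blast
    obtain n m where c: "A \<in> carrier_mat n n" "B \<in> carrier_mat m m"
      using as(1) bs(1) unfolding forms_iff_det by auto
    have "isometric (orth_sum A B) (diag_form (as' @ bs'))"
      unfolding orth_sum_diag_form[symmetric] using isometric_orth_sum[OF c as(3) bs(3)] .
    then have "witt_rel `` {orth_sum A B} = witt_rel `` {diag_form (as' @ bs')}"
      using isometric_imp_witt_class forms_orth_sum as bs by blast
    also have "\<dots> = Rep_witt (diag_class (as' @ bs'))" using Rep_diag_class as bs by simp
    also have "diag_class (as' @ bs') = diag_class (as @ bs)"
      using as bs assms by (auto simp: diag_class_eq_iff intro!: witt_eq_append intro: witt_eq_sym)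
    finally show ?thesis .
  qed
  have "(\<Union>A\<in>Rep_witt (diag_class as). \<Union>B\<in>Rep_witt (diag_class bs). witt_rel `` {orth_sum A B})
      = (\<Union>A\<in>Rep_witt (diag_class as). \<Union>B\<in>Rep_witt (diag_class bs). Rep_witt (diag_class (as @ bs)))"
    by (intro SUP_cong HOL.refl *)
  also have "\<dots> = Rep_witt (diag_class (as @ bs))"
    using Rep_diag_class_self assms by auto
  finally show ?thesis by (simp add: witt_ring_def)
qed

lemma diag_class_append:
  "0 \<notin> set as \<Longrightarrow> 0 \<notin> set bs \<Longrightarrow> diag_class (as @ bs) = diag_class as + diag_class bs"
  unfolding plus_witt_def by (simp add: diag_class_append_aux Rep_witt_inverse)

lemma diag_class_diso: "0 \<notin> set as \<Longrightarrow> as \<simeq> bs \<Longrightarrow> diag_class as = diag_class bs"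
  using diso_imp_witt_eq diso_nonzero diag_class_eq_iff by metis

lemma diag_class_mset: "0 \<notin> set as \<Longrightarrow> mset as = mset bs \<Longrightarrow> diag_class as = diag_class bs"
  using diag_class_diso diso_mset by blast

lemma witt_eq_hyps: "witt_eq (hyps m) []"
  unfolding witt_eq_def by (intro exI[of _ 0] exI[of _ m]) simp

lemma diag_class_uminus:
  assumes "0 \<notin> set as" shows "diag_class (map uminus as) + diag_class as = 0"
  using assms
proof (induction as)
  case Nil
  then show ?case using diag_class_append[of "[]" "[]"] by (simp add: zero_witt_def)
next
  case (Cons a as)
  have nz: "0 \<notin> set (map uminus as)" using Cons by auto
  have "diag_class (map uminus (a # as)) + diag_class (a # as)
      = diag_class (map uminus (a # as) @ (a # as))"
    using Cons nz by (subst diag_class_append) auto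
  also have "\<dots> = diag_class ([a, - a] @ map uminus as @ as)"
    using Cons nz by (intro diag_class_mset) auto
  also have "\<dots> = diag_class ([1, - 1] @ map uminus as @ as)"
  proof (rule diag_class_diso)
    show "[a, - a] @ map uminus as @ as \<simeq> [1, - 1] @ map uminus as @ as"
      using Cons.prems by (intro diso_append diso_hyperbolic diso_refl) simp
  qed (use Cons nz in auto)
  also have "\<dots> = diag_class (hyps 1) + diag_class (map uminus as @ as)"
    using Cons nz by (subst diag_class_append) (auto simp: hyps_def)
  also have "diag_class (hyps 1) = diag_class []"
    using witt_eq_hyps by (simp add: diag_class_eq_iff)
  also have "diag_class [] + diag_class (map uminus as @ as) = diag_class (map uminus as) + diag_class as"
    using Cons nz diag_class_append[of "[]" "map uminus as @ as"] diag_class_append[of "map uminus as" as] by simp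
  finally show ?case using Cons by simp
qed

instance
proof
  fix x y z :: witt
  obtain as where as: "0 \<notin> set as" "x = diag_class as" by (rule witt_diag_cases)
  obtain bs where bs: "0 \<notin> set bs" "y = diag_class bs" by (rule witt_diag_cases)
  obtain cs where cs: "0 \<notin> set cs" "z = diag_class cs" by (rule witt_diag_cases)
  show "x + y + z = x + (y + z)"
    using as bs cs by (simp add: diag_class_append[symmetric])
  show "x + y = y + x"
    using as bs diag_class_mset[of "as @ bs" "bs @ as"] by (simp add: diag_class_append[symmetric])
  show "0 + x = x" using as by (simp add: zero_witt_def diag_class_append[symmetric])
  have "\<exists>as. 0 \<notin> set as \<and> x = diag_class as" using as by blast
  from someI_ex[OF this]
  show "- x + x = 0" unfolding uminus_witt_def using diag_class_uminus by metis
  show "x - y = x + - y" by (rule minus_witt_def)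
qed

end

definition brac :: "rat \<Rightarrow> witt" where
  "brac a = (if a = 0 then 0 else diag_class [a])"

lemma brac_0 [simp]: "brac 0 = 0" by (simp add: brac_def)

lemma diag_class_sum: "0 \<notin> set as \<Longrightarrow> diag_class as = sum_list (map brac as)"
proof (induction as)
  case (Cons a as)
  then show ?case using diag_class_append[of "[a]" as] by (auto simp: brac_def)
qed (simp add: zero_witt_def)

lemma brac_uminus [simp]: "brac (- a) = - brac a"
proof (cases "a = 0")
  case False
  then show ?thesis using diag_class_uminus[of "[a]"]
    by (simp add: brac_def eq_neg_iff_add_eq_0)
qed simp

lemma brac_square: "t \<noteq> 0 \<Longrightarrow> brac (a * t\<^sup>2) = brac a"
  using diag_class_diso[OF _ diso_square, of a t] by (auto simp: brac_def)

text \<open>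
The relation \<open>\<langle>a, b\<rangle> \<cong> \<langle>a + b, ab(a + b)\<rangle>\<close> says that the class of a nondegenerate triangle
with \<open>(ab)\<^sub>2\<^sub>1 = a\<^sub>2\<^sub>1 + b\<^sub>2\<^sub>1\<close> is a coboundary.
\<close>

lemma brac_add:
  assumes "a * b * (a + b) \<noteq> 0"
  shows "brac (a * b * (a + b)) = brac a + brac b - brac (a + b)"
  using diag_class_diso[OF _ diso_add, of a b] assms diag_class_append[of "[a]" "[b]"]
    diag_class_append[of "[a + b]" "[a * b * (a + b)]"]
  by (simp add: brac_def eq_diff_eq add.commute)

lemma Rep_witt_add: "Rep_witt (x + y) = Rep_witt x \<oplus>\<^bsub>witt_ring\<^esub> Rep_witt y"
proof -
  obtain as where as: "0 \<notin> set as" "x = diag_class as" by (rule witt_diag_cases)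
  obtain bs where bs: "0 \<notin> set bs" "y = diag_class bs" by (rule witt_diag_cases)
  show ?thesis using as bs by (simp add: diag_class_append[symmetric] diag_class_append_aux)
qed

lemma Rep_witt_0: "Rep_witt 0 = \<zero>\<^bsub>witt_ring\<^esub>"
  by (simp add: zero_witt_def Rep_diag_class witt_ring_def diag_form_Nil)

lemma Rep_witt_brac: "Rep_witt (brac a) = witt1 a"
proof (cases "a = 0")
  case False
  have "diag_form [a] = mat 1 1 (\<lambda>_. a)" by (intro eq_matI) auto
  then show ?thesis using False by (simp add: brac_def witt1_def Rep_diag_class)
qed (simp add: witt1_def Rep_witt_0)

lemma carrier_witt_ring: "carrier witt_ring = range Rep_witt"
  by (simp add: witt_ring_def type_definition.Rep_range[OF type_definition_witt])

section \<open>Products and the square of the fundamental ideal\<close>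

lemma sum_div_mod:
  fixes F :: "nat \<Rightarrow> nat \<Rightarrow> 'a :: comm_monoid_add"
  shows "(\<Sum>k<n * m. F (k div m) (k mod m)) = (\<Sum>a<n. \<Sum>b<m. F a b)"
proof -
  have "(\<Sum>k<n * m. F (k div m) (k mod m))
      = (\<Sum>a<n. \<Sum>k\<in>{a * m..<a * m + m}. F (k div m) (k mod m))"
    by (rule sum.nat_group[symmetric])
  also have "\<dots> = (\<Sum>a<n. \<Sum>b<m. F a b)"
  proof (rule sum.cong[OF HOL.refl])
    fix a
    have "(\<Sum>k\<in>{a * m..<a * m + m}. F (k div m) (k mod m))
        = (\<Sum>b\<in>{0..<m}. F ((b + a * m) div m) ((b + a * m) mod m))"
      using sum.shift_bounds_nat_ivl[of "\<lambda>k. F (k div m) (k mod m)" 0 "a * m" m]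
      by (simp add: add.commute)
    also have "\<dots> = (\<Sum>b<m. F a b)"
      unfolding lessThan_atLeast0 by (intro sum.cong) auto
    finally show "(\<Sum>k\<in>{a * m..<a * m + m}. F (k div m) (k mod m)) = (\<Sum>b<m. F a b)" .
  qed
  finally show ?thesis .
qed

lemma div_mod_less:
  fixes i :: nat assumes "i < n * m" shows "i div m < n" "i mod m < m"
  using assms by (auto simp: less_mult_imp_div_less intro!: mod_less_divisor gr0I)

lemma tensor_form_carrier [simp]:
  "A \<in> carrier_mat n n \<Longrightarrow> B \<in> carrier_mat m m \<Longrightarrow> tensor_form A B \<in> carrier_mat (n * m) (n * m)"
  by (simp add: tensor_form_def Let_def)

lemma index_tensor_form:
  "A \<in> carrier_mat n n \<Longrightarrow> B \<in> carrier_mat m m \<Longrightarrow> i < n * m \<Longrightarrow> j < n * m \<Longrightarrow>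
   tensor_form A B $$ (i, j) = A $$ (i div m, j div m) * B $$ (i mod m, j mod m)"
  by (simp add: tensor_form_def Let_def)

lemma tensor_form_mult:
  assumes A: "A \<in> carrier_mat n n" "C \<in> carrier_mat n n" and B: "B \<in> carrier_mat m m" "D \<in> carrier_mat m m"
  shows "tensor_form A B * tensor_form C D = tensor_form (A * C) (B * D)"
proof (intro eq_matI)
  fix i j assume "i < dim_row (tensor_form (A * C) (B * D))" "j < dim_col (tensor_form (A * C) (B * D))"
  then have i: "i < n * m" and j: "j < n * m" using A B by (auto simp: tensor_form_def Let_def)
  note ij = div_mod_less[OF i] div_mod_less[OF j]
  have "(tensor_form A B * tensor_form C D) $$ (i, j)
     = (\<Sum>k<n * m. tensor_form A B $$ (i, k) * tensor_form C D $$ (k, j))"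
    using i j tensor_form_carrier[OF A(1) B(1)] tensor_form_carrier[OF A(2) B(2)]
    by (simp add: scalar_prod_def lessThan_atLeast0)
  also have "\<dots> = (\<Sum>k<n * m. (A $$ (i div m, k div m) * C $$ (k div m, j div m))
        * (B $$ (i mod m, k mod m) * D $$ (k mod m, j mod m)))"
    by (intro sum.cong) (simp_all add: index_tensor_form[OF A(1) B(1)] index_tensor_form[OF A(2) B(2)] i j)
  also have "\<dots> = (\<Sum>a<n. A $$ (i div m, a) * C $$ (a, j div m)) * (\<Sum>b<m. B $$ (i mod m, b) * D $$ (b, j mod m))"
    unfolding sum_div_mod[where F = "\<lambda>a b. (A $$ (i div m, a) * C $$ (a, j div m)) * (B $$ (i mod m, b) * D $$ (b, j mod m))"]
    by (rule sum_product[symmetric])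
  also have "\<dots> = (A * C) $$ (i div m, j div m) * (B * D) $$ (i mod m, j mod m)"
    using A B ij by (simp add: scalar_prod_def lessThan_atLeast0)
  also have "\<dots> = tensor_form (A * C) (B * D) $$ (i, j)"
    using index_tensor_form[of "A * C" n "B * D" m i j] A B i j by simp
  finally show "(tensor_form A B * tensor_form C D) $$ (i, j) = tensor_form (A * C) (B * D) $$ (i, j)" .
qed (use A B in \<open>auto simp: tensor_form_def Let_def\<close>)

lemma tensor_form_transpose:
  assumes A: "A \<in> carrier_mat n n" and B: "B \<in> carrier_mat m m"
  shows "transpose_mat (tensor_form A B) = tensor_form (transpose_mat A) (transpose_mat B)"
proof (intro eq_matI)
  fix i j assume "i < dim_row (tensor_form (transpose_mat A) (transpose_mat B))"
    "j < dim_col (tensor_form (transpose_mat A) (transpose_mat B))"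
  then have i: "i < n * m" and j: "j < n * m" using A B by (auto simp: tensor_form_def Let_def)
  show "transpose_mat (tensor_form A B) $$ (i, j) = tensor_form (transpose_mat A) (transpose_mat B) $$ (i, j)"
    using index_tensor_form[of "transpose_mat A" n "transpose_mat B" m i j] index_tensor_form[OF A B j i]
      A B i j div_mod_less[OF i] div_mod_less[OF j] carrier_matD[OF tensor_form_carrier[OF A B]] by simp
qed (use A B in \<open>auto simp: tensor_form_def Let_def\<close>)

lemma tensor_form_one: "tensor_form (1\<^sub>m n) (1\<^sub>m m) = 1\<^sub>m (n * m)"
proof (intro eq_matI)
  fix i j assume "i < dim_row (1\<^sub>m (n * m) :: rat mat)" "j < dim_col (1\<^sub>m (n * m) :: rat mat)"
  then have i: "i < n * m" and j: "j < n * m" by auto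
  have "i = j \<longleftrightarrow> i div m = j div m \<and> i mod m = j mod m"
    by (metis div_mult_mod_eq)
  then show "tensor_form (1\<^sub>m n) (1\<^sub>m m) $$ (i, j) = (1\<^sub>m (n * m) :: rat mat) $$ (i, j)"
    using i j div_mod_less[OF i] div_mod_less[OF j] index_tensor_form[of "1\<^sub>m n" n "1\<^sub>m m" m i j] by simp
qed (auto simp: tensor_form_def Let_def)

lemma isometric_tensor_form:
  assumes A: "A \<in> carrier_mat n n" and C: "C \<in> carrier_mat m m"
    and "isometric A B" "isometric C D"
  shows "isometric (tensor_form A C) (tensor_form B D)"
proof -
  obtain P where P: "P \<in> carrier_mat n n" "det P \<noteq> 0" "B = transpose_mat P * A * P"
    using assms isometric_iff by blast
  obtain Q where Q: "Q \<in> carrier_mat m m" "det Q \<noteq> 0" "D = transpose_mat Q * C * Q"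
    using assms isometric_iff by blast
  from det_non_zero_imp_unit[OF P(1,2), of "()"]
  obtain P' where P': "P' \<in> carrier_mat n n" "P * P' = 1\<^sub>m n"
    unfolding Units_def by (auto simp: ring_mat_def)
  from det_non_zero_imp_unit[OF Q(1,2), of "()"]
  obtain Q' where Q': "Q' \<in> carrier_mat m m" "Q * Q' = 1\<^sub>m m"
    unfolding Units_def by (auto simp: ring_mat_def)
  have "tensor_form P Q * tensor_form P' Q' = 1\<^sub>m (n * m)"
    using tensor_form_mult[OF P(1) P'(1) Q(1) Q'(1)] P' Q' tensor_form_one by simp
  then have "det (tensor_form P Q) * det (tensor_form P' Q') = 1"
    using det_mult[OF tensor_form_carrier[OF P(1) Q(1)] tensor_form_carrier[OF P'(1) Q'(1)]] by simp
  then have "det (tensor_form P Q) \<noteq> 0" by auto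
  moreover have "tensor_form B D = transpose_mat (tensor_form P Q) * tensor_form A C * tensor_form P Q"
  proof -
    have "transpose_mat P * A \<in> carrier_mat n n" "transpose_mat Q * C \<in> carrier_mat m m"
      using P A Q C by auto
    then show ?thesis unfolding P(3) Q(3) tensor_form_transpose[OF P(1) Q(1)]
      using P A Q C by (simp add: tensor_form_mult[of _ n _ _ m])
  qed
  ultimately show ?thesis
    unfolding isometric_iff[OF tensor_form_carrier[OF A C]] using tensor_form_carrier[OF P(1) Q(1)] by blast
qed

definition list_tensor :: "rat list \<Rightarrow> rat list \<Rightarrow> rat list" where
  "list_tensor as bs = concat (map (\<lambda>a. map ((*) a) bs) as)"

lemma list_tensor_simps [simp]:
  "list_tensor [] bs = []" "list_tensor (a # as) bs = map ((*) a) bs @ list_tensor as bs"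
  by (simp_all add: list_tensor_def)

lemma length_list_tensor [simp]: "length (list_tensor as bs) = length as * length bs"
  by (induction as) auto

lemma list_tensor_nonzero: "0 \<notin> set as \<Longrightarrow> 0 \<notin> set bs \<Longrightarrow> 0 \<notin> set (list_tensor as bs)"
  by (auto simp: list_tensor_def)

lemma nth_list_tensor:
  "i < length as * length bs \<Longrightarrow> list_tensor as bs ! i = as ! (i div length bs) * bs ! (i mod length bs)"
proof (induction as arbitrary: i)
  case (Cons a as)
  show ?case
  proof (cases "i < length bs")
    case True
    then show ?thesis by (simp add: nth_append)
  next
    case False
    then have "length bs > 0" using Cons.prems by (cases bs) auto
    then have "i div length bs = Suc ((i - length bs) div length bs)"
      "i mod length bs = (i - length bs) mod length bs"
      using False by (simp_all add: div_if[of i] mod_if[of i])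
    then show ?thesis using False Cons.IH[of "i - length bs"] Cons.prems by (simp add: nth_append)
  qed
qed simp

lemma tensor_diag_form: "tensor_form (diag_form as) (diag_form bs) = diag_form (list_tensor as bs)"
proof (intro eq_matI)
  fix i j
  assume "i < dim_row (diag_form (list_tensor as bs))" "j < dim_col (diag_form (list_tensor as bs))"
  then have i: "i < length as * length bs" and j: "j < length as * length bs" by auto
  have "i = j \<longleftrightarrow> i div length bs = j div length bs \<and> i mod length bs = j mod length bs"
    by (metis div_mult_mod_eq)
  then show "tensor_form (diag_form as) (diag_form bs) $$ (i, j) = diag_form (list_tensor as bs) $$ (i, j)"
    using i j div_mod_less[OF i] div_mod_less[OF j] nth_list_tensor[OF i]
      index_tensor_form[OF diag_form_carrier diag_form_carrier i j] by auto
qed (auto simp: tensor_form_def Let_def)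

lemma mset_list_tensor_Cons:
  "mset (list_tensor as (b # bs)) = mset (map ((*) b) as) + mset (list_tensor as bs)"
  by (induction as) (auto simp: mult.commute)

lemma mset_list_tensor_commute: "mset (list_tensor as bs) = mset (list_tensor bs as)"
proof (induction bs)
  case Nil
  then show ?case by (induction as) auto
qed (simp add: mset_list_tensor_Cons)

lemma diso_scale:
  assumes "as \<simeq> bs" "0 \<notin> set as" "c \<noteq> 0"
  shows "map ((*) c) as \<simeq> map ((*) c) bs"
proof -
  have bs: "0 \<notin> set bs" using diso_nonzero assms by blast
  from assms(1)[unfolded diso_iff[OF bs]] obtain P where
     "\<forall>i<length as. \<forall>j<length as. (\<Sum>k<length as. as ! k * P k i * P k j) = (if i = j then bs ! i else 0)"
     by (elim conjE exE)
  note P = this[rule_format]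
  have l: "length bs = length as" using diso_length assms(1) by simp
  show ?thesis
  proof (rule disoI)
    fix i j assume "i < length (map ((*) c) as)" "j < length (map ((*) c) as)"
    then have ij: "i < length as" "j < length as" by auto
    have "(\<Sum>k<length (map ((*) c) as). map ((*) c) as ! k * P k i * P k j)
       = c * (\<Sum>k<length as. as ! k * P k i * P k j)"
      unfolding sum_distrib_left by (intro sum.cong) auto
    then show "(\<Sum>k<length (map ((*) c) as). map ((*) c) as ! k * P k i * P k j)
        = (if i = j then map ((*) c) bs ! i else 0)" using P[OF ij] ij l by simp
  qed (use bs l assms in auto)
qed

lemma diag_class_scale:
  assumes "diag_class as = diag_class bs" "0 \<notin> set as" "0 \<notin> set bs" "c \<noteq> 0"
  shows "diag_class (map ((*) c) as) = diag_class (map ((*) c) bs)"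
proof -
  obtain m n where mn: "as @ hyps m \<simeq> bs @ hyps n"
    using assms diag_class_eq_iff unfolding witt_eq_def by blast
  have hyp: "diag_class (map ((*) c) (hyps k)) = 0" for k
  proof (induction k)
    case (Suc k)
    have "0 \<notin> set (map ((*) c) (hyps k))" using assms(4) by auto
    then have "diag_class (map ((*) c) (hyps (Suc k)))
      = brac c + (brac (- c) + diag_class (map ((*) c) (hyps k)))"
      using assms(4) by (simp add: hyps_Suc diag_class_sum)
    then show ?case using Suc by simp
  qed (simp add: zero_witt_def)
  have nz: "0 \<notin> set (map ((*) c) as)" "0 \<notin> set (map ((*) c) bs)" "0 \<notin> set (map ((*) c) (hyps k))" for k
    using assms by auto
  have "diag_class (map ((*) c) (as @ hyps m)) = diag_class (map ((*) c) (bs @ hyps n))"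
    using assms by (intro diag_class_diso diso_scale[OF mn]) auto
  then show ?thesis using nz hyp by (simp add: diag_class_append)
qed

lemma diag_class_list_tensor_right:
  assumes "diag_class bs = diag_class bs'" "0 \<notin> set as" "0 \<notin> set bs" "0 \<notin> set bs'"
  shows "diag_class (list_tensor as bs) = diag_class (list_tensor as bs')"
  using assms(2)
proof (induction as)
  case (Cons a as)
  then have "0 \<notin> set (map ((*) a) bs)" "0 \<notin> set (map ((*) a) bs')" using assms by auto
  then show ?case using Cons list_tensor_nonzero diag_class_scale[OF assms(1,3,4), of a] assms
    by (simp add: diag_class_append)
qed simp

lemma diag_class_list_tensor_commute:
  assumes "0 \<notin> set as" "0 \<notin> set bs"
  shows "diag_class (list_tensor as bs) = diag_class (list_tensor bs as)"
  using diag_class_mset list_tensor_nonzero mset_list_tensor_commute assms by metis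

text \<open>
The product depends on the right factor only through its class because scaling respects Witt
equivalence; commutativity transfers this to the left factor.
\<close>

lemma diag_class_list_tensor:
  assumes "diag_class as = diag_class as'" "diag_class bs = diag_class bs'"
    "0 \<notin> set as" "0 \<notin> set as'" "0 \<notin> set bs" "0 \<notin> set bs'"
  shows "diag_class (list_tensor as bs) = diag_class (list_tensor as' bs')"
proof -
  have "diag_class (list_tensor as bs) = diag_class (list_tensor as bs')"
    using diag_class_list_tensor_right assms by blast
  also have "\<dots> = diag_class (list_tensor bs' as)" using diag_class_list_tensor_commute assms by blast
  also have "\<dots> = diag_class (list_tensor bs' as')" using diag_class_list_tensor_right assms by blast
  also have "\<dots> = diag_class (list_tensor as' bs')" using diag_class_list_tensor_commute assms by blast
  finally show ?thesis .
qed

lemma forms_tensor_form: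
  assumes "A \<in> forms" "isometric A (diag_form as)" "B \<in> forms" "isometric B (diag_form bs)"
    "0 \<notin> set as" "0 \<notin> set bs"
  shows "tensor_form A B \<in> forms" "isometric (tensor_form A B) (diag_form (list_tensor as bs))"
proof -
  obtain n m where c: "A \<in> carrier_mat n n" "B \<in> carrier_mat m m"
    using assms unfolding forms_iff_det by auto
  show iso: "isometric (tensor_form A B) (diag_form (list_tensor as bs))"
    unfolding tensor_diag_form[symmetric] using isometric_tensor_form[OF c assms(2,4)] .
  show "tensor_form A B \<in> forms"
    using forms_isometric isometric_sym[OF tensor_form_carrier[OF c] iso] diag_form_forms
      list_tensor_nonzero assms by blast
qed

lemma Rep_witt_mult:
  assumes "0 \<notin> set as" "0 \<notin> set bs"
  shows "Rep_witt (diag_class as) \<otimes>\<^bsub>witt_ring\<^esub> Rep_witt (diag_class bs)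
    = Rep_witt (diag_class (list_tensor as bs))"
proof -
  have *: "witt_rel `` {tensor_form A B} = Rep_witt (diag_class (list_tensor as bs))"
    if A: "A \<in> Rep_witt (diag_class as)" and B: "B \<in> Rep_witt (diag_class bs)" for A B
  proof -
    obtain as' where as: "A \<in> forms" "0 \<notin> set as'" "isometric A (diag_form as')" "diag_class as = diag_class as'"
      using in_Rep_diag_class assms A by blast
    obtain bs' where bs: "B \<in> forms" "0 \<notin> set bs'" "isometric B (diag_form bs')" "diag_class bs = diag_class bs'"
      using in_Rep_diag_class assms B by blast
    have "witt_rel `` {tensor_form A B} = witt_rel `` {diag_form (list_tensor as' bs')}"
      by (rule isometric_imp_witt_class[OF forms_tensor_form[OF as(1,3) bs(1,3) as(2) bs(2)]])
    also have "\<dots> = Rep_witt (diag_class (list_tensor as' bs'))"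
      using Rep_diag_class list_tensor_nonzero as bs by simp
    also have "diag_class (list_tensor as' bs') = diag_class (list_tensor as bs)"
      by (rule diag_class_list_tensor[OF as(4) bs(4) assms(1) as(2) assms(2) bs(2), symmetric])
    finally show ?thesis .
  qed
  have "(\<Union>A\<in>Rep_witt (diag_class as). \<Union>B\<in>Rep_witt (diag_class bs). witt_rel `` {tensor_form A B})
      = (\<Union>A\<in>Rep_witt (diag_class as). \<Union>B\<in>Rep_witt (diag_class bs). Rep_witt (diag_class (list_tensor as bs)))"
    by (intro SUP_cong HOL.refl *)
  also have "\<dots> = Rep_witt (diag_class (list_tensor as bs))"
    using Rep_diag_class_self assms by auto
  finally show ?thesis by (simp add: witt_ring_def)
qed

text \<open>
Even dimension \<open>2k\<close> and square signed discriminant.  The sign \<open>(- 1)\<^sup>k\<close> makes the condition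
insensitive to hyperbolic planes, whose determinant is \<open>- 1\<close>.
\<close>

definition trivial_disc :: "rat list \<Rightarrow> bool" where
  "trivial_disc as \<longleftrightarrow> 0 \<notin> set as \<and>
     (\<exists>k t. length as = 2 * k \<and> t \<noteq> 0 \<and> (- 1) ^ k * prod_list as = t\<^sup>2)"

lemma trivial_disc_witt_eq:
  assumes "trivial_disc as" "diag_class as = diag_class bs" "0 \<notin> set bs"
  shows "trivial_disc bs"
proof -
  obtain k t where k: "0 \<notin> set as" "length as = 2 * k" "t \<noteq> 0" "(- 1) ^ k * prod_list as = t\<^sup>2"
    using assms(1) unfolding trivial_disc_def by blast
  obtain m n where mn: "as @ hyps m \<simeq> bs @ hyps n"
    using assms k diag_class_eq_iff unfolding witt_eq_def by blast
  have "length as + 2 * m = length bs + 2 * n" using diso_length[OF mn] by simp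
  then obtain l where l: "length bs = 2 * l" "k + m = l + n" using k
    by (metis add_diff_cancel_right' diff_mult_distrib2 distrib_left nat_mult_eq_cancel1 zero_less_numeral)
  obtain s where s: "s \<noteq> 0" "prod_list bs * (- 1) ^ n = prod_list as * (- 1) ^ m * s\<^sup>2"
    using diso_prod[OF mn] by (auto simp: prod_hyps)
  have "(- 1) ^ l * prod_list bs = (- 1) ^ (l + n) * (prod_list bs * (- 1) ^ n)"
    by (simp add: power_add mult_ac flip: power_mult_distrib)
  also have "\<dots> = (- 1) ^ (k + m) * (prod_list as * (- 1) ^ m * s\<^sup>2)" using l s by simp
  also have "\<dots> = ((- 1) ^ k * prod_list as) * s\<^sup>2"
    by (simp add: power_add mult_ac flip: power_mult_distrib)
  also have "\<dots> = (t * s)\<^sup>2" using k by (simp add: power_mult_distrib)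
  finally show ?thesis unfolding trivial_disc_def
    using assms(3) l s k by (intro conjI exI[of _ l] exI[of _ "t * s"]) auto
qed

definition witt_I2 :: "witt set" where
  "witt_I2 = {diag_class as | as. trivial_disc as}"

lemma trivial_disc_append:
  assumes "trivial_disc as" "trivial_disc bs" shows "trivial_disc (as @ bs)"
proof -
  obtain k t where k: "0 \<notin> set as" "length as = 2 * k" "t \<noteq> 0" "(- 1) ^ k * prod_list as = t\<^sup>2"
    using assms(1) unfolding trivial_disc_def by blast
  obtain l s where l: "0 \<notin> set bs" "length bs = 2 * l" "s \<noteq> 0" "(- 1) ^ l * prod_list bs = s\<^sup>2"
    using assms(2) unfolding trivial_disc_def by blast
  have "(- 1) ^ (k + l) * prod_list (as @ bs) = (t * s)\<^sup>2"
    using k(4)[symmetric] l(4)[symmetric] by (simp add: power_mult_distrib power_add)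
  then show ?thesis unfolding trivial_disc_def using k l
    by (intro conjI exI[of _ "k + l"] exI[of _ "t * s"]) auto
qed

lemma witt_I2_add:
  assumes "x \<in> witt_I2" "y \<in> witt_I2" shows "x + y \<in> witt_I2"
proof -
  obtain as bs where "trivial_disc as" "x = diag_class as" "trivial_disc bs" "y = diag_class bs"
    using assms unfolding witt_I2_def by blast
  then have "x + y = diag_class (as @ bs)" "trivial_disc (as @ bs)"
    using trivial_disc_append by (simp_all add: diag_class_append trivial_disc_def)
  then show ?thesis unfolding witt_I2_def by blast
qed

lemma trivial_disc_Nil: "trivial_disc []"
  unfolding trivial_disc_def by (intro conjI exI[of _ 0] exI[of _ 1]) auto

lemma witt_I2_0: "0 \<in> witt_I2"
  unfolding witt_I2_def zero_witt_def using trivial_disc_Nil by blast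

lemma prod_list_map_uminus: "prod_list (map uminus as) = (- 1) ^ length as * prod_list (as :: rat list)"
  by (induction as) auto

lemma witt_I2_uminus: assumes "x \<in> witt_I2" shows "- x \<in> witt_I2"
proof -
  obtain as where as: "trivial_disc as" "x = diag_class as" using assms witt_I2_def by auto
  then have nz: "0 \<notin> set as" by (simp add: trivial_disc_def)
  have "- x = diag_class (map uminus as)"
    using diag_class_uminus[OF nz] as by (simp add: neg_eq_iff_add_eq_0 add.commute)
  moreover have "trivial_disc (map uminus as)"
    using as unfolding trivial_disc_def by (auto simp: prod_list_map_uminus)
  ultimately show ?thesis unfolding witt_I2_def by blast
qed

lemma diag_class_witt_I2_iff: "0 \<notin> set as \<Longrightarrow> diag_class as \<in> witt_I2 \<longleftrightarrow> trivial_disc as"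
  unfolding witt_I2_def using trivial_disc_witt_eq[of _ as] by auto

lemma fundamental_ideal_iff:
  "U \<in> fundamental_ideal \<longleftrightarrow> (\<exists>as. 0 \<notin> set as \<and> even (length as) \<and> U = Rep_witt (diag_class as))"
proof
  assume U: "U \<in> fundamental_ideal"
  then obtain A where A: "A \<in> U" "even (dim_row A)" "U \<in> carrier witt_ring"
    unfolding fundamental_ideal_def by blast
  then obtain cs where cs: "0 \<notin> set cs" "U = Rep_witt (diag_class cs)"
    unfolding carrier_witt_ring using witt_diag_cases by (metis rangeE)
  then obtain bs where bs: "A \<in> forms" "0 \<notin> set bs" "isometric A (diag_form bs)" "diag_class cs = diag_class bs"
    using in_Rep_diag_class A by metis
  have "length bs = dim_row A"
    using isometric_carrier[OF _ bs(3), of "dim_row A"] bs(1) unfolding forms_iff_det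
    by (metis carrier_matD(1) carrier_matI dim_diag_form(1) square_mat.simps)
  then show "\<exists>as. 0 \<notin> set as \<and> even (length as) \<and> U = Rep_witt (diag_class as)"
    using A cs bs by metis
next
  assume "\<exists>as. 0 \<notin> set as \<and> even (length as) \<and> U = Rep_witt (diag_class as)"
  then show "U \<in> fundamental_ideal"
    unfolding fundamental_ideal_def carrier_witt_ring
    using Rep_diag_class_self by (metis (mono_tags, lifting) dim_diag_form(1) mem_Collect_eq rangeI)
qed

lemma prod_list_list_tensor:
  "prod_list (list_tensor as bs) = prod_list as ^ length bs * prod_list bs ^ length as"
proof (induction as)
  case (Cons a as)
  have "prod_list (map ((*) a) bs) = a ^ length bs * prod_list bs" by (induction bs) auto
  then show ?case using Cons by (simp add: power_mult_distrib)
qed simp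

lemma trivial_disc_list_tensor:
  assumes "0 \<notin> set as" "even (length as)" "0 \<notin> set bs" "even (length bs)"
  shows "trivial_disc (list_tensor as bs)"
proof -
  obtain k l where kl: "length as = 2 * k" "length bs = 2 * l" using assms by (auto elim!: evenE)
  have "prod_list (list_tensor as bs) = (prod_list as ^ l * prod_list bs ^ k)\<^sup>2"
    unfolding prod_list_list_tensor kl
    by (simp add: power_mult_distrib power_mult[symmetric] mult.commute)
  moreover have "prod_list as ^ l * prod_list bs ^ k \<noteq> 0" using assms by (simp add: prod_list_zero_iff)
  ultimately show ?thesis unfolding trivial_disc_def using list_tensor_nonzero assms kl
    by (intro conjI exI[of _ "2 * k * l"] exI[of _ "prod_list as ^ l * prod_list bs ^ k"]) auto
qed

text \<open>
Dimension reduction by \<open>\<langle>1, ab\<rangle> \<otimes> \<langle>a, c\<rangle> = \<langle>a, c, b, abc\<rangle>\<close> up to squares: subtracting this product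
replaces the first three entries \<open>a, b, c\<close> by the single entry \<open>- abc\<close>.  In dimension two,
trivial signed discriminant means hyperbolic.
\<close>

lemma trivial_disc_in_ideal_sq:
  "trivial_disc as \<Longrightarrow> length as = 2 * k \<Longrightarrow> Rep_witt (diag_class as) \<in> fundamental_ideal_sq"
proof (induction k arbitrary: as)
  case 0
  have "Rep_witt (diag_class []) \<in> fundamental_ideal" unfolding fundamental_ideal_iff
    by (intro exI[of _ "[]"]) auto
  then have "Rep_witt (diag_class []) \<otimes>\<^bsub>witt_ring\<^esub> Rep_witt (diag_class []) \<in> fundamental_ideal_sq"
    unfolding fundamental_ideal_sq_def by (intro ideal_prod.prod)
  then show ?case using 0 by (simp add: Rep_witt_mult)
next
  case (Suc k)
  from Suc.prems obtain l t where "0 \<notin> set as" "length as = 2 * l" "t \<noteq> 0" "(- 1) ^ l * prod_list as = t\<^sup>2"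
    unfolding trivial_disc_def by blast
  moreover from this have "l = Suc k" using Suc.prems by simp
  ultimately have t: "0 \<notin> set as" "t \<noteq> 0" "(- 1) ^ Suc k * prod_list as = t\<^sup>2" by auto
  show ?case
  proof (cases "k = 0")
    case True
    obtain a b where as: "as = [a, b]" using Suc.prems True
      by (auto simp: length_Suc_conv numeral_2_eq_2)
    have ab: "a \<noteq> 0" "b \<noteq> 0" "- (a * b) = t\<^sup>2" using t as True by auto
    have "- a * (t / a)\<^sup>2 = b" using ab by (simp add: field_simps power2_eq_square)
    then have "brac b = - brac a" using brac_square[of "t / a" "- a"] ab t by simp
    then have "diag_class as = diag_class []" using ab as by (simp add: diag_class_sum)
    then show ?thesis using Suc.IH[OF trivial_disc_Nil] True by simp
  next
    case False
    then obtain a b c bs where as: "as = a # b # c # bs" using Suc.prems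
      by (cases as; cases "tl as"; cases "tl (tl as)") auto
    have nz: "a \<noteq> 0" "b \<noteq> 0" "c \<noteq> 0" "0 \<notin> set bs" using t as by auto
    let ?cs = "- (a * b * c) # bs"
    have "trivial_disc ?cs" unfolding trivial_disc_def using t as nz Suc.prems
      by (intro conjI exI[of _ k] exI[of _ t]) (auto simp: mult_ac)
    then have 1: "Rep_witt (diag_class ?cs) \<in> fundamental_ideal_sq" using Suc.IH Suc.prems as by simp
    have "Rep_witt (diag_class [1, a * b]) \<in> fundamental_ideal"
      unfolding fundamental_ideal_iff using nz by (intro exI[of _ "[1, a * b]"]) auto
    moreover have "Rep_witt (diag_class [a, c]) \<in> fundamental_ideal"
      unfolding fundamental_ideal_iff using nz by (intro exI[of _ "[a, c]"]) auto
    ultimately have "Rep_witt (diag_class [1, a * b]) \<otimes>\<^bsub>witt_ring\<^esub> Rep_witt (diag_class [a, c]) \<in> fundamental_ideal_sq"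
      unfolding fundamental_ideal_sq_def by (intro ideal_prod.prod)
    then have 2: "Rep_witt (diag_class [a, c, a * b * a, a * b * c]) \<in> fundamental_ideal_sq"
      using nz by (simp add: Rep_witt_mult)
    have "brac (a * b * a) = brac b" using brac_square[of a b] nz by (simp add: power2_eq_square mult_ac)
    then have "diag_class as = diag_class [a, c, a * b * a, a * b * c] + diag_class ?cs"
      using nz as by (simp add: diag_class_sum add_ac)
    then show ?thesis using 1 2 Rep_witt_add unfolding fundamental_ideal_sq_def
      by (metis ideal_prod.sum)
  qed
qed

lemma fundamental_ideal_sq_eq: "fundamental_ideal_sq = Rep_witt ` witt_I2"
proof
  show "Rep_witt ` witt_I2 \<subseteq> fundamental_ideal_sq"
    using trivial_disc_in_ideal_sq unfolding witt_I2_def trivial_disc_def by blast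
  show "fundamental_ideal_sq \<subseteq> Rep_witt ` witt_I2"
  proof
    fix U assume "U \<in> fundamental_ideal_sq"
    then have "U \<in> ideal_prod witt_ring fundamental_ideal fundamental_ideal"
      by (simp add: fundamental_ideal_sq_def)
    then show "U \<in> Rep_witt ` witt_I2"
    proof (induction rule: ideal_prod.induct)
      case (prod i j)
      then obtain as bs where as: "0 \<notin> set as" "even (length as)" "i = Rep_witt (diag_class as)"
        and bs: "0 \<notin> set bs" "even (length bs)" "j = Rep_witt (diag_class bs)"
        unfolding fundamental_ideal_iff by blast
      have "diag_class (list_tensor as bs) \<in> witt_I2"
        using trivial_disc_list_tensor as bs unfolding witt_I2_def by blast
      then show ?case using as bs Rep_witt_mult by blast
    next
      case (sum s1 s2)
      then obtain x y where "x \<in> witt_I2" "y \<in> witt_I2" "s1 = Rep_witt x" "s2 = Rep_witt y" by blast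
      then show ?case using witt_I2_add[of x y] by (simp add: Rep_witt_add[symmetric])
    qed
  qed
qed

section \<open>The norm\<close>

lemma bil_diag_form:
  assumes "v \<in> carrier_vec (length as)"
  shows "bil (diag_form as) v v = (\<Sum>i<length as. as ! i * (v $ i)\<^sup>2)"
proof -
  have "(diag_form as *\<^sub>v v) $ i = as ! i * v $ i" if i: "i < length as" for i
  proof -
    have "(diag_form as *\<^sub>v v) $ i = (\<Sum>j<length as. (if i = j then as ! i else 0) * v $ j)"
      using i assms by (simp add: scalar_prod_def lessThan_atLeast0)
    also have "\<dots> = (\<Sum>j<length as. if j = i then as ! i * v $ i else 0)"
      by (intro sum.cong) auto
    finally show ?thesis using i by simp
  qed
  then show ?thesis using assms unfolding bil_def
    by (simp add: scalar_prod_def lessThan_atLeast0 power2_eq_square mult.left_commute)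
qed

lemma not_anisotropic_hyp:
  "\<not> anisotropic (diag_form (1 # - 1 # as))"
proof
  let ?n = "length (1 # - 1 # as)"
  let ?v = "vec ?n (\<lambda>i. if i < 2 then 1 else 0) :: rat vec"
  assume "anisotropic (diag_form (1 # - 1 # as))"
  moreover have "bil (diag_form (1 # - 1 # as)) ?v ?v = 0"
    by (subst bil_diag_form) (simp_all add: sum.lessThan_Suc_shift del: sum.lessThan_Suc)
  ultimately have "?v = 0\<^sub>v ?n" unfolding anisotropic_def by simp
  from arg_cong[OF this, of "\<lambda>v. v $ 0"] show False by simp
qed

lemma anisotropic_isometric:
  assumes A: "A \<in> carrier_mat n n" and "isometric A B" "anisotropic A" shows "anisotropic B"
proof -
  obtain P where P: "P \<in> carrier_mat n n" "det P \<noteq> 0" "B = transpose_mat P * A * P"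
    using assms isometric_iff by blast
  have B: "B \<in> carrier_mat n n" using isometric_carrier assms by blast
  show ?thesis unfolding anisotropic_def
  proof (intro ballI impI)
    fix v assume v0: "v \<in> carrier_vec (dim_row B)" and z: "bil B v v = 0"
    have v: "v \<in> carrier_vec n" using v0 B by simp
    have Pv: "P *\<^sub>v v \<in> carrier_vec n" using P v by simp
    have "B *\<^sub>v v = transpose_mat P *\<^sub>v (A *\<^sub>v (P *\<^sub>v v))"
      unfolding P(3) using A P(1) v by (simp add: assoc_mult_mat_vec[of _ n n _ n])
    moreover have "v \<bullet> (transpose_mat P *\<^sub>v w) = (P *\<^sub>v v) \<bullet> w" if "w \<in> carrier_vec n" for w
      using transpose_vec_mult_scalar[OF P(1) v that] that v P(1)
      by (metis comm_scalar_prod mult_mat_vec_carrier transpose_carrier_mat)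
    ultimately have "bil A (P *\<^sub>v v) (P *\<^sub>v v) = 0"
      using z A Pv unfolding bil_def by (metis mult_mat_vec_carrier)
    then have "P *\<^sub>v v = 0\<^sub>v n" using assms(3) Pv A unfolding anisotropic_def by auto
    then have "v = 0\<^sub>v n" using det_0_iff_vec_prod_zero_field[OF P(1)] P(2) v by blast
    then show "v = 0\<^sub>v (dim_row B)" using B by simp
  qed
qed

text \<open>
If the anisotropic form were longer, cancelling the common hyperbolic planes would leave a
hyperbolic plane inside it.
\<close>

lemma anisotropic_length_unique:
  assumes "0 \<notin> set as" "0 \<notin> set bs" "anisotropic (diag_form bs)"
    "diag_class as = diag_class bs"
  shows "length bs \<le> length as"
proof -
  obtain m n where mn: "as @ hyps m \<simeq> bs @ hyps n"
    using assms diag_class_eq_iff unfolding witt_eq_def by blast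
  show ?thesis
  proof (rule ccontr)
    assume "\<not> ?thesis"
    then have "n < m" using diso_length[OF mn] by simp
    then obtain k where k: "m = n + Suc k" by (metis add_Suc_right less_imp_Suc_add)
    have "mset (hyps m) = mset (hyps n) + mset (hyps (Suc k))" unfolding k hyps_add by simp
    then have "hyps n @ (hyps (Suc k) @ as) \<simeq> as @ hyps m"
      using assms by (intro diso_mset) auto
    also have "\<dots> \<simeq> bs @ hyps n" using mn .
    also have "\<dots> \<simeq> hyps n @ bs" using assms by (intro diso_mset) auto
    finally have "hyps n @ (hyps (Suc k) @ as) \<simeq> hyps n @ bs" .
    moreover have "0 \<notin> set (hyps (Suc k) @ as)" using assms(1) by simp
    ultimately have "hyps (Suc k) @ as \<simeq> bs" using diso_cancel_append hyps_nonzero by blast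
    then have "isometric (diag_form bs) (diag_form (1 # - 1 # hyps k @ as))"
      using diso_sym by (simp add: hyps_Suc diag_isometric_def)
    then show False using anisotropic_isometric[OF diag_form_carrier] assms not_anisotropic_hyp by blast
  qed
qed

lemma witt_norm_anisotropic:
  assumes "0 \<notin> set as" "anisotropic (diag_form as)"
  shows "witt_norm (Rep_witt (diag_class as)) = length as"
  unfolding witt_norm_def
proof (rule the_equality)
  show "\<exists>A\<in>Rep_witt (diag_class as). anisotropic A \<and> dim_row A = length as"
    using assms Rep_diag_class_self by (intro bexI[of _ "diag_form as"]) auto
next
  fix n assume "\<exists>A\<in>Rep_witt (diag_class as). anisotropic A \<and> dim_row A = n"
  then obtain A where A: "A \<in> Rep_witt (diag_class as)" "anisotropic A" "dim_row A = n" by blast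
  obtain bs where bs: "A \<in> forms" "0 \<notin> set bs" "isometric A (diag_form bs)" "diag_class as = diag_class bs"
    using in_Rep_diag_class assms A by blast
  have c: "A \<in> carrier_mat n n" using bs A unfolding forms_iff_det by auto
  have "length bs = n" using isometric_carrier[OF c bs(3)] by auto
  moreover have "anisotropic (diag_form bs)" using anisotropic_isometric[OF c bs(3)] A by blast
  ultimately show "n = length as"
    using anisotropic_length_unique[of as bs] anisotropic_length_unique[of bs as] assms bs by simp
qed

lemma diag_class_isotropic:
  assumes "0 \<notin> set as" "length rs = length as" "(\<Sum>i<length as. as ! i * (rs ! i)\<^sup>2) = 0"
    "\<exists>i<length as. rs ! i \<noteq> 0"
  shows "\<exists>bs. 0 \<notin> set bs \<and> length bs + 2 = length as \<and> diag_class as = diag_class bs"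
proof -
  obtain bs where bs: "as \<simeq> 1 # - 1 # bs" using diso_isotropic[OF assms] by blast
  then have nz: "0 \<notin> set (1 # - 1 # bs)" using diso_nonzero assms by blast
  then have "diag_class as = diag_class bs"
    using diag_class_diso[OF assms(1) bs] by (simp add: diag_class_sum)
  then show ?thesis using nz diso_length[OF bs] by (intro exI[of _ bs]) auto
qed

text \<open>
Hyperbolic planes are split off as long as there are isotropic vectors.
\<close>

lemma diag_class_ex_anisotropic:
  assumes "0 \<notin> set as"
  shows "\<exists>bs. 0 \<notin> set bs \<and> length bs \<le> length as \<and> diag_class as = diag_class bs \<and> anisotropic (diag_form bs)"
  using assms
proof (induction "length as" arbitrary: as rule: less_induct)
  case less
  show ?case
  proof (cases "anisotropic (diag_form as)")
    case True
    then show ?thesis using less by blast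
  next
    case False
    then obtain v where v: "v \<in> carrier_vec (length as)" "bil (diag_form as) v v = 0" "v \<noteq> 0\<^sub>v (length as)"
      unfolding anisotropic_def by auto
    define rs where "rs = map (\<lambda>i. v $ i) [0..<length as]"
    have rs: "rs ! i = v $ i" if "i < length as" for i using that by (simp add: rs_def)
    have "\<exists>i<length as. rs ! i \<noteq> 0"
    proof (rule ccontr)
      assume "\<not> ?thesis"
      then have "\<forall>i<length as. v $ i = 0" using rs by auto
      then have "v = 0\<^sub>v (length as)" using v(1) by (intro eq_vecI) auto
      then show False using v by blast
    qed
    moreover have "(\<Sum>i<length as. as ! i * (rs ! i)\<^sup>2) = 0"
      using v(2) rs unfolding bil_diag_form[OF v(1)] by simp
    ultimately obtain bs where bs: "0 \<notin> set bs" "length bs + 2 = length as" "diag_class as = diag_class bs"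
      using diag_class_isotropic[OF less.prems, of rs] by (auto simp: rs_def)
    then obtain cs where "0 \<notin> set cs" "length cs \<le> length bs" "diag_class bs = diag_class cs"
      "anisotropic (diag_form cs)" using less.hyps[of bs] by auto
    then show ?thesis using bs by (intro exI[of _ cs]) auto
  qed
qed

lemma witt_norm_le_iff:
  "witt_norm (Rep_witt x) \<le> N \<longleftrightarrow> (\<exists>as. 0 \<notin> set as \<and> length as \<le> N \<and> x = diag_class as)"
proof -
  obtain cs where cs: "0 \<notin> set cs" "x = diag_class cs" by (rule witt_diag_cases)
  obtain bs where bs: "0 \<notin> set bs" "x = diag_class bs" "anisotropic (diag_form bs)"
    using diag_class_ex_anisotropic cs by metis
  then have "witt_norm (Rep_witt x) = length bs" using witt_norm_anisotropic by blast
  then show ?thesis using bs anisotropic_length_unique by (metis le_trans)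
qed

section \<open>The group \<open>SL(2, \<rat>)\<close>\<close>

definition mat22 :: "rat \<Rightarrow> rat \<Rightarrow> rat \<Rightarrow> rat \<Rightarrow> rat mat" where
  "mat22 a b c d = mat 2 2 (\<lambda>(i, j). if i = 0 then (if j = 0 then a else b) else (if j = 0 then c else d))"

lemma mat22_carrier [simp]: "mat22 a b c d \<in> carrier_mat 2 2"
  by (simp add: mat22_def)

lemma mat22_index [simp]:
  "mat22 a b c d $$ (0, 0) = a" "mat22 a b c d $$ (0, Suc 0) = b"
  "mat22 a b c d $$ (Suc 0, 0) = c" "mat22 a b c d $$ (Suc 0, Suc 0) = d"
  by (simp_all add: mat22_def)

lemma mat22_eta:
  assumes "m \<in> carrier_mat 2 2"
  shows "m = mat22 (m $$ (0, 0)) (m $$ (0, Suc 0)) (m $$ (Suc 0, 0)) (m $$ (Suc 0, Suc 0))"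
  by (rule eq_matI) (use assms in \<open>auto simp: mat22_def less_2_cases_iff\<close>)

lemma mat22_mult [simp]:
  "mat22 a b c d * mat22 a' b' c' d' = mat22 (a * a' + b * c') (a * b' + b * d') (c * a' + d * c') (c * b' + d * d')"
  by (rule eq_matI) (auto simp: mat22_def scalar_prod_def numeral_2_eq_2 less_Suc_eq)

lemma mat22_eq_iff [simp]:
  "mat22 a b c d = mat22 a' b' c' d' \<longleftrightarrow> a = a' \<and> b = b' \<and> c = c' \<and> d = d'"
  by (metis mat22_index)

lemma one_mat22: "1\<^sub>m 2 = mat22 1 0 0 1"
  by (rule eq_matI) (auto simp: mat22_def less_2_cases_iff)

lemma det_mat22: "det (mat22 a b c d) = a * d - b * c"
  by (simp add: det_2x2)

lemma mat22_SL2Q: "mat22 a b c d \<in> carrier SL2Q \<longleftrightarrow> a * d - b * c = 1"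
  by (simp add: SL2Q_def det_mat22)

lemma SL2Q_cases:
  assumes "m \<in> carrier SL2Q"
  obtains a b c d where "m = mat22 a b c d" "a * d - b * c = 1"
proof -
  have "m \<in> carrier_mat 2 2" using assms by (simp add: SL2Q_def)
  from mat22_eta[OF this] show ?thesis using that assms mat22_SL2Q by metis
qed

lemma mult_SL2Q [simp]: "mult SL2Q = (*)" and one_SL2Q [simp]: "one SL2Q = 1\<^sub>m 2"
  by (simp_all add: SL2Q_def)

lemma group_SL2Q: "group SL2Q"
proof (rule groupI)
  fix x y z assume "x \<in> carrier SL2Q" "y \<in> carrier SL2Q" "z \<in> carrier SL2Q"
  then show "x \<otimes>\<^bsub>SL2Q\<^esub> y \<otimes>\<^bsub>SL2Q\<^esub> z = x \<otimes>\<^bsub>SL2Q\<^esub> (y \<otimes>\<^bsub>SL2Q\<^esub> z)"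
    by (simp add: SL2Q_def assoc_mult_mat[of x 2 2 y 2 z 2])
next
  fix x assume "x \<in> carrier SL2Q"
  then obtain a b c d where x: "x = mat22 a b c d" "a * d - b * c = 1" by (rule SL2Q_cases)
  show "\<exists>y\<in>carrier SL2Q. y \<otimes>\<^bsub>SL2Q\<^esub> x = \<one>\<^bsub>SL2Q\<^esub>"
    by (rule bexI[of _ "mat22 d (- b) (- c) a"])
       (use x in \<open>auto simp: mat22_SL2Q one_mat22 algebra_simps\<close>)
qed (auto simp: SL2Q_def det_mult[of _ 2])

interpretation SL2Q: group SL2Q by (rule group_SL2Q)

lemma SL2Q_mult_closed [simp]:
  "a \<in> carrier SL2Q \<Longrightarrow> b \<in> carrier SL2Q \<Longrightarrow> a * b \<in> carrier SL2Q"
  using SL2Q.m_closed by simp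

lemma inv_mat22 [simp]:
  assumes "a * d - b * c = 1" shows "inv\<^bsub>SL2Q\<^esub> (mat22 a b c d) = mat22 d (- b) (- c) a"
proof (rule SL2Q.inv_equality)
  show "mat22 d (- b) (- c) a \<otimes>\<^bsub>SL2Q\<^esub> mat22 a b c d = \<one>\<^bsub>SL2Q\<^esub>"
    using assms by (simp add: one_mat22 algebra_simps)
qed (use assms in \<open>auto simp: mat22_SL2Q algebra_simps\<close>)

section \<open>The triangles of the surface\<close>

definition comm_mat :: "rat mat \<times> rat mat \<Rightarrow> rat mat" where
  "comm_mat = (\<lambda>(A, B). A * B * inv\<^bsub>SL2Q\<^esub> A * inv\<^bsub>SL2Q\<^esub> B)"

fun relator_value :: "(rat mat \<times> rat mat) list \<Rightarrow> rat mat" where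
  "relator_value [] = 1\<^sub>m 2"
| "relator_value (p # ps) = comm_mat p * relator_value ps"

text \<open>
The triangles met when a commutator is multiplied out from left to right.  A pair \<open>(a, b)\<close> stands
for the triangle with edges \<open>a\<close>, \<open>b\<close> and \<open>ab\<close>.
\<close>

definition comm_chain :: "rat mat \<times> rat mat \<Rightarrow> (rat mat \<times> rat mat) list" where
  "comm_chain = (\<lambda>(A, B). [(A, B), (A * B, inv\<^bsub>SL2Q\<^esub> A), (A * B * inv\<^bsub>SL2Q\<^esub> A, inv\<^bsub>SL2Q\<^esub> B)])"

text \<open>
The last commutator is not multiplied by the empty product: that triangle has a trivial edge, and
leaving it out makes the number of triangles \<open>4g - 1\<close>.
\<close>

fun surface_chain :: "(rat mat \<times> rat mat) list \<Rightarrow> (rat mat \<times> rat mat) list" where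
  "surface_chain [] = []"
| "surface_chain [p] = comm_chain p"
| "surface_chain (p # q # ps) =
     comm_chain p @ (comm_mat p, relator_value (q # ps)) # surface_chain (q # ps)"

definition triangle :: "rat mat \<times> rat mat \<Rightarrow> rat" where
  "triangle = (\<lambda>(a, b). - (a $$ (1, 0) * (a * b) $$ (1, 0) * b $$ (1, 0)))"

definition chain_class :: "(rat mat \<times> rat mat) list \<Rightarrow> witt" where
  "chain_class T = sum_list (map (\<lambda>p. brac (triangle p)) T)"

text \<open>
The inhomogeneous coboundary of a 1-cochain, up to sign.
\<close>

definition delta :: "(rat mat \<Rightarrow> 'a :: ab_group_add) \<Rightarrow> rat mat \<times> rat mat \<Rightarrow> 'a" where
  "delta f = (\<lambda>(a, b). f (a * b) - f a - f b)"

abbreviation SL2_pairs :: "(rat mat \<times> rat mat) set" where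
  "SL2_pairs \<equiv> carrier SL2Q \<times> carrier SL2Q"

lemma comm_mat_closed [simp]: "p \<in> SL2_pairs \<Longrightarrow> comm_mat p \<in> carrier SL2Q"
  by (auto simp: comm_mat_def)

lemma relator_value_closed [simp]: "set ps \<subseteq> SL2_pairs \<Longrightarrow> relator_value ps \<in> carrier SL2Q"
  by (induction ps) (use SL2Q.one_closed in auto)

lemma comm_chain_closed [simp]: "p \<in> SL2_pairs \<Longrightarrow> set (comm_chain p) \<subseteq> SL2_pairs"
  by (auto simp: comm_chain_def)

lemma surface_chain_closed: "set ps \<subseteq> SL2_pairs \<Longrightarrow> set (surface_chain ps) \<subseteq> SL2_pairs"
proof (induction ps rule: surface_chain.induct)
  case (3 p q ps)
  then have "set (comm_chain p) \<subseteq> SL2_pairs" "comm_mat p \<in> carrier SL2Q"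
    "relator_value (q # ps) \<in> carrier SL2Q"
    by (auto simp del: relator_value.simps intro!: relator_value_closed comm_mat_closed dest: comm_chain_closed[THEN subsetD, rotated])
  then show ?case using 3 by (simp del: relator_value.simps)
qed (use comm_chain_closed in auto)

lemma length_surface_chain: "ps \<noteq> [] \<Longrightarrow> length (surface_chain ps) = 4 * length ps - 1"
  by (induction ps rule: surface_chain.induct) (auto simp: comm_chain_def split: prod.splits)

lemma sum_list_cong_mod:
  fixes J :: "'a :: ab_group_add set"
  assumes "0 \<in> J" "\<And>x y. x \<in> J \<Longrightarrow> y \<in> J \<Longrightarrow> x + y \<in> J"
    and "\<And>p. p \<in> set T \<Longrightarrow> F p - G p \<in> J"
  shows "sum_list (map F T) - sum_list (map G T) \<in> J"
  using assms(3)
proof (induction T)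
  case (Cons p T)
  then have "(F p - G p) + (sum_list (map F T) - sum_list (map G T)) \<in> J" using assms(2) by simp
  then show ?case by (simp add: algebra_simps)
qed (simp add: assms(1))

text \<open>
Every edge inside the surface borders two triangles, which contribute with opposite signs, and
only the boundary edge survives.  The edges \<open>m\<close> and \<open>m\<inverse>\<close> are identified only modulo a
subgroup \<open>J\<close>, which is the trivial group in two of the three applications and the square of the
fundamental ideal in the third.
\<close>

lemma surface_chain_telescope:
  fixes f :: "rat mat \<Rightarrow> 'a :: ab_group_add"
  assumes J: "0 \<in> J" "\<And>x y. x \<in> J \<Longrightarrow> y \<in> J \<Longrightarrow> x + y \<in> J" "\<And>x. x \<in> J \<Longrightarrow> - x \<in> J"
    and f: "\<And>m. m \<in> carrier SL2Q \<Longrightarrow> f m + f (inv\<^bsub>SL2Q\<^esub> m) \<in> J"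
    and ps: "ps \<noteq> []" "set ps \<subseteq> SL2_pairs"
  shows "sum_list (map (delta f) (surface_chain ps)) - f (relator_value ps) \<in> J"
proof -
  have c: "sum_list (map (delta f) (comm_chain p)) - f (comm_mat p) \<in> J" if pp: "p \<in> SL2_pairs" for p
  proof -
    obtain A B where p: "p = (A, B)" "A \<in> carrier SL2Q" "B \<in> carrier SL2Q" using pp by (cases p) auto
    have "- (f A + f (inv\<^bsub>SL2Q\<^esub> A)) + - (f B + f (inv\<^bsub>SL2Q\<^esub> B)) \<in> J"
      using J f p by blast
    then show ?thesis by (simp add: p comm_chain_def comm_mat_def delta_def algebra_simps)
  qed
  show ?thesis using ps
  proof (induction ps rule: surface_chain.induct)
    case (2 p)
    then have "comm_mat p * 1\<^sub>m 2 = comm_mat p" using comm_mat_closed[of p] SL2Q.r_one by simp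
    then show ?case using c[of p] 2 by simp
  next
    case (3 p q ps)
    let ?R = "relator_value (q # ps)"
    have "(sum_list (map (delta f) (comm_chain p)) - f (comm_mat p))
       + (sum_list (map (delta f) (surface_chain (q # ps))) - f ?R) \<in> J"
      using 3 c[of p] by (intro J(2)) auto
    then show ?case by (simp add: delta_def algebra_simps)
  qed simp
qed

text \<open>
When the boundary closes up, one of the \<open>4g - 1\<close> triangles has the trivial element as an edge:
the one that joins the first commutator to the rest or, in genus one, the last triangle of the
commutator.
\<close>

lemma surface_chain_trivial_pair:
  assumes "ps \<noteq> []" "set ps \<subseteq> SL2_pairs" "relator_value ps = 1\<^sub>m 2"
  shows "\<exists>L a b M. surface_chain ps = L @ (a, b) # M \<and> a * b = 1\<^sub>m 2"
proof -
  obtain A B qs where ps: "ps = (A, B) # qs" using assms(1) by (metis list.exhaust surj_pair)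
  show ?thesis
  proof (cases qs)
    case Nil
    have AB: "A \<in> carrier SL2Q" "B \<in> carrier SL2Q" using ps assms by auto
    then have "A * B * inv\<^bsub>SL2Q\<^esub> A * inv\<^bsub>SL2Q\<^esub> B = 1\<^sub>m 2"
      using assms(3) ps Nil comm_mat_closed[of "(A, B)"] SL2Q.r_one by (simp add: comm_mat_def)
    then show ?thesis using ps Nil
      by (intro exI[of _ "[(A, B), (A * B, inv\<^bsub>SL2Q\<^esub> A)]"] exI) (simp add: comm_chain_def)
  next
    case (Cons q qs')
    show ?thesis using assms(3) unfolding ps Cons
      by (intro exI[of _ "comm_chain (A, B)"] exI) simp
  qed
qed

lemma SL2Q_inverse_unique:
  "a \<in> carrier SL2Q \<Longrightarrow> b \<in> carrier SL2Q \<Longrightarrow> a * b = 1\<^sub>m 2 \<Longrightarrow> b = inv\<^bsub>SL2Q\<^esub> a"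
  using SL2Q.inv_equality[of b a] SL2Q.inv_comm[of a b] by simp

text \<open>
The degenerate triangle can be dropped from the cycle, which leaves \<open>4g - 2\<close> triangles.
\<close>

lemma closed_chain_telescope:
  fixes f :: "rat mat \<Rightarrow> 'a :: ab_group_add"
  assumes J: "0 \<in> J" "\<And>x y. x \<in> J \<Longrightarrow> y \<in> J \<Longrightarrow> x + y \<in> J" "\<And>x. x \<in> J \<Longrightarrow> - x \<in> J"
    and f: "\<And>m. m \<in> carrier SL2Q \<Longrightarrow> f m + f (inv\<^bsub>SL2Q\<^esub> m) \<in> J"
    and ps: "ps \<noteq> []" "set ps \<subseteq> SL2_pairs" "relator_value ps = 1\<^sub>m 2"
    and T: "surface_chain ps = L @ (a, b) # M" "a * b = 1\<^sub>m 2"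
  shows "sum_list (map (delta f) (L @ M)) \<in> J"
proof -
  have ab: "a \<in> carrier SL2Q" "b \<in> carrier SL2Q"
    using surface_chain_closed[OF ps(2)] T(1) by auto
  have "(sum_list (map (delta f) (surface_chain ps)) - f (1\<^sub>m 2)) + (f a + f b) \<in> J"
  proof (rule J(2))
    show "sum_list (map (delta f) (surface_chain ps)) - f (1\<^sub>m 2) \<in> J"
      using surface_chain_telescope[where J = J and f = f, OF J f ps(1,2)] ps(3) by simp
    show "f a + f b \<in> J" using f[OF ab(1)] SL2Q_inverse_unique[OF ab T(2)] by simp
  qed
  then show ?thesis by (simp add: T delta_def algebra_simps)
qed

section \<open>The upper bound\<close>

lemma SL2Q_inv_entry [simp]:
  "m \<in> carrier SL2Q \<Longrightarrow> (inv\<^bsub>SL2Q\<^esub> m) $$ (Suc 0, 0) = - m $$ (Suc 0, 0)"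
  by (erule SL2Q_cases) simp

text \<open>
A 1-cochain whose coboundary is the Witt cocycle modulo \<open>I\<^sup>2\<close>.  If \<open>m\<close> fixes the line spanned by
\<open>e\<^sub>1\<close>, the entry \<open>m\<^sub>2\<^sub>1\<close> vanishes and the eigenvalue on the quotient by that line takes its place:
left multiplication by such an \<open>m\<close> multiplies the \<open>(2,1)\<close> entry by \<open>m\<^sub>2\<^sub>2\<close>.
\<close>

definition line_class :: "rat mat \<Rightarrow> witt" where
  "line_class m = (if m $$ (1, 0) = 0 then brac (m $$ (1, 1)) - brac 1 else brac (m $$ (1, 0)))"

lemma brac_sum_in_I2:
  assumes "a \<noteq> 0" "b \<noteq> 0" "c \<noteq> 0" "d \<noteq> 0" "t \<noteq> 0" "a * b * c * d = t\<^sup>2"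
  shows "brac a + brac b + brac c + brac d \<in> witt_I2"
proof -
  have "trivial_disc [a, b, c, d]" unfolding trivial_disc_def using assms
    by (intro conjI exI[of _ 2] exI[of _ t]) (auto simp: mult.assoc)
  then show ?thesis using diag_class_witt_I2_iff[of "[a, b, c, d]"] assms
    by (simp add: diag_class_sum add.assoc)
qed

text \<open>
In each case the difference is the class of a form of dimension four whose discriminant is a
square.  For a nondegenerate triangle with entries \<open>c\<close>, \<open>c'\<close>, \<open>e\<close> this form is
\<open>\<langle>- c e c', - e, c, c'\<rangle>\<close>.
\<close>

lemma triangle_line_class:
  assumes "p \<in> SL2_pairs"
  shows "brac (triangle p) - delta line_class p \<in> witt_I2"
proof -
  obtain a b c d a' b' c' d' where p: "p = (mat22 a b c d, mat22 a' b' c' d')"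
    and dets: "a * d - b * c = 1" "a' * d' - b' * c' = 1"
    using assms by (auto elim!: SL2Q_cases)
  define e where "e = c * a' + d * c'"
  define h where "h = c * b' + d * d'"
  have t: "triangle p = - (c * e * c')" by (simp add: triangle_def p e_def)
  have D: "delta line_class p = (if e = 0 then brac h - brac 1 else brac e)
      - (if c = 0 then brac d - brac 1 else brac c) - (if c' = 0 then brac d' - brac 1 else brac c')"
    by (simp add: delta_def p line_class_def e_def h_def)
  show ?thesis
  proof (cases "c = 0")
    case c: True
    then have d: "d \<noteq> 0" using dets by auto
    show ?thesis
    proof (cases "c' = 0")
      case c': True
      then have d': "d' \<noteq> 0" using dets by auto
      have "brac (- (d * d')) + brac d + brac d' + brac (- 1) \<in> witt_I2"
        by (rule brac_sum_in_I2[of _ _ _ _ "d * d'"]) (use d d' in \<open>auto simp: power2_eq_square\<close>)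
      then show ?thesis using c c' by (simp add: t D e_def h_def algebra_simps)
    next
      case c': False
      have "brac (- (d * c')) + brac d + brac (- 1) + brac c' \<in> witt_I2"
        by (rule brac_sum_in_I2[of _ _ _ _ "d * c'"]) (use d c' in \<open>auto simp: power2_eq_square\<close>)
      then show ?thesis using c c' d by (simp add: t D e_def h_def algebra_simps)
    qed
  next
    case c: False
    show ?thesis
    proof (cases "c' = 0")
      case c': True
      then have a': "a' * d' = 1" using dets by auto
      then have nz: "a' \<noteq> 0" "d' \<noteq> 0" by auto
      have "- (c * a') * c * d' * - 1 = c * c * (a' * d')" by simp
      then have "brac (- (c * a')) + brac c + brac d' + brac (- 1) \<in> witt_I2"
        using a' by (intro brac_sum_in_I2[of _ _ _ _ c]) (use c nz in \<open>auto simp: power2_eq_square\<close>)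
      then show ?thesis using c c' nz by (simp add: t D e_def h_def algebra_simps)
    next
      case c': False
      show ?thesis
      proof (cases "e = 0")
        case e: True
        \<comment> \<open>the product maps \<open>e\<^sub>1\<close> into its own line, and its lower right entry \<open>h\<close> is \<open>- c / c'\<close>\<close>
        have "c' * h = d' * e - c * (a' * d' - b' * c')"
          by (simp add: e_def h_def algebra_simps)
        then have h: "c' * h = - c" using e dets by simp
        then have "h \<noteq> 0" using c by auto
        moreover have "- h * 1 * c * c' = - (c' * h) * c" by simp
        then have "- h * 1 * c * c' = c\<^sup>2" unfolding h by (simp add: power2_eq_square)
        ultimately have "brac (- h) + brac 1 + brac c + brac c' \<in> witt_I2"
          using c c' by (intro brac_sum_in_I2[of _ _ _ _ c]) auto
        then show ?thesis using c c' e by (simp add: t D algebra_simps)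
      next
        case e: False
        have "brac (- (c * e * c')) + brac (- e) + brac c + brac c' \<in> witt_I2"
          by (rule brac_sum_in_I2[of _ _ _ _ "c * e * c'"]) (use c c' e in \<open>auto simp: power2_eq_square\<close>)
        then show ?thesis using c c' e by (simp add: t D algebra_simps)
      qed
    qed
  qed
qed

lemma line_class_inv:
  assumes "m \<in> carrier SL2Q"
  shows "line_class m + line_class (inv\<^bsub>SL2Q\<^esub> m) \<in> witt_I2"
proof -
  obtain a b c d where m: "m = mat22 a b c d" "a * d - b * c = 1" using assms by (rule SL2Q_cases)
  show ?thesis
  proof (cases "c = 0")
    case True
    then have ad: "a * d = 1" using m by simp
    then have "d \<noteq> 0" "a \<noteq> 0" by auto
    then have "brac d + brac (- 1) + brac a + brac (- 1) \<in> witt_I2"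
      using ad by (intro brac_sum_in_I2[of _ _ _ _ 1]) (auto simp: mult.commute)
    then show ?thesis using True m by (simp add: line_class_def algebra_simps)
  next
    case False
    then show ?thesis using m witt_I2_0 by (simp add: line_class_def)
  qed
qed

text \<open>
An antisymmetric function, chosen because its coboundary on a nondegenerate triangle is
\<open>t(a, b)\<close> times a square.  A vanishing denominator gives the value zero.
\<close>

definition slope :: "rat mat \<Rightarrow> rat" where
  "slope m = (m $$ (0, 0) + m $$ (1, 1) - 2) / m $$ (1, 0)"

text \<open>
Vanishes on a nondegenerate triangle exactly if \<open>m \<mapsto> m\<^sub>2\<^sub>1\<close> is additive on it.
\<close>

definition defect :: "rat mat \<times> rat mat \<Rightarrow> rat" where
  "defect = (\<lambda>(a, b). (a $$ (1, 0) + b $$ (1, 0) - (a * b) $$ (1, 0))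
     / (a $$ (1, 0) * b $$ (1, 0) * (a * b) $$ (1, 0)))"

text \<open>
Put \<open>\<alpha> = a\<^sub>2\<^sub>1\<close>, \<open>\<beta> = b\<^sub>2\<^sub>1\<close>, \<open>\<sigma> = (ab)\<^sub>2\<^sub>1\<close>.  The identity rests on the trace relation
\<open>\<alpha>\<beta> tr(ab) - \<beta>\<sigma> tr(a) - \<alpha>\<sigma> tr(b) = - \<alpha>\<^sup>2 - \<beta>\<^sup>2 - \<sigma>\<^sup>2\<close>, which becomes
\<open>- (\<alpha> + \<beta> - \<sigma>)\<^sup>2\<close> on the right when every trace is lowered by \<open>2\<close>.
\<close>

lemma triangle_defect:
  assumes "p \<in> SL2_pairs" "triangle p \<noteq> 0"
  shows "triangle p * (defect p)\<^sup>2 = delta slope p"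
proof -
  obtain a b c d a' b' c' d' where p: "p = (mat22 a b c d, mat22 a' b' c' d')"
    and dets: "a * d - b * c = 1" "a' * d' - b' * c' = 1"
    using assms by (auto elim!: SL2Q_cases)
  define e where "e = c * a' + d * c'"
  have nz: "c \<noteq> 0" "c' \<noteq> 0" "e \<noteq> 0" using assms(2) by (auto simp: triangle_def p e_def)
  define tr where "tr = a * a' + b * c' + (c * b' + d * d')"
  have "c * c' * tr = c * c' * a * a' + c'\<^sup>2 * (b * c) + c\<^sup>2 * (b' * c') + c * c' * d * d'"
    by (simp add: tr_def power2_eq_square algebra_simps)
  also have "b * c = a * d - 1" using dets by simp
  also have "b' * c' = a' * d' - 1" using dets by simp
  finally have main: "- (c + c' - e)\<^sup>2 = c * c' * (tr - 2) - c' * e * (a + d - 2) - c * e * (a' + d' - 2)"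
    by (simp add: e_def power2_eq_square algebra_simps)
  have "triangle p * (defect p)\<^sup>2 = - (c + c' - e)\<^sup>2 / (c * c' * e)"
    using nz by (simp add: triangle_def defect_def p e_def[symmetric] power2_eq_square)
  also have "\<dots> = (tr - 2) / e - (a + d - 2) / c - (a' + d' - 2) / c'"
    unfolding main using nz by (simp add: diff_divide_distrib)
  also have "\<dots> = delta slope p"
    by (simp add: delta_def slope_def p e_def tr_def)
  finally show ?thesis .
qed

lemma slope_inv: "m \<in> carrier SL2Q \<Longrightarrow> slope m + slope (inv\<^bsub>SL2Q\<^esub> m) = 0"
  by (erule SL2Q_cases) (simp add: slope_def add.commute divide_minus_right)

lemma triangle_no_defect:
  assumes "p \<in> SL2_pairs" "triangle p \<noteq> 0" "defect p = 0"
  shows "brac (triangle p) = delta (\<lambda>m. brac (m $$ (1, 0))) p"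
proof -
  obtain a b where p: "p = (a, b)" by force
  define x y z where "x = a $$ (Suc 0, 0)" "y = b $$ (Suc 0, 0)" "z = (a * b) $$ (Suc 0, 0)"
  have nz: "x \<noteq> 0" "y \<noteq> 0" "z \<noteq> 0" using assms(2) by (auto simp: triangle_def p x_y_z_def)
  have z: "z = x + y" using assms(3) nz by (simp add: defect_def p x_y_z_def[symmetric])
  have "triangle p = - (x * y * (x + y))"
    by (simp add: triangle_def p x_y_z_def[symmetric] z)
  then show ?thesis using brac_add[of x y] nz z
    by (simp add: delta_def p x_y_z_def[symmetric])
qed

lemma chain_class_triangle_filter:
  "chain_class T = diag_class (filter (\<lambda>t. t \<noteq> 0) (map triangle T))"
proof -
  have "diag_class (filter (\<lambda>t. t \<noteq> 0) (map triangle T))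
      = sum_list (map brac (filter (\<lambda>t. t \<noteq> 0) (map triangle T)))"
    by (intro diag_class_sum) auto
  also have "\<dots> = chain_class T" unfolding chain_class_def by (induction T) auto
  finally show ?thesis by simp
qed

text \<open>
Three cases: a degenerate triangle leaves fewer than \<open>4g - 2\<close> summands, and their number is even;
if all triangles are nondegenerate, a nonzero vector of defects is isotropic by the telescoping
of \<^const>\<open>slope\<close>; a zero vector of defects makes the whole sum telescope.
\<close>

lemma chain_class_bound:
  assumes ps: "ps \<noteq> []" "set ps \<subseteq> SL2_pairs" "relator_value ps = 1\<^sub>m 2"
  shows "chain_class (surface_chain ps) \<in> witt_I2"
    and "\<exists>as. 0 \<notin> set as \<and> length as \<le> 4 * (length ps - 1) \<and> chain_class (surface_chain ps) = diag_class as"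
proof -
  let ?g = "length ps"
  obtain L a b M where LM: "surface_chain ps = L @ (a, b) # M" "a * b = 1\<^sub>m 2"
    using surface_chain_trivial_pair[OF ps] by blast
  define T where "T = L @ M"
  have TS: "set T \<subseteq> SL2_pairs" using surface_chain_closed[OF ps(2)] LM by (auto simp: T_def)
  have lenT: "length T = 4 * ?g - 2" using length_surface_chain[OF ps(1)] LM by (simp add: T_def)
  have "triangle (a, b) = 0" using LM(2) by (simp add: triangle_def one_mat22)
  then have eq: "chain_class (surface_chain ps) = chain_class T"
    by (simp add: chain_class_def LM T_def)
  have "sum_list (map (delta line_class) T) \<in> witt_I2"
    unfolding T_def
    by (rule closed_chain_telescope[where J = witt_I2 and f = line_class, OF witt_I2_0 witt_I2_add witt_I2_uminus line_class_inv ps LM])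
  moreover have "chain_class T - sum_list (map (delta line_class) T) \<in> witt_I2"
    unfolding chain_class_def using TS triangle_line_class
    by (intro sum_list_cong_mod witt_I2_0 witt_I2_add) auto
  ultimately have "chain_class T \<in> witt_I2" using witt_I2_add by fastforce
  then show I2: "chain_class (surface_chain ps) \<in> witt_I2" using eq by simp
  have telescope: "sum_list (map (delta f) T) = 0"
    if "\<And>m. m \<in> carrier SL2Q \<Longrightarrow> f m + f (inv\<^bsub>SL2Q\<^esub> m) = 0" for f :: "rat mat \<Rightarrow> 'a :: ab_group_add"
    using closed_chain_telescope[where J = "{0}" and f = f, OF _ _ _ _ ps LM] that unfolding T_def by simp
  show "\<exists>as. 0 \<notin> set as \<and> length as \<le> 4 * (?g - 1) \<and> chain_class (surface_chain ps) = diag_class as"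
  proof (cases "\<exists>p\<in>set T. triangle p = 0")
    case True
    define as where "as = filter (\<lambda>t. t \<noteq> 0) (map triangle T)"
    have "length as < length T" unfolding as_def
      using True length_filter_less[of _ "map triangle T" "\<lambda>t. t \<noteq> 0"] by force
    moreover have nz: "0 \<notin> set as" by (auto simp: as_def)
    moreover have "chain_class T = diag_class as" by (simp add: as_def chain_class_triangle_filter)
    moreover have "trivial_disc as" using I2 calculation eq diag_class_witt_I2_iff[OF nz] by simp
    then have "even (length as)" by (auto simp: trivial_disc_def)
    ultimately show ?thesis using lenT eq
      by (intro exI[of _ as]) (auto elim!: evenE)
  next
    case False
    define as where "as = map triangle T"
    have nz: "0 \<notin> set as" using False by (auto simp: as_def)
    have cls: "chain_class T = diag_class as"
      using nz by (simp add: diag_class_sum chain_class_def as_def o_def)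
    show ?thesis
    proof (cases "\<exists>p\<in>set T. defect p \<noteq> 0")
      case True
      have "(\<Sum>i<length as. as ! i * (map defect T ! i)\<^sup>2) = (\<Sum>i<length T. delta slope (T ! i))"
        unfolding as_def using TS False nth_mem
        by (intro sum.cong) (simp_all add: triangle_defect[OF subsetD])
      also have "\<dots> = sum_list (map (delta slope) T)"
        by (simp add: sum_list_sum_nth lessThan_atLeast0)
      also have "\<dots> = 0" using telescope slope_inv by blast
      finally have zero: "(\<Sum>i<length as. as ! i * (map defect T ! i)\<^sup>2) = 0" .
      obtain p where "p \<in> set T" "defect p \<noteq> 0" using True by blast
      then obtain i where "i < length T" "defect (T ! i) \<noteq> 0" by (metis in_set_conv_nth)
      then have "\<exists>i<length as. map defect T ! i \<noteq> 0" by (auto simp: as_def)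
      from diag_class_isotropic[OF nz _ zero this]
      obtain bs where "0 \<notin> set bs" "length bs + 2 = length as" "diag_class as = diag_class bs"
        by (auto simp: as_def)
      then show ?thesis using cls eq lenT by (intro exI[of _ bs]) (auto simp: as_def)
    next
      case noD: False
      have "chain_class T = sum_list (map (delta (\<lambda>m. brac (m $$ (1, 0)))) T)"
        unfolding chain_class_def using TS False noD
        by (intro arg_cong[of _ _ sum_list] map_cong HOL.refl triangle_no_defect) auto
      also have "\<dots> = 0" using telescope[of "\<lambda>m. brac (m $$ (1, 0))"] by simp
      finally show ?thesis using eq by (intro exI[of _ "[]"]) (simp add: zero_witt_def)
    qed
  qed
qed

section \<open>Realization of forms\<close>

definition shear_conj :: "rat \<Rightarrow> rat mat \<Rightarrow> rat mat" where
  "shear_conj t m = mat22 1 t 0 1 * m * mat22 1 (- t) 0 1"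

lemma shear_conj_mat22 [simp]:
  "shear_conj t (mat22 a b c d) = mat22 (a + t * c) (b + t * d - t * (a + t * c)) c (d - t * c)"
  by (simp add: shear_conj_def)

lemma shear_conj_closed [simp]: "m \<in> carrier SL2Q \<Longrightarrow> shear_conj t m \<in> carrier SL2Q"
  by (erule SL2Q_cases) (simp add: mat22_SL2Q algebra_simps)

lemma shear_conj_entry: "m \<in> carrier SL2Q \<Longrightarrow> shear_conj t m $$ (Suc 0, 0) = m $$ (Suc 0, 0)"
  by (erule SL2Q_cases) simp

lemma shear_conj_mult:
  "a \<in> carrier SL2Q \<Longrightarrow> b \<in> carrier SL2Q \<Longrightarrow> shear_conj t (a * b) = shear_conj t a * shear_conj t b"
  by (elim SL2Q_cases) (simp add: algebra_simps)

lemma shear_conj_inv: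
  "m \<in> carrier SL2Q \<Longrightarrow> inv\<^bsub>SL2Q\<^esub> (shear_conj t m) = shear_conj t (inv\<^bsub>SL2Q\<^esub> m)"
proof (elim SL2Q_cases)
  fix a b c d :: rat assume m: "m = mat22 a b c d" "a * d - b * c = 1"
  have "(a + t * c) * (d - t * c) - (b + t * d - t * (a + t * c)) * c = 1"
    using m(2) by (simp add: algebra_simps)
  from inv_mat22[OF this] show ?thesis using m by (simp add: algebra_simps)
qed

text \<open>
Unipotent matrices that fix \<open>e\<^sub>1\<close> preserve all \<open>(2,1)\<close> entries, hence all triangle numbers.
\<close>

lemma comm_chain_shear_conj:
  assumes "(A, B) \<in> SL2_pairs"
  shows "comm_mat (shear_conj t A, shear_conj t B) = shear_conj t (comm_mat (A, B))"
    and "chain_class (comm_chain (shear_conj t A, shear_conj t B)) = chain_class (comm_chain (A, B))"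
proof -
  have AB: "A \<in> carrier SL2Q" "B \<in> carrier SL2Q" using assms by auto
  show "comm_mat (shear_conj t A, shear_conj t B) = shear_conj t (comm_mat (A, B))"
    using AB by (simp add: comm_mat_def shear_conj_inv shear_conj_mult)
  have tri: "triangle (shear_conj t a, shear_conj t b) = triangle (a, b)"
    if "a \<in> carrier SL2Q" "b \<in> carrier SL2Q" for a b
    using that by (simp add: triangle_def shear_conj_entry shear_conj_mult[symmetric])
  show "chain_class (comm_chain (shear_conj t A, shear_conj t B)) = chain_class (comm_chain (A, B))"
    using AB by (simp add: comm_chain_def chain_class_def shear_conj_inv shear_conj_mult[symmetric] tri)
qed

text \<open>
A one-holed torus with prescribed triangle classes.  Normalize \<open>A\<^sub>2\<^sub>1 = B\<^sub>2\<^sub>1 = 1\<close> and \<open>A\<^sub>2\<^sub>2 = 0\<close>.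
The three triangle numbers are then \<open>- \<sigma>\<close>, \<open>\<sigma> \<delta>\<close> and \<open>\<delta> k\<close> with \<open>\<sigma> = (AB)\<^sub>2\<^sub>1\<close>,
\<open>\<delta> = (ABA\<inverse>)\<^sub>2\<^sub>1\<close> and \<open>k = [A, B]\<^sub>2\<^sub>1\<close>.  The entries \<open>B\<^sub>1\<^sub>1 = \<sigma>\<close>, \<open>r = B\<^sub>2\<^sub>2\<close>
and \<open>s = A\<^sub>1\<^sub>1\<close> are chosen one after the other to adjust \<open>\<sigma>\<close>, \<open>\<delta>\<close> and \<open>k\<close>: the last two depend
affinely on \<open>r\<close> and on \<open>s\<close>.
\<close>

lemma commutator_realization:
  assumes "x \<noteq> 0" "y \<noteq> 0" "z \<noteq> 0"
  shows "\<exists>p\<in>SL2_pairs. comm_mat p $$ (1, 0) = - (x * y * z) \<and>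
    chain_class (comm_chain p) = brac x + brac y + brac z"
proof -
  define k where "k = - (x * y * z)"
  define \<delta> where "\<delta> = - (x * y)"
  define r where "r = (1 - \<delta>) / - x"
  define s where "s = (k - x) / \<delta> - r"
  have xr: "x * r = \<delta> - 1" using assms by (simp add: r_def field_simps)
  have sr: "\<delta> * (s + r) = k - x" using assms by (simp add: s_def \<delta>_def)
  let ?A = "mat22 s (- 1) 1 0" and ?B = "mat22 (- x) (- x * r - 1) 1 r"
  have A: "?A \<in> carrier SL2Q" and B: "?B \<in> carrier SL2Q" by (simp_all add: mat22_SL2Q)
  have iA: "inv\<^bsub>SL2Q\<^esub> ?A = mat22 0 1 (- 1) s" by simp
  have iB: "inv\<^bsub>SL2Q\<^esub> ?B = mat22 r (x * r + 1) (- 1) (- x)" by (subst inv_mat22) simp_all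
  have 1: "(?A * ?B) $$ (Suc 0, 0) = - x" by simp
  have 2: "(?A * ?B * inv\<^bsub>SL2Q\<^esub> ?A) $$ (Suc 0, 0) = \<delta>"
    unfolding iA using xr by simp
  have "comm_mat (?A, ?B) $$ (Suc 0, 0) = (x * r + 1) * (s + r) + x"
    unfolding comm_mat_def prod.case iA iB by (simp add: algebra_simps)
  also have "\<dots> = k" using sr xr by simp
  finally have 3: "comm_mat (?A, ?B) $$ (Suc 0, 0) = k" .
  have "chain_class (comm_chain (?A, ?B)) = brac x + (brac (- (x * \<delta>)) + brac (\<delta> * k))"
    using 1 2 3 A B unfolding chain_class_def comm_chain_def triangle_def comm_mat_def
    by (simp del: mat22_mult inv_mat22)
  moreover have "brac (- (x * \<delta>)) = brac y"
    using brac_square[of x y] assms by (simp add: \<delta>_def power2_eq_square mult_ac)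
  moreover have "brac (\<delta> * k) = brac z"
    using brac_square[of "x * y" z] assms by (simp add: \<delta>_def k_def power2_eq_square mult_ac)
  ultimately show ?thesis using A B 3
    by (intro bexI[of _ "(?A, ?B)"]) (auto simp: k_def add.assoc)
qed

text \<open>
Tori are attached one at a time.  The new torus brings three classes and the triangle that joins it to
the rest a fourth one, which is adjusted by a unipotent conjugation of the new torus.  The
negative of the boundary entry records the determinant of the form reached so far.
\<close>

lemma one_holed_realization:
  assumes "0 \<notin> set xs" "length xs = 4 * h + 3"
  shows "\<exists>ps s. length ps = Suc h \<and> set ps \<subseteq> SL2_pairs \<and> s \<noteq> 0 \<and>
    relator_value ps $$ (1, 0) = - prod_list xs * s\<^sup>2 \<and> chain_class (surface_chain ps) = diag_class xs"
  using assms
proof (induction h arbitrary: xs)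
  case 0
  then obtain x y z where xs: "xs = [x, y, z]" by (auto simp: length_Suc_conv numeral_3_eq_3)
  then have "x \<noteq> 0" "y \<noteq> 0" "z \<noteq> 0" using 0 by auto
  from commutator_realization[OF this] obtain p where p: "p \<in> SL2_pairs"
    "comm_mat p $$ (1, 0) = - (x * y * z)" "chain_class (comm_chain p) = brac x + brac y + brac z"
    by blast
  have "comm_mat p * 1\<^sub>m 2 = comm_mat p" using comm_mat_closed[OF p(1)] SL2Q.r_one by simp
  then show ?case using p xs 0
    by (intro exI[of _ "[p]"] exI[of _ 1]) (auto simp: diag_class_sum mult.assoc add.assoc)
next
  case (Suc h)
  then obtain x y z w ys where xs: "xs = x # y # z # w # ys" "length ys = 4 * h + 3"
    by (auto simp: length_Suc_conv numeral_eq_Suc)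
  then have nz: "x \<noteq> 0" "y \<noteq> 0" "z \<noteq> 0" "w \<noteq> 0" "0 \<notin> set ys" using Suc by auto
  from Suc.IH[OF nz(5) xs(2)] obtain ps s where ps: "length ps = Suc h" "set ps \<subseteq> SL2_pairs" "s \<noteq> 0"
    "relator_value ps $$ (1, 0) = - prod_list ys * s\<^sup>2" "chain_class (surface_chain ps) = diag_class ys"
    by blast
  from commutator_realization[OF nz(1-3)] obtain A B where AB: "(A, B) \<in> SL2_pairs"
    "comm_mat (A, B) $$ (1, 0) = - (x * y * z)"
    "chain_class (comm_chain (A, B)) = brac x + brac y + brac z"
    by (metis surj_pair)
  define k where "k = - (x * y * z)"
  have k: "k \<noteq> 0" using nz by (simp add: k_def)
  obtain a b d where C: "comm_mat (A, B) = mat22 a b k d" "a * d - b * k = 1"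
    using comm_mat_closed[OF AB(1)] AB(2) unfolding k_def by (metis SL2Q_cases mat22_index(3) One_nat_def)
  obtain a' b' c' d' where R: "relator_value ps = mat22 a' b' c' d'" "a' * d' - b' * c' = 1"
    using relator_value_closed[OF ps(2)] by (rule SL2Q_cases)
  have c': "c' = - prod_list ys * s\<^sup>2" using ps(4) R by simp
  then have "c' \<noteq> 0" using nz ps(3) by (simp add: prod_list_zero_iff)
  \<comment> \<open>this shear gives the product of the boundaries the \<open>(2,1)\<close> entry \<open>- k c' w\<close>\<close>
  define t where "t = (k * a' + d * c' + k * c' * w) / (k * c')"
  have t: "t * k * c' = k * a' + d * c' + k * c' * w"
    using k \<open>c' \<noteq> 0\<close> by (simp add: t_def)
  let ?p = "(shear_conj t A, shear_conj t B)"
  have pp: "?p \<in> SL2_pairs" using AB by simp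
  have Cp: "comm_mat ?p = shear_conj t (mat22 a b k d)"
    using comm_chain_shear_conj(1)[OF AB(1)] C by simp
  have ent: "(comm_mat ?p * relator_value ps) $$ (Suc 0, 0) = - (k * c' * w)"
    unfolding Cp R using t by (simp add: algebra_simps)
  have "triangle (comm_mat ?p, relator_value ps) = w * (k * c')\<^sup>2"
    unfolding triangle_def prod.case One_nat_def ent unfolding Cp R by (simp add: power2_eq_square)
  then have tri: "brac (triangle (comm_mat ?p, relator_value ps)) = brac w"
    using brac_square k \<open>c' \<noteq> 0\<close> by simp
  obtain q qs where psq: "ps = q # qs" using ps(1) by (cases ps) auto
  have "surface_chain (?p # ps) = comm_chain ?p @ (comm_mat ?p, relator_value ps) # surface_chain ps"
    unfolding psq by simp
  then have "chain_class (surface_chain (?p # ps)) = chain_class (comm_chain ?p) + (brac w + diag_class ys)"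
    using tri ps(5) by (simp add: chain_class_def)
  also have "\<dots> = diag_class xs"
    using comm_chain_shear_conj(2)[OF AB(1)] AB(3) nz by (simp add: xs diag_class_sum add.assoc)
  finally have cls: "chain_class (surface_chain (?p # ps)) = diag_class xs" .
  have "relator_value (?p # ps) $$ (1, 0) = - prod_list xs * s\<^sup>2"
    using ent by (simp add: c' k_def xs)
  then show ?case using cls ps pp by (intro exI[of _ "?p # ps"] exI[of _ s]) auto
qed

text \<open>
If \<open>A\<close> fixes the line of \<open>e\<^sub>1\<close>, two of the three triangles of \<open>[A, B]\<close> degenerate and the third
has the class of \<open>[A, B]\<^sub>2\<^sub>1\<close>.  With \<open>A = diag(2, 1/2)\<close> the \<open>(2,1)\<close> entry and the trace of the
commutator are adjusted through \<open>B\<close>; up to a unipotent conjugation these two numbers determine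
a matrix with nonzero \<open>(2,1)\<close> entry in \<open>SL(2, \<rat>)\<close>.
\<close>

lemma triangular_commutator:
  assumes "C \<in> carrier SL2Q" "C $$ (1, 0) \<noteq> 0"
  shows "\<exists>p\<in>SL2_pairs. comm_mat p = C \<and> chain_class (comm_chain p) = brac (C $$ (1, 0))"
proof -
  obtain a b k d where C: "C = mat22 a b k d" "a * d - b * k = 1" using assms(1) by (rule SL2Q_cases)
  have k: "k \<noteq> 0" using assms C by simp
  define q where "q = 4 / 9 * (2 - (a + d))"
  define s where "s = - (4 / 3) * k"
  define r where "r = (1 + q) / s"
  have "s \<noteq> 0" using k by (simp add: s_def)
  then have rs: "r * s = 1 + q" by (simp add: r_def)
  let ?A = "mat22 2 0 0 (1 / 2)" and ?B = "mat22 r q 1 s"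
  have A: "?A \<in> carrier SL2Q" and B: "?B \<in> carrier SL2Q" using rs by (simp_all add: mat22_SL2Q)
  then have AB: "(?A, ?B) \<in> SL2_pairs" by simp
  have iA: "inv\<^bsub>SL2Q\<^esub> ?A = mat22 (1 / 2) 0 0 2" by simp
  have iB: "inv\<^bsub>SL2Q\<^esub> ?B = mat22 s (- q) (- 1) r" using rs by simp
  have C0: "comm_mat (?A, ?B) = mat22 (1 - 3 * q) (3 * r * q) k (1 + 3 / 4 * q)"
    unfolding comm_mat_def prod.case iA iB using rs by (simp add: s_def algebra_simps)
  define t where "t = (a - 1 + 3 * q) / k"
  have tk: "t * k = a - 1 + 3 * q" using k by (simp add: t_def)
  let ?p = "(shear_conj t ?A, shear_conj t ?B)"
  have p: "?p \<in> SL2_pairs" using A B by (simp del: shear_conj_mat22)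
  obtain a' b' k' d' where E: "shear_conj t (comm_mat (?A, ?B)) = mat22 a' b' k' d'" "a' * d' - b' * k' = 1"
    using shear_conj_closed[OF comm_mat_closed[OF AB]] by (rule SL2Q_cases)
  have "1 - 3 * q + t * k = a'" "k = k'" "1 + 3 / 4 * q - t * k = d'"
    using E(1) unfolding C0 shear_conj_mat22 mat22_eq_iff by blast+
  moreover have "9 * q = 8 - 4 * a - 4 * d" by (simp add: q_def)
  ultimately have "a' = a" "k' = k" "d' = d" using tk by linarith+
  moreover from this have "b' = b" using E(2) C(2) k by (metis diff_left_imp_eq mult_right_cancel)
  ultimately have pC: "comm_mat ?p = C" using comm_chain_shear_conj(1)[OF AB] E C by simp
  have "chain_class (comm_chain (?A, ?B)) = brac (k * (1 / 2)\<^sup>2)"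
    unfolding chain_class_def comm_chain_def prod.case triangle_def iA iB using rs
    by (simp add: s_def power2_eq_square)
  then have "chain_class (comm_chain (?A, ?B)) = brac (C $$ (1, 0))"
    using brac_square[of "1 / 2" k] C by simp
  then show ?thesis using comm_chain_shear_conj(2)[OF AB] p pC by metis
qed

text \<open>
After padding with hyperbolic planes to dimension \<open>4(g - 1)\<close>, all entries but the last are realized
on a surface of genus \<open>g - 1\<close> with one hole, and the hole is closed by a torus that contributes one
class.  Since the determinant of the padded form is a square, that class is the last entry.
\<close>

lemma closed_surface_realization:
  assumes "trivial_disc xs" "length xs \<le> 4 * (g - 1)" "g \<ge> 1"
  shows "\<exists>ps. length ps = g \<and> set ps \<subseteq> SL2_pairs \<and> relator_value ps = 1\<^sub>m 2 \<and>
    chain_class (surface_chain ps) = diag_class xs"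
proof (cases "g = 1")
  case True
  then have "xs = []" using assms by simp
  moreover have "comm_mat (1\<^sub>m 2, 1\<^sub>m 2) * 1\<^sub>m 2 = 1\<^sub>m 2"
    by (simp add: comm_mat_def one_mat22)
  moreover have "chain_class (comm_chain (1\<^sub>m 2, 1\<^sub>m 2)) = 0"
    by (simp add: comm_chain_def chain_class_def triangle_def one_mat22)
  ultimately show ?thesis using True SL2Q.one_closed
    by (intro exI[of _ "[(1\<^sub>m 2, 1\<^sub>m 2)]"]) (auto simp: zero_witt_def)
next
  case False
  then obtain h where g: "g = h + 2" using assms(3) by (metis add_2_eq_Suc' le_Suc_ex not_less_eq_eq One_nat_def Suc_1 le_antisym add.commute)
  have nz: "0 \<notin> set xs" and ev: "even (length xs)" using assms(1) by (auto simp: trivial_disc_def)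
  define m where "m = (4 * (h + 1) - length xs) div 2"
  define xs' where "xs' = xs @ hyps m"
  have len: "length xs' = 4 * (h + 1)" using assms(2) ev g by (simp add: xs'_def m_def)
  have nz': "0 \<notin> set xs'" using nz by (simp add: xs'_def)
  have "diag_class (hyps m) = 0"
    using witt_eq_hyps diag_class_eq_iff[of "hyps m" "[]"] by (simp add: zero_witt_def)
  then have cls: "diag_class xs' = diag_class xs"
    using nz by (simp add: xs'_def diag_class_append)
  then have "trivial_disc xs'" using trivial_disc_witt_eq[OF assms(1)] nz' by simp
  then obtain k t where "length xs' = 2 * k" "t \<noteq> 0" "(- 1) ^ k * prod_list xs' = t\<^sup>2"
    unfolding trivial_disc_def by blast
  moreover from this have "k = 2 * (h + 1)" using len by simp
  ultimately have t: "t \<noteq> 0" "prod_list xs' = t\<^sup>2" by simp_all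
  obtain ys z where xs': "xs' = ys @ [z]" using len by (cases xs' rule: rev_cases) auto
  have lys: "length ys = 4 * h + 3" and nzy: "0 \<notin> set ys" "z \<noteq> 0" using len xs' nz' by auto
  from one_holed_realization[OF nzy(1) lys] obtain ps s where ps: "length ps = Suc h" "set ps \<subseteq> SL2_pairs"
    "s \<noteq> 0" "relator_value ps $$ (1, 0) = - prod_list ys * s\<^sup>2" "chain_class (surface_chain ps) = diag_class ys"
    by blast
  define R where "R = relator_value ps"
  have R: "R \<in> carrier SL2Q" using ps(2) by (simp add: R_def)
  define C where "C = inv\<^bsub>SL2Q\<^esub> R"
  have C: "C \<in> carrier SL2Q" using R by (simp add: C_def)
  have C10: "C $$ (1, 0) = prod_list ys * s\<^sup>2" using ps(4) R by (simp add: C_def R_def)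
  then have "C $$ (1, 0) \<noteq> 0" using nzy ps(3) by (simp add: prod_list_zero_iff)
  from triangular_commutator[OF C this] obtain p where p: "p \<in> SL2_pairs" "comm_mat p = C"
    "chain_class (comm_chain p) = brac (C $$ (1, 0))" by blast
  have "C $$ (1, 0) = z * (t * s / z)\<^sup>2"
    unfolding C10 using t(2) nzy by (simp add: xs' power2_eq_square field_simps)
  then have Cz: "brac (C $$ (1, 0)) = brac z" using brac_square nzy t ps(3) by simp
  have CR: "C * R = 1\<^sub>m 2" using R SL2Q.l_inv by (simp add: C_def)
  obtain q qs where psq: "ps = q # qs" using ps(1) by (cases ps) auto
  have "triangle (C, R) = 0" using CR by (simp add: triangle_def one_mat22)
  moreover have "surface_chain (p # ps) = comm_chain p @ (C, R) # surface_chain ps"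
    unfolding psq using p by (simp add: R_def psq)
  ultimately have "chain_class (surface_chain (p # ps)) = brac z + diag_class ys"
    using p(3) Cz ps(5) by (simp add: chain_class_def)
  also have "\<dots> = diag_class xs'" using nzy by (simp add: xs' diag_class_sum add.commute)
  finally show ?thesis using ps(1,2) p(1,2) CR g cls
    by (intro exI[of _ "p # ps"]) (auto simp: R_def)
qed

section \<open>The central extension\<close>

lemma witt_cocycle_triangle: "witt_cocycle a b = Rep_witt (brac (triangle (a, b)))"
  by (simp add: witt_cocycle_def triangle_def Rep_witt_brac del: brac_uminus)

lemma witt_ext_mult:
  "(a, Rep_witt x) \<otimes>\<^bsub>witt_ext\<^esub> (b, Rep_witt y) = (a * b, Rep_witt (x + y + brac (triangle (a, b))))"
  by (simp add: witt_ext_def witt_cocycle_triangle Rep_witt_add)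

lemma triangle_inv:
  assumes "m \<in> carrier SL2Q"
  shows "triangle (m, inv\<^bsub>SL2Q\<^esub> m) = 0" "triangle (inv\<^bsub>SL2Q\<^esub> m, m) = 0"
  using SL2Q.r_inv[OF assms] SL2Q.l_inv[OF assms] by (simp_all add: triangle_def one_mat22)

text \<open>
The defining property of the inverse determines both components directly, because the cocycle
vanishes on \<open>(m, m\<inverse>)\<close>.
\<close>

lemma witt_ext_inv:
  assumes m: "m \<in> carrier SL2Q"
  shows "inv\<^bsub>witt_ext\<^esub> (m, Rep_witt x) = (inv\<^bsub>SL2Q\<^esub> m, Rep_witt (- x))"
  unfolding m_inv_def[of witt_ext]
proof (rule the_equality)
  have one: "\<one>\<^bsub>witt_ext\<^esub> = (1\<^sub>m 2, Rep_witt 0)" by (simp add: witt_ext_def Rep_witt_0)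
  show "(inv\<^bsub>SL2Q\<^esub> m, Rep_witt (- x)) \<in> carrier witt_ext \<and>
    (m, Rep_witt x) \<otimes>\<^bsub>witt_ext\<^esub> (inv\<^bsub>SL2Q\<^esub> m, Rep_witt (- x)) = \<one>\<^bsub>witt_ext\<^esub> \<and>
    (inv\<^bsub>SL2Q\<^esub> m, Rep_witt (- x)) \<otimes>\<^bsub>witt_ext\<^esub> (m, Rep_witt x) = \<one>\<^bsub>witt_ext\<^esub>"
    using m SL2Q.r_inv[OF m] SL2Q.l_inv[OF m]
    by (simp add: one witt_ext_mult triangle_inv) (simp add: witt_ext_def carrier_witt_ring)
  fix y assume y: "y \<in> carrier witt_ext \<and> (m, Rep_witt x) \<otimes>\<^bsub>witt_ext\<^esub> y = \<one>\<^bsub>witt_ext\<^esub> \<and>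
    y \<otimes>\<^bsub>witt_ext\<^esub> (m, Rep_witt x) = \<one>\<^bsub>witt_ext\<^esub>"
  then obtain n z where yn: "y = (n, Rep_witt z)" "n \<in> carrier SL2Q"
    by (auto simp: witt_ext_def carrier_witt_ring)
  have "m * n = 1\<^sub>m 2" and s: "Rep_witt (x + z + brac (triangle (m, n))) = Rep_witt 0"
    using y unfolding yn witt_ext_mult one by auto
  then have n: "n = inv\<^bsub>SL2Q\<^esub> m" using SL2Q_inverse_unique m yn by blast
  then have "x + z = 0" using s triangle_inv[OF m] by (simp add: Rep_witt_inject)
  then show "y = (inv\<^bsub>SL2Q\<^esub> m, Rep_witt (- x))" using yn n by (simp add: Rep_witt_inject eq_neg_iff_add_eq_0 add.commute)
qed

lemma witt_ext_commutator:
  assumes "A \<in> carrier SL2Q" "B \<in> carrier SL2Q"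
  shows "commutator witt_ext (lift_ext A) (lift_ext B)
    = (comm_mat (A, B), Rep_witt (chain_class (comm_chain (A, B))))"
proof -
  have l: "lift_ext m = (m, Rep_witt 0)" for m by (simp add: lift_ext_def Rep_witt_0)
  show ?thesis using assms
    by (simp add: commutator_def l witt_ext_inv witt_ext_mult comm_mat_def comm_chain_def chain_class_def add.assoc)
qed

lemma prod_commutators_witt_ext:
  assumes "\<And>i. i < g \<Longrightarrow> A i \<in> carrier SL2Q" "\<And>i. i < g \<Longrightarrow> B i \<in> carrier SL2Q"
  shows "prod_commutators witt_ext g (\<lambda>i. lift_ext (A i)) (\<lambda>i. lift_ext (B i))
    = (relator_value (map (\<lambda>i. (A i, B i)) [0..<g]),
       Rep_witt (chain_class (surface_chain (map (\<lambda>i. (A i, B i)) [0..<g]))))"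
proof -
  let ?F = "\<lambda>i z. commutator witt_ext (lift_ext (A i)) (lift_ext (B i)) \<otimes>\<^bsub>witt_ext\<^esub> z"
  have "foldr ?F is \<one>\<^bsub>witt_ext\<^esub> = (relator_value (map (\<lambda>i. (A i, B i)) is),
       Rep_witt (chain_class (surface_chain (map (\<lambda>i. (A i, B i)) is))))"
    if "\<forall>i\<in>set is. A i \<in> carrier SL2Q \<and> B i \<in> carrier SL2Q" for "is"
    using that
  proof (induction "is")
    case Nil
    then show ?case by (simp add: witt_ext_def Rep_witt_0 chain_class_def)
  next
    case (Cons i js)
    then have AB: "A i \<in> carrier SL2Q" "B i \<in> carrier SL2Q" by auto
    have "triangle (m, 1\<^sub>m 2) = 0" for m by (simp add: triangle_def one_mat22)
    then show ?case using Cons AB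
      by (cases js) (simp_all add: witt_ext_commutator witt_ext_mult chain_class_def add_ac)
  qed
  then show ?thesis unfolding prod_commutators_def using assms by simp
qed

section \<open>Representations of the surface group\<close>

lemma surface_relator_words: "surface_relator g \<in> surface_words g"
  by (auto simp: surface_relator_def surface_words_def)

lemma surface_words_append [simp]:
  "u @ v \<in> surface_words g \<longleftrightarrow> u \<in> surface_words g \<and> v \<in> surface_words g"
  by (auto simp: surface_words_def)

lemma surface_words_Nil [simp]: "[] \<in> surface_words g"
  by (simp add: surface_words_def)

definition gens :: "nat \<Rightarrow> surface_gen set" where
  "gens g = GenA ` {..<g} \<union> GenB ` {..<g}"

lemma surface_words_Cons [simp]: "(e, x) # w \<in> surface_words g \<longleftrightarrow> x \<in> gens g \<and> w \<in> surface_words g"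
  by (auto simp: surface_words_def gens_def)

lemma surface_rel_words: "(u, v) \<in> surface_rel g \<Longrightarrow> u \<in> surface_words g \<and> v \<in> surface_words g"
proof (induction rule: surface_rel.induct)
  case (cancel u e x v)
  then show ?case by (simp add: surface_words_def)
qed (use surface_relator_words in auto)

lemma equiv_surface_rel: "equiv (surface_words g) (surface_rel g)"
  by (rule equivI)
     (auto simp: refl_on_def intro: surface_rel.refl surface_rel.trans surface_rel.sym symI transI dest: surface_rel_words)

lemma surface_rel_append_left:
  "(u, v) \<in> surface_rel g \<Longrightarrow> w \<in> surface_words g \<Longrightarrow> (w @ u, w @ v) \<in> surface_rel g"
proof (induction rule: surface_rel.induct)
  case (cancel u e x v)
  then show ?case using surface_rel.cancel[of "w @ u" e x v g] by simp
next
  case (relator u v)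
  then show ?case using surface_rel.relator[of "w @ u" v g] by simp
qed (auto intro: surface_rel.refl surface_rel.trans surface_rel.sym)

lemma surface_rel_append_right:
  "(u, v) \<in> surface_rel g \<Longrightarrow> w \<in> surface_words g \<Longrightarrow> (u @ w, v @ w) \<in> surface_rel g"
proof (induction rule: surface_rel.induct)
  case (cancel u e x v)
  then show ?case using surface_rel.cancel[of u e x "v @ w" g] by simp
next
  case (relator u v)
  then show ?case using surface_rel.relator[of u "v @ w" g] by simp
qed (auto intro: surface_rel.refl surface_rel.trans surface_rel.sym)

abbreviation word_class :: "nat \<Rightarrow> surface_word \<Rightarrow> surface_word set" where
  "word_class g w \<equiv> surface_rel g `` {w}"

lemma word_class_mult:
  assumes "u \<in> surface_words g" "v \<in> surface_words g"
  shows "word_class g u \<otimes>\<^bsub>surface_group g\<^esub> word_class g v = word_class g (u @ v)"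
proof -
  have *: "word_class g (u' @ v') = word_class g (u @ v)" if "u' \<in> word_class g u" "v' \<in> word_class g v" for u' v'
  proof -
    have "(u @ v, u' @ v') \<in> surface_rel g"
      using that assms surface_rel_words surface_rel_append_left[of v v' g u'] surface_rel_append_right[of u u' g v]
      by (auto intro: surface_rel.trans)
    then show ?thesis using equiv_class_eq[OF equiv_surface_rel] by metis
  qed
  have "(\<Union>u'\<in>word_class g u. \<Union>v'\<in>word_class g v. word_class g (u' @ v'))
     = (\<Union>u'\<in>word_class g u. \<Union>v'\<in>word_class g v. word_class g (u @ v))"
    by (intro SUP_cong HOL.refl *)
  also have "\<dots> = word_class g (u @ v)"
    using assms equiv_class_self[OF equiv_surface_rel] by blast
  finally show ?thesis by (simp add: surface_group_def)
qed

definition letter_value :: "(surface_gen \<Rightarrow> rat mat) \<Rightarrow> bool \<times> surface_gen \<Rightarrow> rat mat" where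
  "letter_value M = (\<lambda>(e, x). if e then M x else inv\<^bsub>SL2Q\<^esub> (M x))"

fun word_value :: "(surface_gen \<Rightarrow> rat mat) \<Rightarrow> surface_word \<Rightarrow> rat mat" where
  "word_value M [] = 1\<^sub>m 2"
| "word_value M (l # w) = letter_value M l * word_value M w"

lemma letter_value_closed:
  "M ` gens g \<subseteq> carrier SL2Q \<Longrightarrow> x \<in> gens g \<Longrightarrow> letter_value M (e, x) \<in> carrier SL2Q"
  by (auto simp: letter_value_def)

lemma word_value_closed:
  "M ` gens g \<subseteq> carrier SL2Q \<Longrightarrow> w \<in> surface_words g \<Longrightarrow> word_value M w \<in> carrier SL2Q"
proof (induction w)
  case Nil
  then show ?case using SL2Q.one_closed by simp
next
  case (Cons l w)
  then show ?case by (cases l) (simp add: letter_value_closed)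
qed

lemma SL2Q_assoc:
  "a \<in> carrier SL2Q \<Longrightarrow> b \<in> carrier SL2Q \<Longrightarrow> c \<in> carrier SL2Q \<Longrightarrow> a * b * c = a * (b * c)"
  using SL2Q.m_assoc by simp

lemma SL2Q_one_left [simp]: "a \<in> carrier SL2Q \<Longrightarrow> 1\<^sub>m 2 * a = a"
  using SL2Q.l_one by simp

lemma SL2Q_one_right [simp]: "a \<in> carrier SL2Q \<Longrightarrow> a * 1\<^sub>m 2 = a"
  using SL2Q.r_one by simp

lemma word_value_append:
  "M ` gens g \<subseteq> carrier SL2Q \<Longrightarrow> u \<in> surface_words g \<Longrightarrow> v \<in> surface_words g \<Longrightarrow>
    word_value M (u @ v) = word_value M u * word_value M v"
proof (induction u)
  case Nil
  then show ?case using word_value_closed by simp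
next
  case (Cons l u)
  then show ?case
    by (cases l) (simp add: SL2Q_assoc letter_value_closed word_value_closed)
qed

lemma word_value_relator:
  assumes "M ` gens g \<subseteq> carrier SL2Q"
  shows "word_value M (surface_relator g) = relator_value (map (\<lambda>i. (M (GenA i), M (GenB i))) [0..<g])"
proof -
  have "word_value M (concat (map (\<lambda>i. [(True, GenA i), (True, GenB i), (False, GenA i), (False, GenB i)]) is))
     = relator_value (map (\<lambda>i. (M (GenA i), M (GenB i))) is)"
    if "set is \<subseteq> {..<g}" for "is"
    using that
  proof (induction "is")
    case (Cons i js)
    let ?w = "concat (map (\<lambda>i. [(True, GenA i), (True, GenB i), (False, GenA i), (False, GenB i)]) js)"
    have "set js \<subseteq> {..<g} \<Longrightarrow> ?w \<in> surface_words g"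
      by (induction js) (auto simp: gens_def)
    then have "?w \<in> surface_words g" using Cons.prems by simp
    then have "word_value M ?w \<in> carrier SL2Q" using word_value_closed assms by blast
    moreover have "M (GenA i) \<in> carrier SL2Q" "M (GenB i) \<in> carrier SL2Q"
      using assms Cons.prems by (auto simp: gens_def)
    ultimately show ?case using Cons
      by (simp add: letter_value_def comm_mat_def SL2Q_assoc)
  qed simp
  then show ?thesis unfolding surface_relator_def by (simp add: lessThan_atLeast0)
qed

lemma word_value_surface_rel:
  assumes M: "M ` gens g \<subseteq> carrier SL2Q" and R: "word_value M (surface_relator g) = 1\<^sub>m 2"
  shows "(u, v) \<in> surface_rel g \<Longrightarrow> word_value M u = word_value M v"
proof (induction rule: surface_rel.induct)
  case (cancel u e x v)
  then have "x \<in> gens g" "u \<in> surface_words g" "v \<in> surface_words g" by simp_all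
  moreover from this have "M x \<in> carrier SL2Q" using M by auto
  then have "letter_value M (e, x) * letter_value M (\<not> e, x) = 1\<^sub>m 2"
    using SL2Q.r_inv[of "M x"] SL2Q.l_inv[of "M x"] by (simp add: letter_value_def)
  ultimately have "word_value M ([(e, x), (\<not> e, x)] @ v) = word_value M v"
    using letter_value_closed[OF M] word_value_closed[OF M] SL2Q_assoc[symmetric] by simp
  then show ?case using cancel word_value_append[OF M] by simp
next
  case (relator u v)
  then show ?case
    using word_value_append[OF M] surface_relator_words word_value_closed[OF M] R by simp
qed auto

text \<open>
The universal property of the presentation.
\<close>

lemma hom_of_relator_solution:
  assumes M: "M ` gens g \<subseteq> carrier SL2Q" and R: "word_value M (surface_relator g) = 1\<^sub>m 2"
  shows "\<exists>\<rho> \<in> hom (surface_group g) SL2Q. \<forall>w \<in> surface_words g. \<rho> (word_class g w) = word_value M w"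
proof -
  define \<rho> where "\<rho> = (\<lambda>U. the_elem (word_value M ` U))"
  have \<rho>: "\<rho> (word_class g w) = word_value M w" if "w \<in> surface_words g" for w
  proof -
    have "word_value M v = word_value M w" if "v \<in> word_class g w" for v
      using word_value_surface_rel[OF M R, of w v] that by simp
    moreover have "w \<in> word_class g w" using equiv_class_self[OF equiv_surface_rel that] .
    ultimately have "word_value M ` word_class g w = {word_value M w}" by blast
    then show ?thesis by (simp add: \<rho>_def)
  qed
  have "\<rho> \<in> hom (surface_group g) SL2Q"
  proof (rule homI)
    fix U assume "U \<in> carrier (surface_group g)"
    then obtain u where "u \<in> surface_words g" "U = word_class g u"
      by (auto simp: surface_group_def elim: quotientE)
    then show "\<rho> U \<in> carrier SL2Q" using \<rho> word_value_closed[OF M] by simp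
    fix V assume "V \<in> carrier (surface_group g)"
    then obtain v where v: "v \<in> surface_words g" "V = word_class g v"
      by (auto simp: surface_group_def elim: quotientE)
    then show "\<rho> (U \<otimes>\<^bsub>surface_group g\<^esub> V) = \<rho> U \<otimes>\<^bsub>SL2Q\<^esub> \<rho> V"
      using \<open>u \<in> surface_words g\<close> \<open>U = word_class g u\<close> \<rho> word_class_mult word_value_append[OF M] by simp
  qed
  then show ?thesis using \<rho> by blast
qed

text \<open>
Conversely, a representation evaluates words letter by letter, and the relator has the class of
the empty word.
\<close>

lemma hom_word_value:
  assumes \<rho>: "\<rho> \<in> hom (surface_group g) SL2Q"
  defines "M \<equiv> \<lambda>x. \<rho> (word_class g [(True, x)])"
  shows "M ` gens g \<subseteq> carrier SL2Q" "word_value M (surface_relator g) = 1\<^sub>m 2"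
proof -
  have closed: "\<rho> (word_class g w) \<in> carrier SL2Q" if "w \<in> surface_words g" for w
    using hom_in_carrier[OF \<rho>] that by (simp add: surface_group_def quotientI)
  have mult: "\<rho> (word_class g (u @ v)) = \<rho> (word_class g u) * \<rho> (word_class g v)"
    if "u \<in> surface_words g" "v \<in> surface_words g" for u v
    using hom_mult[OF \<rho>, of "word_class g u" "word_class g v"] that
    by (simp add: word_class_mult) (simp add: surface_group_def quotientI)
  show M: "M ` gens g \<subseteq> carrier SL2Q" unfolding M_def using closed by auto
  have one: "\<rho> (word_class g []) = 1\<^sub>m 2"
    using mult[of "[]" "[]"] closed[of "[]"] SL2Q.l_cancel_one[of "\<rho> (word_class g [])" "\<rho> (word_class g [])"] by simp
  have inv: "\<rho> (word_class g [(False, x)]) = inv\<^bsub>SL2Q\<^esub> (M x)" if x: "x \<in> gens g" for x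
  proof -
    have "([(True, x), (False, x)], []) \<in> surface_rel g"
      using surface_rel.cancel[of "[]" True x "[]" g] x by simp
    then have "word_class g [(True, x), (False, x)] = word_class g []"
      using equiv_class_eq[OF equiv_surface_rel] by metis
    then have "M x * \<rho> (word_class g [(False, x)]) = 1\<^sub>m 2"
      using mult[of "[(True, x)]" "[(False, x)]"] x one by (simp add: M_def)
    then show ?thesis using SL2Q_inverse_unique M closed[of "[(False, x)]"] x by auto
  qed
  have val: "\<rho> (word_class g w) = word_value M w" if "w \<in> surface_words g" for w
    using that
  proof (induction w)
    case Nil
    then show ?case using one by simp
  next
    case (Cons l w)
    obtain e x where l: "l = (e, x)" by force
    then have "x \<in> gens g" "w \<in> surface_words g" using Cons.prems by auto
    moreover from this have "\<rho> (word_class g [(e, x)]) = letter_value M (e, x)"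
      using inv by (cases e) (simp_all add: letter_value_def M_def)
    ultimately show ?case using mult[of "[(e, x)]" w] Cons.IH l by simp
  qed
  have "(surface_relator g, []) \<in> surface_rel g"
    using surface_rel.relator[of "[]" "[]" g] by simp
  then have "word_class g (surface_relator g) = word_class g []"
    using equiv_class_eq[OF equiv_surface_rel] by metis
  then show "word_value M (surface_relator g) = 1\<^sub>m 2"
    using val[OF surface_relator_words] one by simp
qed

lemma witt_class_chain:
  assumes "\<And>i. i < g \<Longrightarrow> \<rho> (loop_a g i) \<in> carrier SL2Q" "\<And>i. i < g \<Longrightarrow> \<rho> (loop_b g i) \<in> carrier SL2Q"
  shows "witt_class g \<rho> = Rep_witt (chain_class (surface_chain (map (\<lambda>i. (\<rho> (loop_a g i), \<rho> (loop_b g i))) [0..<g])))"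
  using prod_commutators_witt_ext[OF assms] by (simp add: witt_class_def)

theorem theoremC:
  fixes g :: nat
  assumes "g \<ge> 1"
  shows "{witt_class g \<rho> | \<rho>. \<rho> \<in> hom (surface_group g) SL2Q}
       = {x \<in> fundamental_ideal_sq. witt_norm x \<le> 4 * (g - 1)}"
proof (intro Set.set_eqI iffI)
  fix x assume "x \<in> {witt_class g \<rho> | \<rho>. \<rho> \<in> hom (surface_group g) SL2Q}"
  then obtain \<rho> where \<rho>: "\<rho> \<in> hom (surface_group g) SL2Q" and x: "x = witt_class g \<rho>" by blast
  define M where "M = (\<lambda>y. \<rho> (word_class g [(True, y)]))"
  have M: "M ` gens g \<subseteq> carrier SL2Q" "word_value M (surface_relator g) = 1\<^sub>m 2"
    using hom_word_value[OF \<rho>] by (simp_all add: M_def)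
  have loops: "\<rho> (loop_a g i) = M (GenA i)" "\<rho> (loop_b g i) = M (GenB i)" for i
    by (simp_all add: loop_a_def loop_b_def M_def)
  have MS: "M (GenA i) \<in> carrier SL2Q" "M (GenB i) \<in> carrier SL2Q" if "i < g" for i
    using M(1) that by (auto simp: gens_def)
  define ps where "ps = map (\<lambda>i. (M (GenA i), M (GenB i))) [0..<g]"
  have "ps \<noteq> []" "set ps \<subseteq> SL2_pairs" "relator_value ps = 1\<^sub>m 2" "length ps = g"
    using assms MS M word_value_relator[OF M(1)] by (auto simp: ps_def)
  note bound = chain_class_bound[OF this(1-3), unfolded this(4)]
  have "x = Rep_witt (chain_class (surface_chain ps))"
    unfolding x using witt_class_chain[of g \<rho>] MS by (simp add: loops ps_def)
  then show "x \<in> {x \<in> fundamental_ideal_sq. witt_norm x \<le> 4 * (g - 1)}"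
    using bound by (simp add: fundamental_ideal_sq_eq witt_norm_le_iff)
next
  fix x assume "x \<in> {x \<in> fundamental_ideal_sq. witt_norm x \<le> 4 * (g - 1)}"
  then obtain y where y: "x = Rep_witt y" "y \<in> witt_I2" "witt_norm (Rep_witt y) \<le> 4 * (g - 1)"
    by (auto simp: fundamental_ideal_sq_eq)
  then obtain xs where xs: "0 \<notin> set xs" "length xs \<le> 4 * (g - 1)" "y = diag_class xs"
    using witt_norm_le_iff by blast
  then have "trivial_disc xs" using y(2) diag_class_witt_I2_iff by blast
  from closed_surface_realization[OF this xs(2) assms] obtain ps where
    ps: "length ps = g" "set ps \<subseteq> SL2_pairs" "relator_value ps = 1\<^sub>m 2"
      "chain_class (surface_chain ps) = diag_class xs" by blast
  define M where "M = (\<lambda>l. case l of GenA i \<Rightarrow> fst (ps ! i) | GenB i \<Rightarrow> snd (ps ! i))"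
  have M: "M ` gens g \<subseteq> carrier SL2Q"
    using ps(1,2) nth_mem by (fastforce simp: M_def gens_def)
  have mp: "map (\<lambda>i. (M (GenA i), M (GenB i))) [0..<g] = ps"
    using ps(1) by (intro nth_equalityI) (auto simp: M_def)
  have "word_value M (surface_relator g) = 1\<^sub>m 2" using word_value_relator[OF M] mp ps(3) by simp
  from hom_of_relator_solution[OF M this] obtain \<rho> where \<rho>: "\<rho> \<in> hom (surface_group g) SL2Q"
    and val: "\<And>w. w \<in> surface_words g \<Longrightarrow> \<rho> (word_class g w) = word_value M w" by blast
  have loops: "\<rho> (loop_a g i) = M (GenA i)" "\<rho> (loop_b g i) = M (GenB i)" if "i < g" for i
  proof -
    have "GenA i \<in> gens g" "GenB i \<in> gens g" using that by (auto simp: gens_def)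
    then show "\<rho> (loop_a g i) = M (GenA i)" "\<rho> (loop_b g i) = M (GenB i)"
      using val M by (auto simp: loop_a_def loop_b_def letter_value_def image_subset_iff)
  qed
  have "\<And>i. i < g \<Longrightarrow> M (GenA i) \<in> carrier SL2Q" "\<And>i. i < g \<Longrightarrow> M (GenB i) \<in> carrier SL2Q"
    using M by (auto simp: gens_def)
  moreover have "map (\<lambda>i. (\<rho> (loop_a g i), \<rho> (loop_b g i))) [0..<g] = ps"
    unfolding mp[symmetric] using loops by simp
  ultimately have "witt_class g \<rho> = x"
    using witt_class_chain[of g \<rho>] loops ps(4) xs(3) y(1) by simp
  then show "x \<in> {witt_class g \<rho> | \<rho>. \<rho> \<in> hom (surface_group g) SL2Q}" using \<rho> by blast
qed

end
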